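(* Let $S$ be a semitopological semigroup and let $X$ be a semitopological $S$-flow. For a function $f\in C(X)$ the following conditions are equivalent: (i) $f: X\to\mathbb{R}$ is weakly almost periodic, i.e. $f\in \mathrm{WAP}_S(X)$. (ii) There exist a reflexive Banach space $V$, a weakly continuous antihomomorphism $h: S\to\Theta(V)$, a weakly continuous equivariant map $\alpha: X\to B(V^* )$, and a vector $v\in V$ such that $f(x)=\langle v,\alpha(x)\rangle$ for all $x\in X$. (iii) The same as (ii), but with no continuity assumption on $h$: there exist a reflexive Banach space $V$, an antihomomorphism $h: S\to\Theta(V)$, a weakly continuous equivariant map $\alpha: X\to B(V^* )$, and a vector $v\in V$ such that $f(x)=\langle v,\alpha(x)\rangle$ for all $x\in X$. Moreover, if either (a) $S=G$ is a semitopological group, or (b) $X$ is compact and the action $S\times X\to X$ is jointly continuous, then in (ii) one can suppose that $h$ is strongly continuous.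
   Context: A semitopological semigroup (group) is a semigroup (group) with a topology for which multiplication is separately continuous. For such $S$, a semitopological $S$-flow is a topological space $X$ with a separately continuous left action $S\times X\to X$, $s_1(s_2x)=(s_1s_2)x$; if $S$ is a monoid, its identity acts as the identity transformation (this convention also applies to actions on Banach spaces). "Compact" means compact Hausdorff. Banach spaces are real. $C(X)$ is the Banach algebra of bounded continuous real functions on $X$ with the sup norm; for $f\in C(X)$, $s\in S$ put $(fs)(x)=f(sx)$ and $fS=\{fs: s\in S\}$. $f$ is weakly almost periodic ($f\in\mathrm{WAP}_S(X)$) if $fS$ is relatively weakly compact in $C(X)$. For a Banach space $V$: $\Theta(V)=\{\sigma\in L(V,V):\|\sigma\|\le 1\}$, and $B(V^* )$ is the closed unit ball of $V^*$. An antihomomorphism $h:S\to\Theta(V)$ (that is, $h(st)=h(t)h(s)$) defines a right action $vs:=h(s)(v)$ on $V$ and a left dual action on $V^*$ by $\langle v,s\psi\rangle=\langle vs,\psi\rangle$; $\alpha:X\to B(V^* )$ is equivariant if $\alpha(sx)=s\,\alpha(x)$. $h$ is weakly (strongly) continuous if it is continuous for the weak (strong) operator topology on $\Theta(V)$. *)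

theory Defs
  imports "HOL-Analysis.Analysis"
begin

section \<open>Real Banach spaces on a carrier set\<close>

text \<open>
  The theorem asserts the existence of a Banach space. HOL cannot quantify existentially over
  types, so Banach spaces are structures on a carrier set rather than instances of
  class \<^class>\<open>banach\<close>. An existential still fixes the type containing the carrier; for a flow on
  \<open>'x\<close> the type \<open>'x \<Rightarrow>\<^sub>C real\<close> is large enough, since \<open>V\<close> modulo the common kernel of the functionals
  \<open>\<alpha>(x)\<close> maps injectively into \<open>C(X)\<close>. The implication from representability to weak almost
  periodicity is stated separately for carriers in an arbitrary type.
\<close>

record 'v normed_structure =
  vcarrier :: "'v set"
  vzero :: 'v
  vadd :: "'v \<Rightarrow> 'v \<Rightarrow> 'v"
  vscale :: "real \<Rightarrow> 'v \<Rightarrow> 'v"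
  vnorm :: "'v \<Rightarrow> real"

definition vdiff :: "'v normed_structure \<Rightarrow> 'v \<Rightarrow> 'v \<Rightarrow> 'v" where
  "vdiff V x y = vadd V x (vscale V (-1) y)"

definition real_vector_space_on :: "'v normed_structure \<Rightarrow> bool" where
  "real_vector_space_on V \<longleftrightarrow>
     vzero V \<in> vcarrier V \<and>
     (\<forall>x\<in>vcarrier V. \<forall>y\<in>vcarrier V. vadd V x y \<in> vcarrier V) \<and>
     (\<forall>a. \<forall>x\<in>vcarrier V. vscale V a x \<in> vcarrier V) \<and>
     (\<forall>x\<in>vcarrier V. \<forall>y\<in>vcarrier V. \<forall>z\<in>vcarrier V.
        vadd V (vadd V x y) z = vadd V x (vadd V y z)) \<and>
     (\<forall>x\<in>vcarrier V. \<forall>y\<in>vcarrier V. vadd V x y = vadd V y x) \<and>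
     (\<forall>x\<in>vcarrier V. vadd V (vzero V) x = x) \<and>
     (\<forall>x\<in>vcarrier V. vdiff V x x = vzero V) \<and>
     (\<forall>a. \<forall>x\<in>vcarrier V. \<forall>y\<in>vcarrier V.
        vscale V a (vadd V x y) = vadd V (vscale V a x) (vscale V a y)) \<and>
     (\<forall>a b. \<forall>x\<in>vcarrier V. vscale V (a + b) x = vadd V (vscale V a x) (vscale V b x)) \<and>
     (\<forall>a b. \<forall>x\<in>vcarrier V. vscale V a (vscale V b x) = vscale V (a * b) x) \<and>
     (\<forall>x\<in>vcarrier V. vscale V 1 x = x)"

definition normed_space_on :: "'v normed_structure \<Rightarrow> bool" where
  "normed_space_on V \<longleftrightarrow>
     real_vector_space_on V \<and>
     (\<forall>x\<in>vcarrier V. vnorm V x \<ge> 0) \<and>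
     (\<forall>x\<in>vcarrier V. vnorm V x = 0 \<longleftrightarrow> x = vzero V) \<and>
     (\<forall>x\<in>vcarrier V. \<forall>y\<in>vcarrier V. vnorm V (vadd V x y) \<le> vnorm V x + vnorm V y) \<and>
     (\<forall>a. \<forall>x\<in>vcarrier V. vnorm V (vscale V a x) = \<bar>a\<bar> * vnorm V x)"

definition banach_space_on :: "'v normed_structure \<Rightarrow> bool" where
  "banach_space_on V \<longleftrightarrow>
     normed_space_on V \<and>
     (\<forall>\<sigma> :: nat \<Rightarrow> 'v.
        range \<sigma> \<subseteq> vcarrier V \<and>
        (\<forall>\<epsilon>>0. \<exists>N. \<forall>m\<ge>N. \<forall>n\<ge>N. vnorm V (vdiff V (\<sigma> m) (\<sigma> n)) < \<epsilon>) \<longrightarrow>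
        (\<exists>l\<in>vcarrier V. (\<lambda>n. vnorm V (vdiff V (\<sigma> n) l)) \<longlonglongrightarrow> 0))"

text \<open>
  Functionals, and operators below, are made extensional, i.e. \<^const>\<open>undefined\<close> outside the
  carrier, so that equality on the carrier is equality.
\<close>

definition dual_carrier :: "'v normed_structure \<Rightarrow> ('v \<Rightarrow> real) set" where
  "dual_carrier V =
     {\<phi> \<in> extensional (vcarrier V).
        (\<forall>x\<in>vcarrier V. \<forall>y\<in>vcarrier V. \<phi> (vadd V x y) = \<phi> x + \<phi> y) \<and>
        (\<forall>a. \<forall>x\<in>vcarrier V. \<phi> (vscale V a x) = a * \<phi> x) \<and>
        (\<exists>C. \<forall>x\<in>vcarrier V. \<bar>\<phi> x\<bar> \<le> C * vnorm V x)}"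

definition dual_space :: "'v normed_structure \<Rightarrow> ('v \<Rightarrow> real) normed_structure" where
  "dual_space V =
     \<lparr> vcarrier = dual_carrier V,
       vzero = (\<lambda>x\<in>vcarrier V. 0),
       vadd = (\<lambda>\<phi> \<psi>. \<lambda>x\<in>vcarrier V. \<phi> x + \<psi> x),
       vscale = (\<lambda>a \<phi>. \<lambda>x\<in>vcarrier V. a * \<phi> x),
       vnorm = (\<lambda>\<phi>. SUP x\<in>{x\<in>vcarrier V. vnorm V x \<le> 1}. \<bar>\<phi> x\<bar>) \<rparr>"

definition dual_ball :: "'v normed_structure \<Rightarrow> ('v \<Rightarrow> real) set" where
  "dual_ball V = {\<psi> \<in> vcarrier (dual_space V). vnorm (dual_space V) \<psi> \<le> 1}"

text \<open>Reflexivity: the canonical embedding into the bidual is onto.\<close>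

definition reflexive_banach_space_on :: "'v normed_structure \<Rightarrow> bool" where
  "reflexive_banach_space_on V \<longleftrightarrow>
     banach_space_on V \<and>
     (\<lambda>v. \<lambda>\<phi>\<in>vcarrier (dual_space V). \<phi> v) ` vcarrier V = vcarrier (dual_space (dual_space V))"

definition weak_topology :: "'v normed_structure \<Rightarrow> 'v topology" where
  "weak_topology V =
     topology_generated_by
       {{v \<in> vcarrier V. \<phi> v \<in> U} |\<phi> U. \<phi> \<in> vcarrier (dual_space V) \<and> open U}"

definition contractions :: "'v normed_structure \<Rightarrow> ('v \<Rightarrow> 'v) set" where
  "contractions V =
     {\<sigma> \<in> vcarrier V \<rightarrow>\<^sub>E vcarrier V.
        (\<forall>x\<in>vcarrier V. \<forall>y\<in>vcarrier V. \<sigma> (vadd V x y) = vadd V (\<sigma> x) (\<sigma> y)) \<and>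
        (\<forall>a. \<forall>x\<in>vcarrier V. \<sigma> (vscale V a x) = vscale V a (\<sigma> x)) \<and>
        (\<forall>x\<in>vcarrier V. vnorm V (\<sigma> x) \<le> vnorm V x)}"

definition weak_op_topology :: "'v normed_structure \<Rightarrow> ('v \<Rightarrow> 'v) topology" where
  "weak_op_topology V =
     topology_generated_by
       {{\<sigma> \<in> contractions V. \<phi> (\<sigma> v) \<in> U} |v \<phi> U.
          v \<in> vcarrier V \<and> \<phi> \<in> vcarrier (dual_space V) \<and> open U}"

definition strong_op_topology :: "'v normed_structure \<Rightarrow> ('v \<Rightarrow> 'v) topology" where
  "strong_op_topology V =
     topology_generated_by
       {{\<sigma> \<in> contractions V. vnorm V (vdiff V (\<sigma> v) w) < r} |v w r.
          v \<in> vcarrier V \<and> w \<in> vcarrier V}"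

text \<open>Used to regard \<open>C(X)\<close>, the type \<open>'x \<Rightarrow>\<^sub>C real\<close>, as such a structure.\<close>

definition space_of_type :: "'a::real_normed_vector normed_structure" where
  "space_of_type = \<lparr> vcarrier = UNIV, vzero = 0, vadd = (+), vscale = (*\<^sub>R), vnorm = norm \<rparr>"


section \<open>Semitopological semigroups, groups and flows\<close>

class semitopological_semigroup = semigroup_mult + topological_space +
  assumes continuous_mult_left: "open U \<Longrightarrow> open ((\<lambda>t. s * t) -` U)"
    and continuous_mult_right: "open U \<Longrightarrow> open ((\<lambda>t. t * s) -` U)"

text \<open>
  A monoid is a semigroup with a (unique) \<open>is_identity\<close> element; actions, including those on Banach
  spaces, are required to send it, when it exists, to the identity transformation.
\<close>

definition is_identity :: "'s::semigroup_mult \<Rightarrow> bool" where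
  "is_identity e \<longleftrightarrow> (\<forall>s. e * s = s \<and> s * e = s)"

definition is_group :: "'s::semigroup_mult itself \<Rightarrow> bool" where
  "is_group _ \<longleftrightarrow> (\<exists>e::'s. is_identity e \<and> (\<forall>s. \<exists>t. s * t = e \<and> t * s = e))"

definition semitopological_flow ::
    "('s::semitopological_semigroup \<Rightarrow> 'x::topological_space \<Rightarrow> 'x) \<Rightarrow> bool" where
  "semitopological_flow act \<longleftrightarrow>
     (\<forall>s. continuous_on UNIV (\<lambda>x. act s x)) \<and>
     (\<forall>x. continuous_on UNIV (\<lambda>s. act s x)) \<and>
     (\<forall>s t x. act s (act t x) = act (s * t) x) \<and>
     (\<forall>e. is_identity e \<longrightarrow> (\<forall>x. act e x = x))"

definition translate :: "('s \<Rightarrow> 'x \<Rightarrow> 'x) \<Rightarrow> ('x::topological_space \<Rightarrow>\<^sub>C real) \<Rightarrow> 's \<Rightarrow> ('x \<Rightarrow>\<^sub>C real)" where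
  "translate act f s = Bcontfun (\<lambda>x. apply_bcontfun f (act s x))"

lemma apply_translate:
  assumes "semitopological_flow act"
  shows "apply_bcontfun (translate act f s) x = apply_bcontfun f (act s x)"
proof -
  have "continuous_on UNIV (act s)"
    using assms by (simp add: semitopological_flow_def)
  then have "continuous_on UNIV (\<lambda>x. apply_bcontfun f (act s x))"
    by (rule continuous_on_compose2[OF continuous_on_apply_bcontfun[of UNIV f]]) simp
  then have "(\<lambda>x. apply_bcontfun f (act s x)) \<in> bcontfun"
    by (rule bcontfun_normI) (rule norm_bounded)
  then show ?thesis
    by (simp add: translate_def Bcontfun_inverse)
qed

definition weakly_almost_periodic :: "('s \<Rightarrow> 'x \<Rightarrow> 'x) \<Rightarrow> ('x::topological_space \<Rightarrow>\<^sub>C real) \<Rightarrow> bool" where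
  "weakly_almost_periodic act f \<longleftrightarrow>
     compactin (weak_topology space_of_type)
       (weak_topology space_of_type closure_of range (translate act f))"


section \<open>Representations of flows\<close>

definition antihomomorphism :: "'v normed_structure \<Rightarrow> ('s::semigroup_mult \<Rightarrow> 'v \<Rightarrow> 'v) \<Rightarrow> bool" where
  "antihomomorphism V h \<longleftrightarrow>
     (\<forall>s. h s \<in> contractions V) \<and>
     (\<forall>s t. h (s * t) = compose (vcarrier V) (h t) (h s)) \<and>
     (\<forall>e. is_identity e \<longrightarrow> h e = (\<lambda>v\<in>vcarrier V. v))"

definition dual_action ::
    "'v normed_structure \<Rightarrow> ('s \<Rightarrow> 'v \<Rightarrow> 'v) \<Rightarrow> 's \<Rightarrow> ('v \<Rightarrow> real) \<Rightarrow> ('v \<Rightarrow> real)" where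
  "dual_action V h s \<psi> = (\<lambda>v\<in>vcarrier V. \<psi> (h s v))"

text \<open>
  The data common to all representability conditions; continuity of \<open>h\<close> is not included.
\<close>

definition reflexive_representation ::
    "('s::semigroup_mult \<Rightarrow> 'x \<Rightarrow> 'x) \<Rightarrow> ('x::topological_space \<Rightarrow>\<^sub>C real) \<Rightarrow> 'v normed_structure
      \<Rightarrow> ('s \<Rightarrow> 'v \<Rightarrow> 'v) \<Rightarrow> ('x \<Rightarrow> 'v \<Rightarrow> real) \<Rightarrow> 'v \<Rightarrow> bool" where
  "reflexive_representation act f V h \<alpha> v \<longleftrightarrow>
     reflexive_banach_space_on V \<and>
     antihomomorphism V h \<and>
     continuous_map euclidean (subtopology (weak_topology (dual_space V)) (dual_ball V)) \<alpha> \<and>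
     (\<forall>s x. \<alpha> (act s x) = dual_action V h s (\<alpha> x)) \<and>
     v \<in> vcarrier V \<and>
     (\<forall>x. apply_bcontfun f x = \<alpha> x v)"

definition weakly_continuous ::
    "'v normed_structure \<Rightarrow> ('s::topological_space \<Rightarrow> 'v \<Rightarrow> 'v) \<Rightarrow> bool" where
  "weakly_continuous V h \<longleftrightarrow> continuous_map euclidean (weak_op_topology V) h"

definition strongly_continuous ::
    "'v normed_structure \<Rightarrow> ('s::topological_space \<Rightarrow> 'v \<Rightarrow> 'v) \<Rightarrow> bool" where
  "strongly_continuous V h \<longleftrightarrow> continuous_map euclidean (strong_op_topology V) h"

end

theory Submission
  imports Defs
begin

text \<open>
  If \<open>f(x) = \<langle>v, \<alpha>(x)\<rangle>\<close> with \<open>V\<close> reflexive, the orbit of \<open>f\<close> lies in the image of a ball of \<open>V\<close> under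
  \<open>u \<mapsto> \<langle>u, \<alpha>(\<cdot>)\<rangle>\<close>, and balls of \<open>V\<close> are weakly compact.

  Conversely, let \<open>W\<close> be the symmetric convex hull of (a multiple of) the orbit of \<open>f\<close> together with
  \<open>f\<close>. By Krein's theorem \<open>W\<close> is relatively weakly compact in \<open>C(X)\<close>. The interpolation space of
  Davis, Figiel, Johnson and Pelczynski, with \<open>\<ell>\<^sup>2\<close>-norm built from the K-functionals of the pair
  \<open>(span W, C(X))\<close>, is then a reflexive \<open>V \<subseteq> C(X)\<close> containing \<open>f\<close>; it is invariant under
  translations, which act as contractions, and \<open>\<alpha>\<close> is point evaluation. Reflexivity rests on two facts:
  the ball of \<open>V\<close> is weakly compact in \<open>C(X)\<close>, and on that ball every functional of \<open>V\<^sup>*\<close> is continuous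
  for the sup norm, hence by Mazur's theorem compatible with weak limits taken in \<open>C(X)\<close>. The second
  fact also gives weak continuity of the translations, since orbit maps are pointwise continuous.

  Because of the \<open>\<ell>\<^sup>2\<close>-sum, strong continuity on \<open>V\<close> follows from continuity of \<open>s \<mapsto> fs\<close> in the sup
  norm. This is immediate if \<open>X\<close> is compact and the action jointly continuous. For a group it holds
  because the relatively weakly compact orbit has nonempty pointwise open pieces of arbitrarily small
  norm diameter, which translations carry isometrically to every point of the orbit.

  Relative weak compactness is expressed through ultrafilters, so that all limits of bounded functions exist.
\<close>

section \<open>Ultrafilters\<close>

text \<open>Krein's theorem is commonly proved by integrating against measures and using dominated
  convergence. A limit of convex combinations is here only a finitely additive mean, for which
  dominated convergence fails in general. What survives is a second-moment estimate; it produces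
  functionals and points of the generating set whose two iterated limits differ, against
  Grothendieck's double limit criterion. The interpolation norm is handled through finite sections
  of the l2-sum. Its balls are therefore closed for the ambient norm, which gives completeness.
  Instead of describing the dual of the l2-sum, the proof of reflexivity tests a functional near a
  point where its norm is almost attained and uses only the quadratic growth of the l2-norm. The
  orbit is scaled into the unit ball so that the interpolation norm dominates the sup norm; point
  evaluations then have norm at most 1.\<close>

lemma Zorn_minimal:
  fixes A :: "'a::order set"
  assumes "A \<noteq> {}"
    and chain: "\<And>C. C \<subseteq> A \<Longrightarrow> C \<noteq> {} \<Longrightarrow> (\<And>x y. x \<in> C \<Longrightarrow> y \<in> C \<Longrightarrow> x \<le> y \<or> y \<le> x) \<Longrightarrow>
      \<exists>u\<in>A. \<forall>c\<in>C. u \<le> c"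
  shows "\<exists>m\<in>A. \<forall>a\<in>A. a \<le> m \<longrightarrow> a = m"
proof (rule predicate_Zorn)
  show "partial_order_on A (relation_of (\<lambda>x y. y \<le> x) A)"
    by (rule partial_order_on_relation_ofI) auto
next
  fix C assume C: "C \<in> Chains (relation_of (\<lambda>x y. y \<le> x) A)"
  show "\<exists>u\<in>A. \<forall>a\<in>C. u \<le> a"
  proof (cases "C = {}")
    case True then show ?thesis using assms(1) by auto
  next
    case False
    then show ?thesis
      using C by (intro chain) (auto simp: Chains_def relation_of_def)
  qed
qed

definition ultrafilter :: "'a filter \<Rightarrow> bool" where
  "ultrafilter F \<longleftrightarrow> F \<noteq> bot \<and> (\<forall>P. eventually P F \<or> eventually (\<lambda>x. \<not> P x) F)"

lemma ultrafilter_not_bot: "ultrafilter F \<Longrightarrow> F \<noteq> bot"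
  by (simp add: ultrafilter_def)

lemma ultrafilter_not_eventually:
  "ultrafilter F \<Longrightarrow> \<not> eventually P F \<Longrightarrow> eventually (\<lambda>x. \<not> P x) F"
  by (auto simp: ultrafilter_def)

lemma ultrafilter_filtermap: "ultrafilter F \<Longrightarrow> ultrafilter (filtermap g F)"
  by (auto simp: ultrafilter_def eventually_filtermap filtermap_bot_iff)

lemma ultrafilter_exists:
  assumes "F \<noteq> bot"
  obtains G where "G \<le> F" "ultrafilter G"
proof -
  let ?A = "{G. G \<noteq> bot \<and> G \<le> F}"
  have "\<exists>m\<in>?A. \<forall>a\<in>?A. a \<le> m \<longrightarrow> a = m"
  proof (rule Zorn_minimal)
    show "?A \<noteq> {}" using assms by auto
  next
    fix C assume C: "C \<subseteq> ?A" "C \<noteq> {}" and ch: "\<And>x y. x \<in> C \<Longrightarrow> y \<in> C \<Longrightarrow> x \<le> y \<or> y \<le> x"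
    \<comment> \<open>The infimum of a chain of filters has as its events the union of the members'
      events, so it stays proper.\<close>
    have ev: "eventually P (Inf C) \<longleftrightarrow> (\<exists>b\<in>C. eventually P b)" for P
      by (rule eventually_Inf_base) (use C ch in \<open>auto simp: le_inf_iff\<close>)
    have "Inf C \<noteq> bot"
      using C ev[of "\<lambda>_. False"] by (auto simp: trivial_limit_def)
    moreover have "Inf C \<le> F"
      using C by (metis (mono_tags, lifting) Inf_lower2 equals0I mem_Collect_eq subsetD)
    ultimately show "\<exists>u\<in>?A. \<forall>c\<in>C. u \<le> c"
      by (intro bexI[of _ "Inf C"]) (auto intro: Inf_lower)
  qed
  then obtain G where G: "G \<noteq> bot" "G \<le> F" and min: "\<And>H. H \<noteq> bot \<Longrightarrow> H \<le> F \<Longrightarrow> H \<le> G \<Longrightarrow> H = G"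
    by auto
  have "eventually P G" if "\<not> eventually (\<lambda>x. \<not> P x) G" for P
  proof -
    \<comment> \<open>Refining \<open>G\<close> by a set compatible with it leaves a proper filter,
      so minimality puts that set into \<open>G\<close> already.\<close>
    let ?H = "inf G (principal {x. P x})"
    have "?H \<noteq> bot"
      using that by (auto simp: trivial_limit_def eventually_inf_principal)
    then have "?H = G"
      using G by (intro min) (auto intro: le_infI1)
    moreover have "eventually P ?H"
      by (auto simp: eventually_inf_principal)
    ultimately show ?thesis by simp
  qed
  then have "ultrafilter G"
    using G unfolding ultrafilter_def by blast
  with G that show ?thesis by blast
qed

text \<open>The conditions are indexed by a whole type, so side constraints on the index are passed
  as implications inside \<open>P\<close>. With pairs (point, tolerance) as indices this takes the
  place of nets.\<close>

lemma ultrafilter_finite_intersection: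
  assumes "\<And>J. finite J \<Longrightarrow> \<exists>x. \<forall>j\<in>J. P j x"
  obtains G where "ultrafilter G" "\<And>j. eventually (P j) G"
proof -
  have "(INF j. principal {x. P j x}) \<noteq> bot"
  proof (rule INF_filter_not_bot)
    fix J :: "'a set" assume "finite J"
    then show "(INF j\<in>J. principal {x. P j x}) \<noteq> bot"
      using assms[of J] by (auto simp: INF_principal_finite principal_eq_bot_iff)
  qed
  then obtain G where G: "G \<le> (INF j. principal {x. P j x})" "ultrafilter G"
    by (rule ultrafilter_exists)
  have "eventually (P j) G" for j
    by (rule filter_leD[OF G(1)], rule eventually_INF1[of j]) (auto simp: eventually_principal)
  with G that show ?thesis by blast
qed

text \<open>A failing neighbourhood has a complement compatible with \<open>F\<close>, and an
  ultrafilter refining both violates the assumption. The gain is that along ultrafilters compactness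
  supplies a limit, which only has to be identified.\<close>

lemma tendsto_ultrafilterI:
  assumes "\<And>G. ultrafilter G \<Longrightarrow> G \<le> F \<Longrightarrow> (g \<longlongrightarrow> l) G"
  shows "(g \<longlongrightarrow> l) F"
proof (rule topological_tendstoI, rule ccontr)
  fix U assume U: "open U" "l \<in> U" and n: "\<not> eventually (\<lambda>x. g x \<in> U) F"
  have "inf F (principal {x. g x \<notin> U}) \<noteq> bot"
    using n by (auto simp: trivial_limit_def eventually_inf_principal)
  then obtain G where G: "G \<le> inf F (principal {x. g x \<notin> U})" "ultrafilter G"
    by (rule ultrafilter_exists)
  then have "(g \<longlongrightarrow> l) G"
    using assms by simp
  then have "eventually (\<lambda>x. g x \<in> U) G"
    using U by (rule topological_tendstoD)
  moreover have "eventually (\<lambda>x. g x \<notin> U) G"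
    using G(1) by (simp add: le_principal)
  ultimately show False
    using G(2) eventually_conj[of "\<lambda>x. g x \<in> U" G "\<lambda>x. g x \<notin> U"]
    by (auto simp: ultrafilter_def trivial_limit_def)
qed

lemma ultrafilter_compact_limit:
  assumes "ultrafilter G" "compact K" "eventually (\<lambda>x. g x \<in> K) G"
  obtains l where "l \<in> K" "(g \<longlongrightarrow> l) G"
proof -
  have u: "ultrafilter (filtermap g G)"
    by (rule ultrafilter_filtermap) fact
  obtain l where l: "l \<in> K" "inf (nhds l) (filtermap g G) \<noteq> bot"
    using assms(2,3) u unfolding compact_filter by (auto simp: eventually_filtermap ultrafilter_def)
  have "(g \<longlongrightarrow> l) G"
  proof (rule topological_tendstoI, rule ccontr)
    fix U assume "open U" "l \<in> U" "\<not> eventually (\<lambda>x. g x \<in> U) G"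
    then have "eventually (\<lambda>x. x \<in> U) (nhds l)" "eventually (\<lambda>x. x \<notin> U) (filtermap g G)"
      using assms(1) by (auto intro: eventually_nhds_in_open simp: eventually_filtermap ultrafilter_def)
    then have "eventually (\<lambda>x. False) (inf (nhds l) (filtermap g G))"
      unfolding eventually_inf by blast
    with l(2) show False by (simp add: trivial_limit_def)
  qed
  with l that show ?thesis by blast
qed

text \<open>Naming the limit \<open>Lim G g\<close> allows functionals to be defined as limits
  without a choice for each argument.\<close>

lemma ultrafilter_bounded_tendsto_Lim:
  fixes g :: "'a \<Rightarrow> real"
  assumes "ultrafilter G" "eventually (\<lambda>x. \<bar>g x\<bar> \<le> B) G"
  shows "(g \<longlongrightarrow> Lim G g) G"
proof -
  have "eventually (\<lambda>x. g x \<in> {-B..B}) G"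
    using assms(2) by eventually_elim auto
  then obtain l where "(g \<longlongrightarrow> l) G"
    using ultrafilter_compact_limit[OF assms(1) compact_Icc] by blast
  moreover from this have "Lim G g = l"
    by (rule tendsto_Lim[OF ultrafilter_not_bot[OF assms(1)]])
  ultimately show ?thesis by simp
qed


section \<open>The Mazur--Orlicz theorem\<close>

definition sublinear :: "('a::real_vector \<Rightarrow> real) \<Rightarrow> bool" where
  "sublinear p \<longleftrightarrow> (\<forall>x y. p (x + y) \<le> p x + p y) \<and> (\<forall>t x. 0 \<le> t \<longrightarrow> p (t *\<^sub>R x) = t * p x)"

lemma sublinearI:
  assumes "\<And>x y. p (x + y) \<le> p x + p y" "\<And>t x. 0 < t \<Longrightarrow> p (t *\<^sub>R x) \<le> t * p x" "p 0 = 0"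
  shows "sublinear p"
proof -
  have "p (t *\<^sub>R x) = t * p x" if t: "0 \<le> t" for t x
  proof (cases "t = 0")
    case False
    with t have "0 < t" by simp
    then have "p ((1/t) *\<^sub>R (t *\<^sub>R x)) \<le> (1/t) * p (t *\<^sub>R x)"
      by (intro assms(2)) auto
    then have "t * p x \<le> p (t *\<^sub>R x)"
      using \<open>0 < t\<close> by (simp add: field_simps)
    with assms(2)[OF \<open>0 < t\<close>, of x] show ?thesis by simp
  qed (use assms(3) in auto)
  with assms(1) show ?thesis
    by (simp add: sublinear_def)
qed

lemma sublinear_add: "sublinear p \<Longrightarrow> p (x + y) \<le> p x + p y"
  and sublinear_scale: "sublinear p \<Longrightarrow> 0 \<le> t \<Longrightarrow> p (t *\<^sub>R x) = t * p x"
  by (auto simp: sublinear_def)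

lemma sublinear_0: "sublinear p \<Longrightarrow> p 0 = 0"
  using sublinear_scale[of p 0 0] by simp

lemma sublinear_ge: "sublinear p \<Longrightarrow> - p (- x) \<le> p x"
  using sublinear_add[of p x "-x"] sublinear_0[of p] by simp

lemma sublinear_plus: "sublinear p \<Longrightarrow> sublinear q \<Longrightarrow> sublinear (\<lambda>x. p x + q x)"
proof (rule sublinearI)
  fix x y assume p: "sublinear p" and q: "sublinear q"
  show "p (x + y) + q (x + y) \<le> p x + q x + (p y + q y)"
    using sublinear_add[OF p, of x y] sublinear_add[OF q, of x y] by simp
qed (auto simp: sublinear_scale sublinear_0 algebra_simps)

text \<open>This step serves twice: with \<open>C\<close> a singleton it shows that minimal sublinear functionals are
  additive, and in general it pushes \<open>p\<close> below \<open>-\<beta>\<close> on \<open>-C\<close>.\<close>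

lemma sublinear_reduce:
  fixes p :: "'a::real_vector \<Rightarrow> real"
  assumes p: "sublinear p" and C: "convex C" "C \<noteq> {}" and \<beta>: "\<And>c. c \<in> C \<Longrightarrow> \<beta> \<le> p c"
  obtains q where "sublinear q" "\<And>x. q x \<le> p x" "\<And>c. c \<in> C \<Longrightarrow> q (- c) \<le> - \<beta>"
proof -
  let ?I = "{0..} \<times> C :: (real \<times> 'a) set"
  define q where "q x = (INF (t,c)\<in>?I. p (x + t *\<^sub>R c) - t * \<beta>)" for x
  have ne: "?I \<noteq> {}" using C by auto
  have low: "- p (- x) \<le> p (x + t *\<^sub>R c) - t * \<beta>" if "0 \<le> t" "c \<in> C" for t c x
  proof -
    have "t * \<beta> \<le> p (t *\<^sub>R c)"
      using that by (simp add: sublinear_scale[OF p] mult_left_mono \<beta>)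
    also have "\<dots> \<le> p (x + t *\<^sub>R c) + p (- x)"
      using sublinear_add[OF p, of "x + t *\<^sub>R c" "- x"] by simp
    finally show ?thesis by simp
  qed
  have bdd: "bdd_below ((\<lambda>(t,c). p (x + t *\<^sub>R c) - t * \<beta>) ` ?I)" for x
    by (rule bdd_belowI2[where m="- p (- x)"]) (use low in auto)
  have q_le: "q x \<le> p (x + t *\<^sub>R c) - t * \<beta>" if "0 \<le> t" "c \<in> C" for t c x
    unfolding q_def using cINF_lower[OF bdd, of "(t,c)" x] that by auto
  have q_ge: "a \<le> q x" if "\<And>t c. 0 \<le> t \<Longrightarrow> c \<in> C \<Longrightarrow> a \<le> p (x + t *\<^sub>R c) - t * \<beta>" for a x
    unfolding q_def by (rule cINF_greatest[OF ne]) (use that in auto)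
  have q_p: "q x \<le> p x" for x
    using C(2) q_le[of 0 _ x] by auto
  have "sublinear q"
  proof (rule sublinearI)
    fix x y
    have *: "q (x + y) \<le> (p (x + t *\<^sub>R c) - t * \<beta>) + (p (y + s *\<^sub>R d) - s * \<beta>)"
      if tc: "0 \<le> t" "c \<in> C" and sd: "0 \<le> s" "d \<in> C" for t c s d
    proof (cases "t + s = 0")
      case True
      then have "t = 0" "s = 0" using tc sd by auto
      then show ?thesis using q_p[of "x+y"] sublinear_add[OF p, of x y] by simp
    next
      case False
      \<comment> \<open>A single point of \<open>C\<close> stands for both \<open>c\<close> and
        \<open>d\<close>: convexity turns \<open>t c + s d\<close> into
        \<open>(t + s) e\<close>.\<close>
      define e where "e = (t/(t+s)) *\<^sub>R c + (s/(t+s)) *\<^sub>R d"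
      have "e \<in> C" unfolding e_def
        by (rule convexD[OF C(1)]) (use tc sd False in \<open>auto simp flip: add_divide_distrib\<close>)
      have "(t+s) *\<^sub>R e = t *\<^sub>R c + s *\<^sub>R d"
        using False by (simp add: e_def scaleR_right_distrib)
      then have "q (x + y) \<le> p ((x + t *\<^sub>R c) + (y + s *\<^sub>R d)) - (t + s) * \<beta>"
        using q_le[of "t+s" e "x+y"] tc sd \<open>e \<in> C\<close> by (simp add: algebra_simps)
      with sublinear_add[OF p, of "x + t *\<^sub>R c" "y + s *\<^sub>R d"] show ?thesis
        by (simp add: algebra_simps)
    qed
    have "q (x + y) - (p (y + s *\<^sub>R d) - s * \<beta>) \<le> q x" if "0 \<le> s" "d \<in> C" for s d
      by (rule q_ge) (use *[OF _ _ that] in \<open>simp add: algebra_simps\<close>)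
    then have "q (x + y) - q x \<le> q y"
      by (intro q_ge) (simp add: algebra_simps)
    then show "q (x + y) \<le> q x + q y" by simp
  next
    fix r :: real and x assume r: "0 < r"
    have "(1/r) * q (r *\<^sub>R x) \<le> q x"
    proof (rule q_ge)
      fix t c assume tc: "0 \<le> (t::real)" "c \<in> C"
      have "q (r *\<^sub>R x) \<le> p (r *\<^sub>R (x + t *\<^sub>R c)) - (r * t) * \<beta>"
        using q_le[of "r*t" c "r *\<^sub>R x"] tc r by (simp add: algebra_simps)
      also have "\<dots> = r * (p (x + t *\<^sub>R c) - t * \<beta>)"
        using r by (simp only: sublinear_scale[OF p less_imp_le[OF r]]) (simp add: algebra_simps)
      finally show "(1/r) * q (r *\<^sub>R x) \<le> p (x + t *\<^sub>R c) - t * \<beta>"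
        using r by (simp add: field_simps)
    qed
    then show "q (r *\<^sub>R x) \<le> r * q x"
      using r by (simp add: field_simps)
  next
    have "0 \<le> q 0"
      using q_ge[of "- p (- 0)" 0] low[of _ _ 0] sublinear_0[OF p] by simp
    with q_p[of 0] sublinear_0[OF p] show "q 0 = 0" by simp
  qed
  moreover have "q (- c) \<le> - \<beta>" if "c \<in> C" for c
    using q_le[of 1 c "- c"] that sublinear_0[OF p] by simp
  ultimately show ?thesis using q_p that by blast
qed

lemma sublinear_chain_INF:
  fixes C :: "('a::real_vector \<Rightarrow> real) set"
  assumes "C \<noteq> {}" and sub: "\<And>q. q \<in> C \<Longrightarrow> sublinear q"
    and ch: "\<And>x y. x \<in> C \<Longrightarrow> y \<in> C \<Longrightarrow> x \<le> y \<or> y \<le> x"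
  obtains u where "sublinear u" "\<And>q. q \<in> C \<Longrightarrow> u \<le> q"
proof -
  define u where "u x = (INF q\<in>C. q x)" for x
  obtain q0 where q0: "q0 \<in> C" using assms(1) by auto
  \<comment> \<open>The pointwise infimum of the chain is finite because every member is comparable
    with the fixed \<open>q0\<close>.\<close>
  have low: "- q0 (- x) \<le> q x" if "q \<in> C" for q x
  proof -
    have "q \<le> q0 \<or> q0 \<le> q" by (rule ch[OF that q0])
    then consider "q \<le> q0" | "q0 \<le> q" by auto
    then show ?thesis
    proof cases
      case 1
      then have "- q0 (- x) \<le> - q (- x)" by (auto simp: le_fun_def)
      with sublinear_ge[OF sub[OF that], of x] show ?thesis by simp
    next
      case 2
      then have "q0 x \<le> q x" by (auto simp: le_fun_def)
      with sublinear_ge[OF sub[OF q0], of x] show ?thesis by simp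
    qed
  qed
  have bdd: "bdd_below ((\<lambda>q. q x) ` C)" for x
    by (rule bdd_belowI2[where m="- q0 (- x)"]) (use low in auto)
  have u_le: "u x \<le> q x" if "q \<in> C" for q x
    unfolding u_def using cINF_lower[OF bdd that] .
  have u_ge: "a \<le> u x" if "\<And>q. q \<in> C \<Longrightarrow> a \<le> q x" for a x
    unfolding u_def by (rule cINF_greatest[OF assms(1)]) (use that in auto)
  have "sublinear u"
  proof (rule sublinearI)
    fix x y
    have *: "u (x + y) \<le> q x + q' y" if "q \<in> C" "q' \<in> C" for q q'
    proof -
      have "\<exists>r\<in>C. r \<le> q \<and> r \<le> q'" using ch that by blast
      then obtain r where r: "r \<in> C" "r x \<le> q x" "r y \<le> q' y" by (auto simp: le_fun_def)
      with u_le[OF r(1), of "x+y"] sublinear_add[OF sub[OF r(1)], of x y] show ?thesis by simp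
    qed
    have "u (x + y) - q' y \<le> u x" if "q' \<in> C" for q'
      by (rule u_ge) (use *[OF _ that] in \<open>simp add: algebra_simps\<close>)
    then have "u (x + y) - u x \<le> u y"
      by (intro u_ge) (simp add: algebra_simps)
    then show "u (x + y) \<le> u x + u y" by simp
  next
    fix r :: real and x assume r: "0 < r"
    have "(1/r) * u (r *\<^sub>R x) \<le> u x"
    proof (rule u_ge)
      fix q assume q: "q \<in> C"
      have "u (r *\<^sub>R x) \<le> r * q x"
        using u_le[OF q, of "r *\<^sub>R x"] sublinear_scale[OF sub[OF q]] r by simp
      then show "(1/r) * u (r *\<^sub>R x) \<le> q x"
        using r by (simp add: field_simps)
    qed
    then show "u (r *\<^sub>R x) \<le> r * u x"
      using r by (simp add: field_simps)
  next
    have "u 0 \<le> 0"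
      using u_le[OF q0, of 0] sublinear_0[OF sub[OF q0]] by simp
    moreover have "0 \<le> u 0"
      by (rule u_ge) (simp add: sublinear_0 sub)
    ultimately show "u 0 = 0" by simp
  qed
  with u_le that show ?thesis by (auto simp: le_fun_def)
qed

lemma sublinear_ge_linear:
  fixes p :: "'a::real_vector \<Rightarrow> real"
  assumes p: "sublinear p"
  obtains L where "linear L" "\<And>x. L x \<le> p x"
proof -
  let ?A = "{q. sublinear q \<and> q \<le> p}"
  have "\<exists>m\<in>?A. \<forall>a\<in>?A. a \<le> m \<longrightarrow> a = m"
  proof (rule Zorn_minimal)
    show "?A \<noteq> {}" using p by auto
  next
    fix C assume C: "C \<subseteq> ?A" "C \<noteq> {}" and ch: "\<And>x y. x \<in> C \<Longrightarrow> y \<in> C \<Longrightarrow> x \<le> y \<or> y \<le> x"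
    obtain u where u: "sublinear u" "\<And>q. q \<in> C \<Longrightarrow> u \<le> q"
      by (rule sublinear_chain_INF[OF C(2) _ ch]) (use C in auto)
    with C show "\<exists>u\<in>?A. \<forall>c\<in>C. u \<le> c"
      by (intro bexI[of _ u]) (auto intro: order_trans)
  qed
  then obtain L where L: "sublinear L" "L \<le> p" and min: "\<And>q. sublinear q \<Longrightarrow> q \<le> L \<Longrightarrow> q = L"
    by (metis (mono_tags, lifting) mem_Collect_eq order_trans)
  have neg: "L (- y) = - L y" for y
  proof -
    obtain q where "sublinear q" "\<And>x. q x \<le> L x" "q (- y) \<le> - L y"
      by (rule sublinear_reduce[OF L(1), of "{y}" "L y"]) auto
    then have "L (- y) \<le> - L y" using min[of q] by (auto simp: le_fun_def)
    with sublinear_ge[OF L(1), of y] show ?thesis by simp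
  qed
  have add: "L (x + y) = L x + L y" for x y
    using sublinear_add[OF L(1), of x y] sublinear_add[OF L(1), of "x + y" "- y"] neg[of y] by simp
  have "linear L"
  proof (rule linearI)
    fix r x show "L (r *\<^sub>R x) = r *\<^sub>R L x"
    proof (cases "0 \<le> r")
      case False
      then have "L ((- r) *\<^sub>R x) = (- r) * L x"
        by (intro sublinear_scale[OF L(1)]) auto
      then show ?thesis using neg[of "r *\<^sub>R x"] by simp
    qed (simp add: sublinear_scale[OF L(1)])
  qed (rule add)
  with L(2) that show ?thesis by (auto simp: le_fun_def)
qed

theorem Mazur_Orlicz:
  fixes p :: "'a::real_vector \<Rightarrow> real"
  assumes "sublinear p" "convex C" "C \<noteq> {}" "\<And>c. c \<in> C \<Longrightarrow> \<beta> \<le> p c"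
  obtains L where "linear L" "\<And>x. L x \<le> p x" "\<And>c. c \<in> C \<Longrightarrow> \<beta> \<le> L c"
proof -
  obtain q where q: "sublinear q" "\<And>x. q x \<le> p x" "\<And>c. c \<in> C \<Longrightarrow> q (- c) \<le> - \<beta>"
    using sublinear_reduce[OF assms] by blast
  obtain L where L: "linear L" "\<And>x. L x \<le> q x"
    using sublinear_ge_linear[OF q(1)] by blast
  have "L x \<le> p x" for x using L(2)[of x] q(2)[of x] by simp
  moreover have "\<beta> \<le> L c" if "c \<in> C" for c
    using L(2)[of "- c"] q(3)[OF that] linear_neg[OF L(1), of c] by simp
  ultimately show ?thesis using L(1) that by blast
qed

section \<open>Hahn-Banach consequences in normed spaces\<close>

lemma sublinear_norm: "sublinear (norm :: 'a::real_normed_vector \<Rightarrow> real)"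
  by (auto simp: sublinear_def norm_triangle_ineq)

text \<open>Mazur-Orlicz with the norm as dominating functional; it separates \<open>C\<close> from
  the open ball of radius \<open>\<beta>\<close> around 0.\<close>

lemma convex_distance_functional:
  fixes C :: "'a::real_normed_vector set"
  assumes "convex C" "C \<noteq> {}" "\<And>c. c \<in> C \<Longrightarrow> \<beta> \<le> norm c"
  obtains \<phi> :: "'a \<Rightarrow>\<^sub>L real" where "norm \<phi> \<le> 1" "\<And>c. c \<in> C \<Longrightarrow> \<beta> \<le> \<phi> c"
proof -
  obtain L where L: "linear L" "\<And>x. L x \<le> norm x" "\<And>c. c \<in> C \<Longrightarrow> \<beta> \<le> L c"
    using Mazur_Orlicz[OF sublinear_norm assms] by blast
  have ab: "\<bar>L x\<bar> \<le> norm x" for x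
    using L(2)[of x] L(2)[of "- x"] linear_neg[OF L(1), of x] by simp
  have bl: "bounded_linear L"
    using L(1) ab by (auto simp: bounded_linear_def bounded_linear_axioms_def intro!: exI[of _ 1])
  have "norm (Blinfun L) \<le> 1"
    by (rule norm_blinfun_bound) (use ab bl in \<open>auto simp: bounded_linear_Blinfun_apply\<close>)
  with L(3) bl that show ?thesis
    by (metis bounded_linear_Blinfun_apply)
qed

lemma norming_functional:
  fixes x :: "'a::real_normed_vector"
  obtains \<phi> :: "'a \<Rightarrow>\<^sub>L real" where "norm \<phi> \<le> 1" "\<phi> x = norm x"
proof -
  obtain \<phi> :: "'a \<Rightarrow>\<^sub>L real" where \<phi>: "norm \<phi> \<le> 1" "norm x \<le> \<phi> x"
    using convex_distance_functional[of "{x}" "norm x"] by auto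
  have "\<bar>\<phi> x\<bar> \<le> norm \<phi> * norm x" using norm_blinfun[of \<phi> x] by simp
  also have "\<dots> \<le> norm x" using \<phi>(1) mult_right_mono[of "norm \<phi>" 1 "norm x"] by simp
  finally show ?thesis using \<phi> that[of \<phi>] by auto
qed

definition weak_limit :: "'a::real_normed_vector \<Rightarrow> 'a filter \<Rightarrow> bool" where
  "weak_limit u G \<longleftrightarrow> (\<forall>\<phi> :: 'a \<Rightarrow>\<^sub>L real. ((\<lambda>v. \<phi> v) \<longlongrightarrow> \<phi> u) G)"

theorem Mazur_weak_limit:
  assumes C: "convex C" and G: "G \<noteq> bot" "eventually (\<lambda>v. v \<in> C) G" and u: "weak_limit u G"
  shows "u \<in> closure C"
proof (rule ccontr)
  assume "u \<notin> closure C"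
  then obtain \<beta> where \<beta>: "\<beta> > 0" "\<And>c. c \<in> C \<Longrightarrow> \<beta> \<le> dist c u"
    unfolding closure_approachable by (metis not_le)
  have "C \<noteq> {}" using G by (auto simp: trivial_limit_def)
  \<comment> \<open>Shifting \<open>C\<close> by \<open>- u\<close> turns the distance from
    \<open>u\<close> into a norm bound. The functional then exceeds \<open>\<phi> u\<close> by at
    least \<open>\<beta>\<close> on all of \<open>C\<close>, a gap that no weak limit can
    close.\<close>
  obtain \<phi> :: "'a \<Rightarrow>\<^sub>L real" where \<phi>: "\<And>c. c \<in> (\<lambda>c. - u + c) ` C \<Longrightarrow> \<beta> \<le> \<phi> c"
  proof (rule convex_distance_functional[of "(\<lambda>c. - u + c) ` C" \<beta>])
    show "convex ((\<lambda>c. - u + c) ` C)" using C by (simp only: convex_translation_eq)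
    show "\<beta> \<le> norm c" if "c \<in> (\<lambda>c. - u + c) ` C" for c
      using that \<beta>(2) by (auto simp: dist_norm)
  qed (use \<open>C \<noteq> {}\<close> in auto)
  have "\<phi> u + \<beta> \<le> \<phi> c" if "c \<in> C" for c
    using \<phi>[of "- u + c"] that by (simp add: blinfun.diff_right)
  then have "eventually (\<lambda>v. \<phi> u + \<beta> \<le> \<phi> v) G"
    using G(2) by (rule eventually_mono[rotated]) auto
  then have "\<phi> u + \<beta> \<le> \<phi> u"
    using u[unfolded weak_limit_def, rule_format, of \<phi>] G(1) by (intro tendsto_lowerbound)
  with \<beta>(1) show False by simp
qed


section \<open>Krein's theorem on convex hulls\<close>

text \<open>Ultrafilter form of relative compactness: the limit may lie outside \<open>A\<close>. In
  a regular space, such as one with its weak topology, this amounts to compactness of the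
  closure.\<close>

definition relatively_weakly_compact :: "'a::real_normed_vector set \<Rightarrow> bool" where
  "relatively_weakly_compact A \<longleftrightarrow>
     (\<forall>G. ultrafilter G \<longrightarrow> eventually (\<lambda>v. v \<in> A) G \<longrightarrow> (\<exists>u. weak_limit u G))"

text \<open>The canonical image of a complete space is closed in the bidual: norming functionals
  turn the approximations of \<open>\<Phi>\<close> into a Cauchy sequence.\<close>

lemma approximable_bidual:
  fixes \<Phi> :: "('a::real_normed_vector \<Rightarrow>\<^sub>L real) \<Rightarrow> real"
  assumes complete: "complete (UNIV :: 'a set)"
    and "\<And>\<delta>. 0 < \<delta> \<Longrightarrow> \<exists>w. \<forall>\<phi>. \<bar>\<Phi> \<phi> - \<phi> w\<bar> \<le> \<delta> * norm \<phi>"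
  obtains w where "\<And>\<phi>. \<Phi> \<phi> = \<phi> w"
proof -
  have "\<exists>w. \<forall>\<phi>. \<bar>\<Phi> \<phi> - \<phi> w\<bar> \<le> (1 / real (Suc n)) * norm \<phi>" for n
    by (rule assms(2)) simp
  then obtain w where w: "\<And>n \<phi>. \<bar>\<Phi> \<phi> - blinfun_apply \<phi> (w n)\<bar> \<le> (1 / real (Suc n)) * norm \<phi>"
    by metis
  have d: "norm (w m - w n) \<le> 1 / real (Suc m) + 1 / real (Suc n)" for m n
  proof -
    obtain \<phi> :: "'a \<Rightarrow>\<^sub>L real" where \<phi>: "norm \<phi> \<le> 1" "\<phi> (w m - w n) = norm (w m - w n)"
      by (rule norming_functional)
    have "norm (w m - w n) \<le> \<bar>\<Phi> \<phi> - \<phi> (w m)\<bar> + \<bar>\<Phi> \<phi> - \<phi> (w n)\<bar>"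
      using \<phi>(2) by (simp add: blinfun.diff_right)
    also have "\<dots> \<le> (1 / real (Suc m)) * norm \<phi> + (1 / real (Suc n)) * norm \<phi>"
      by (intro add_mono w)
    also have "\<dots> \<le> 1 / real (Suc m) + 1 / real (Suc n)"
      using \<phi>(1) by (intro add_mono mult_left_le) auto
    finally show ?thesis .
  qed
  have lim: "(\<lambda>n. 1 / real (Suc n)) \<longlonglongrightarrow> 0"
    by (rule lim_1_over_n[THEN LIMSEQ_Suc])
  have "Cauchy w"
  proof (rule metric_CauchyI)
    fix e :: real assume "0 < e"
    then have "eventually (\<lambda>n. 1 / real (Suc n) < e / 2) sequentially"
      by (intro order_tendstoD(2)[OF lim]) auto
    then obtain N where N: "\<And>n. n \<ge> N \<Longrightarrow> 1 / real (Suc n) < e / 2"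
      by (auto simp: eventually_sequentially)
    have "dist (w m) (w n) < e" if "m \<ge> N" "n \<ge> N" for m n
      using d[of m n] N[OF that(1)] N[OF that(2)] by (simp add: dist_norm)
    then show "\<exists>M. \<forall>m\<ge>M. \<forall>n\<ge>M. dist (w m) (w n) < e" by blast
  qed
  then obtain u where u: "w \<longlonglongrightarrow> u"
    using complete unfolding complete_def by blast
  have "\<Phi> \<phi> = \<phi> u" for \<phi> :: "'a \<Rightarrow>\<^sub>L real"
  proof -
    have "(\<lambda>n. \<Phi> \<phi> - \<phi> (w n)) \<longlonglongrightarrow> 0"
    proof (rule Lim_null_comparison)
      show "eventually (\<lambda>n. norm (\<Phi> \<phi> - \<phi> (w n)) \<le> (1 / real (Suc n)) * norm \<phi>) sequentially"
        using w by simp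
      show "(\<lambda>n. (1 / real (Suc n)) * norm \<phi>) \<longlonglongrightarrow> 0"
        by (rule tendsto_mult_left_zero[OF lim])
    qed
    moreover have "(\<lambda>n. \<Phi> \<phi> - \<phi> (w n)) \<longlonglongrightarrow> \<Phi> \<phi> - \<phi> u"
      by (intro tendsto_intros u)
    ultimately show ?thesis
      using LIMSEQ_unique by fastforce
  qed
  with that show ?thesis by blast
qed

text \<open>Grothendieck's approximation criterion. Points of \<open>W\<close> near those of
  \<open>D\<close> have a weak limit \<open>k\<close>, which places the limit functional
  \<open>\<Phi>\<close> within an arbitrary tolerance of the canonical image.\<close>

lemma relatively_weakly_compact_approx:
  fixes D :: "'a::real_normed_vector set"
  assumes complete: "complete (UNIV :: 'a set)"
    and approx: "\<And>\<epsilon>. 0 < \<epsilon> \<Longrightarrow> \<exists>W. relatively_weakly_compact W \<and> (\<forall>v\<in>D. \<exists>w\<in>W. norm (v - w) \<le> \<epsilon>)"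
    and bounded: "\<And>v. v \<in> D \<Longrightarrow> norm v \<le> B"
  shows "relatively_weakly_compact D"
  unfolding relatively_weakly_compact_def
proof (intro allI impI)
  fix G :: "'a filter" assume G: "ultrafilter G" "eventually (\<lambda>v. v \<in> D) G"
  define \<Phi> where "\<Phi> \<phi> = Lim G (blinfun_apply \<phi>)" for \<phi> :: "'a \<Rightarrow>\<^sub>L real"
  have lim: "((\<lambda>v. \<phi> v) \<longlongrightarrow> \<Phi> \<phi>) G" for \<phi> :: "'a \<Rightarrow>\<^sub>L real"
    unfolding \<Phi>_def
  proof (rule ultrafilter_bounded_tendsto_Lim[OF G(1)])
    show "eventually (\<lambda>v. \<bar>\<phi> v\<bar> \<le> norm \<phi> * B) G"
      using G(2)
    proof eventually_elim
      case (elim v)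
      then show ?case
        using norm_blinfun[of \<phi> v] mult_left_mono[OF bounded[of v], of "norm \<phi>"] by simp
    qed
  qed
  obtain u where u: "\<And>\<phi>. \<Phi> \<phi> = blinfun_apply \<phi> u"
  proof (rule approximable_bidual[OF complete])
    fix \<delta> :: real assume "0 < \<delta>"
    then obtain W where W: "relatively_weakly_compact W" "\<forall>v\<in>D. \<exists>w\<in>W. norm (v - w) \<le> \<delta>"
      using approx by blast
    then obtain w where w: "\<And>v. v \<in> D \<Longrightarrow> w v \<in> W \<and> norm (v - w v) \<le> \<delta>"
      by metis
    have "eventually (\<lambda>v. v \<in> W) (filtermap w G)"
      unfolding eventually_filtermap using G(2) by eventually_elim (use w in blast)
    then obtain k where k: "weak_limit k (filtermap w G)"
      using W(1) ultrafilter_filtermap[OF G(1)] unfolding relatively_weakly_compact_def by blast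
    have "\<bar>\<Phi> \<phi> - \<phi> k\<bar> \<le> \<delta> * norm \<phi>" for \<phi>
    proof (rule tendsto_upperbound[OF _ _ ultrafilter_not_bot[OF G(1)]])
      have "((\<lambda>v. \<phi> (w v)) \<longlongrightarrow> \<phi> k) G"
        using k by (simp add: weak_limit_def filterlim_filtermap)
      then show "((\<lambda>v. \<bar>\<phi> v - \<phi> (w v)\<bar>) \<longlongrightarrow> \<bar>\<Phi> \<phi> - \<phi> k\<bar>) G"
        by (intro tendsto_rabs tendsto_diff lim)
      show "eventually (\<lambda>v. \<bar>\<phi> v - \<phi> (w v)\<bar> \<le> \<delta> * norm \<phi>) G"
        using G(2)
      proof eventually_elim
        case (elim v)
        have "\<bar>\<phi> v - \<phi> (w v)\<bar> \<le> norm \<phi> * norm (v - w v)"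
          using norm_blinfun[of \<phi> "v - w v"] by (simp add: blinfun.diff_right)
        also have "\<dots> \<le> norm \<phi> * \<delta>"
          using w[OF elim] by (intro mult_left_mono) auto
        finally show ?case by (simp add: mult.commute)
      qed
    qed
    then show "\<exists>w. \<forall>\<phi>. \<bar>\<Phi> \<phi> - \<phi> w\<bar> \<le> \<delta> * norm \<phi>" by blast
  qed blast
  have "weak_limit u G"
    unfolding weak_limit_def using lim u by simp
  then show "\<exists>u. weak_limit u G" ..
qed

section \<open>Finitely additive means and second moments\<close>

definition bounded_fun_on :: "'a set \<Rightarrow> ('a \<Rightarrow> real) \<Rightarrow> bool" where
  "bounded_fun_on A g \<longleftrightarrow> (\<exists>M. \<forall>a\<in>A. \<bar>g a\<bar> \<le> M)"

lemma bounded_fun_onI: "(\<And>a. a \<in> A \<Longrightarrow> \<bar>g a\<bar> \<le> M) \<Longrightarrow> bounded_fun_on A g"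
  by (auto simp: bounded_fun_on_def)

lemma bounded_fun_on_const [intro, simp]: "bounded_fun_on A (\<lambda>_. c)"
  by (auto simp: bounded_fun_on_def)

lemma bounded_fun_on_add [intro, simp]:
  assumes "bounded_fun_on A f" "bounded_fun_on A g"
  shows "bounded_fun_on A (\<lambda>a. f a + g a)"
proof -
  obtain M N where "\<forall>a\<in>A. \<bar>f a\<bar> \<le> M" "\<forall>a\<in>A. \<bar>g a\<bar> \<le> N"
    using assms by (auto simp: bounded_fun_on_def)
  then show ?thesis
    by (intro bounded_fun_onI[of _ _ "M + N"]) (smt (verit, ccfv_SIG))
qed

lemma bounded_fun_on_mult [intro, simp]:
  assumes "bounded_fun_on A f" "bounded_fun_on A g"
  shows "bounded_fun_on A (\<lambda>a. f a * g a)"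
proof -
  obtain M N where "\<forall>a\<in>A. \<bar>f a\<bar> \<le> M" "\<forall>a\<in>A. \<bar>g a\<bar> \<le> N"
    using assms by (auto simp: bounded_fun_on_def)
  then show ?thesis
    by (intro bounded_fun_onI[of _ _ "M * N"]) (auto simp: abs_mult intro!: mult_mono')
qed

text \<open>A finitely additive probability on \<open>A\<close>, written as an expectation.
  Functions live on the whole type, but \<open>mono\<close> compares them on \<open>A\<close> only,
  so \<open>L\<close> sees just the restrictions of bounded functions to \<open>A\<close>.\<close>

locale mean =
  fixes A :: "'a set" and L :: "('a \<Rightarrow> real) \<Rightarrow> real"
  assumes add: "bounded_fun_on A f \<Longrightarrow> bounded_fun_on A g \<Longrightarrow> L (\<lambda>a. f a + g a) = L f + L g"
    and scale: "bounded_fun_on A f \<Longrightarrow> L (\<lambda>a. c * f a) = c * L f"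
    and mono: "bounded_fun_on A f \<Longrightarrow> bounded_fun_on A g \<Longrightarrow> (\<And>a. a \<in> A \<Longrightarrow> f a \<le> g a) \<Longrightarrow> L f \<le> L g"
    and one: "L (\<lambda>_. 1) = 1"
begin

lemma const: "L (\<lambda>_. c) = c"
  using scale[of "\<lambda>_. 1" c] one by simp

lemma nonneg: "bounded_fun_on A f \<Longrightarrow> (\<And>a. a \<in> A \<Longrightarrow> 0 \<le> f a) \<Longrightarrow> 0 \<le> L f"
  using mono[of "\<lambda>_. 0" f] const[of 0] by simp

lemma abs_le:
  assumes "\<And>a. a \<in> A \<Longrightarrow> \<bar>f a\<bar> \<le> M"
  shows "\<bar>L f\<bar> \<le> M"
proof -
  have b: "bounded_fun_on A f" by (rule bounded_fun_onI) (rule assms)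
  have "f a \<le> M" "- M \<le> f a" if "a \<in> A" for a
    using assms[OF that] by auto
  then show ?thesis
    using mono[OF b, of "\<lambda>_. M"] mono[OF _ b, of "\<lambda>_. - M"] by (auto simp: const abs_le_iff)
qed

text \<open>If no weighted correlation survived in the limit, sums of \<open>N\<close> well chosen \<open>g i\<close> would have
  mean of order \<open>N\<close> but second moment of order \<open>N\<close> only, contradicting the Cauchy--Schwarz inequality.\<close>

lemma positive_correlation:
  assumes \<H>: "ultrafilter \<H>"
    and g: "\<And>i a. a \<in> A \<Longrightarrow> 0 \<le> g i a \<and> g i a \<le> M"
    and H: "\<And>a. a \<in> A \<Longrightarrow> 0 \<le> H a \<and> H a \<le> M'"
    and c: "((\<lambda>i. L (\<lambda>a. H a * g i a)) \<longlongrightarrow> c) \<H>" "0 < c"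
  shows "eventually (\<lambda>j. \<exists>c'>0. ((\<lambda>i. L (\<lambda>a. H a * g j a * g i a)) \<longlongrightarrow> c') \<H>) \<H>"
proof (rule ccontr)
  assume contra: "\<not> ?thesis"
  have bg: "bounded_fun_on A (g i)" for i
    by (rule bounded_fun_onI[of _ _ M]) (use g in auto)
  have bH: "bounded_fun_on A H"
    by (rule bounded_fun_onI[of _ _ M']) (use H in auto)
  note bds = bounded_fun_on_add bounded_fun_on_mult bounded_fun_on_const bg bH
  have lim_ex: "\<exists>l. ((\<lambda>i. L (\<lambda>a. H a * h a * g i a)) \<longlongrightarrow> l) \<H>" if bh: "bounded_fun_on A h" for h
  proof -
    obtain B where B: "\<forall>a\<in>A. \<bar>h a\<bar> \<le> B"
      using bh unfolding bounded_fun_on_def by blast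
    have "\<bar>L (\<lambda>a. H a * h a * g i a)\<bar> \<le> M' * B * M" for i
      by (rule abs_le) (use B H g in \<open>auto simp: abs_mult intro!: mult_mono'\<close>)
    then show ?thesis
      using ultrafilter_bounded_tendsto_Lim[OF \<H>] by (meson always_eventually)
  qed
  have bad: "eventually (\<lambda>j. \<exists>l\<le>0. ((\<lambda>i. L (\<lambda>a. H a * g j a * g i a)) \<longlongrightarrow> l) \<H>) \<H>"
    using ultrafilter_not_eventually[OF \<H> contra]
    by (rule eventually_mono) (use lim_ex[OF bg] not_le in blast)
  \<comment> \<open>Bounds the second moment of a single \<open>g i\<close>. Each new summand raises
    the second moment by at most \<open>b\<close> plus twice a mixed term kept below 1/2, which is
    the origin of \<open>b + 1\<close>.\<close>
  define b where "b = M' * M * M"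
  have gg: "L (\<lambda>a. H a * g i a * g i a) \<le> b" for i
  proof -
    have "\<bar>L (\<lambda>a. H a * g i a * g i a)\<bar> \<le> b" unfolding b_def
      by (rule abs_le) (use H g in \<open>auto simp: abs_mult intro!: mult_mono'\<close>)
    then show ?thesis by simp
  qed
  have sums: "\<exists>h. bounded_fun_on A h \<and> real N * c / 2 \<le> L (\<lambda>a. H a * h a) \<and>
      L (\<lambda>a. H a * h a * h a) \<le> real N * (b + 1) \<and>
      (\<exists>l\<le>0. ((\<lambda>i. L (\<lambda>a. H a * h a * g i a)) \<longlongrightarrow> l) \<H>)" for N
  proof (induction N)
    case 0
    show ?case
      by (rule exI[of _ "\<lambda>_. 0"]) (auto simp: const intro!: exI[of _ 0])
  next
    case (Suc N)
    then obtain h l where h: "bounded_fun_on A h" "real N * c / 2 \<le> L (\<lambda>a. H a * h a)"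
      "L (\<lambda>a. H a * h a * h a) \<le> real N * (b + 1)" and
      l: "l \<le> 0" "((\<lambda>i. L (\<lambda>a. H a * h a * g i a)) \<longlongrightarrow> l) \<H>" by blast
    have "eventually (\<lambda>i. c / 2 < L (\<lambda>a. H a * g i a)) \<H>"
      by (rule order_tendstoD(1)[OF c(1)]) (use c(2) in auto)
    moreover have "eventually (\<lambda>i. L (\<lambda>a. H a * h a * g i a) < 1/2) \<H>"
      by (rule order_tendstoD(2)[OF l(2)]) (use l(1) in auto)
    moreover define Q where "Q i \<longleftrightarrow> (c / 2 < L (\<lambda>a. H a * g i a) \<and> L (\<lambda>a. H a * h a * g i a) < 1/2) \<and>
        (\<exists>l\<le>0. ((\<lambda>i'. L (\<lambda>a. H a * g i a * g i' a)) \<longlongrightarrow> l) \<H>)" for i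
    ultimately have "eventually Q \<H>"
      unfolding Q_def by (intro eventually_conj bad)
    then obtain i where "Q i"
      using eventually_happens'[OF ultrafilter_not_bot[OF \<H>]] by blast
    then have i: "c / 2 < L (\<lambda>a. H a * g i a)" "L (\<lambda>a. H a * h a * g i a) < 1/2"
      and ex: "\<exists>l\<le>0. ((\<lambda>i'. L (\<lambda>a. H a * g i a * g i' a)) \<longlongrightarrow> l) \<H>"
      unfolding Q_def by simp_all
    define R where "R l \<longleftrightarrow> ((\<lambda>i'. L (\<lambda>a. H a * g i a * g i' a)) \<longlongrightarrow> l) \<H>" for l
    obtain l' where l': "l' \<le> 0" "R l'"
      using ex[folded R_def] by blast
    note l' = l'(1) l'(2)[unfolded R_def]
    let ?h = "\<lambda>a. h a + g i a"
    have 1: "L (\<lambda>a. H a * ?h a) = L (\<lambda>a. H a * h a) + L (\<lambda>a. H a * g i a)"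
      unfolding distrib_left by (rule add; intro bds h(1))
    have 2: "L (\<lambda>a. H a * ?h a * ?h a) =
        L (\<lambda>a. H a * h a * h a) + (2 * L (\<lambda>a. H a * h a * g i a) + L (\<lambda>a. H a * g i a * g i a))"
    proof -
      have "L (\<lambda>a. H a * ?h a * ?h a) =
          L (\<lambda>a. H a * h a * h a + (2 * (H a * h a * g i a) + H a * g i a * g i a))"
        by (rule arg_cong[where f=L], rule ext, algebra)
      also have "\<dots> = L (\<lambda>a. H a * h a * h a) + L (\<lambda>a. 2 * (H a * h a * g i a) + H a * g i a * g i a)"
        by (rule add; intro bds h(1))
      also have "L (\<lambda>a. 2 * (H a * h a * g i a) + H a * g i a * g i a) =
          L (\<lambda>a. 2 * (H a * h a * g i a)) + L (\<lambda>a. H a * g i a * g i a)"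
        by (rule add; intro bds h(1))
      also have "L (\<lambda>a. 2 * (H a * h a * g i a)) = 2 * L (\<lambda>a. H a * h a * g i a)"
        by (rule scale; intro bds h(1))
      finally show ?thesis .
    qed
    have 3: "L (\<lambda>a. H a * ?h a * g k a) = L (\<lambda>a. H a * h a * g k a) + L (\<lambda>a. H a * g i a * g k a)" for k
      unfolding distrib_left distrib_right by (rule add; intro bds h(1))
    have "((\<lambda>k. L (\<lambda>a. H a * ?h a * g k a)) \<longlongrightarrow> l + l') \<H>"
      unfolding 3 by (intro tendsto_intros l l')
    moreover have "bounded_fun_on A ?h" by (intro bds h)
    moreover have "real (Suc N) * c / 2 \<le> L (\<lambda>a. H a * ?h a)"
      unfolding 1 using h(2) i(1) by (simp add: field_simps)
    moreover have "L (\<lambda>a. H a * ?h a * ?h a) \<le> real (Suc N) * (b + 1)"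
      unfolding 2 using h(3) i(2) gg[of i] by (simp add: field_simps)
    ultimately show ?case
      using l(1) l'(1) by (intro exI[of _ ?h]) (auto intro!: exI[of _ "l + l'"])
  qed
  define K where "K = L H"
  have K: "0 \<le> K" unfolding K_def by (rule nonneg[OF bH]) (use H in auto)
  \<comment> \<open>The square \<open>(h - t)^2\<close> is used at \<open>t = N s\<close>. Because
    \<open>s K \<le> c / 2\<close>, the linear term beats the quadratic one and leaves order
    \<open>N^2\<close> against the bound of order \<open>N\<close>. Adding 1 to \<open>K\<close>
    covers \<open>K = 0\<close>.\<close>
  define s where "s = c / (2 * (K + 1))"
  have s: "0 < s" "s * K \<le> c / 2"
    using K c(2) by (auto simp: s_def field_simps)
  obtain N :: nat where N: "b + 1 < real N * (s * c / 2)" "N > 0"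
  proof -
    obtain N :: nat where "(b + 1) / (s * c / 2) < real N" using reals_Archimedean2 by blast
    then have "b + 1 < real N * (s * c / 2)" using s c(2) by (simp add: field_simps)
    also have "\<dots> \<le> real (Suc N) * (s * c / 2)" using s c(2) by (intro mult_right_mono) auto
    finally show ?thesis using that[of "Suc N"] by simp
  qed
  obtain h where h: "bounded_fun_on A h" "real N * c / 2 \<le> L (\<lambda>a. H a * h a)"
      "L (\<lambda>a. H a * h a * h a) \<le> real N * (b + 1)"
    using sums[of N] by blast
  define t where "t = real N * s"
  have "0 \<le> L (\<lambda>a. H a * h a * h a + ((-2 * t) * (H a * h a) + t\<^sup>2 * H a))"
  proof (rule nonneg)
    fix a assume "a \<in> A"
    have "H a * h a * h a + ((-2 * t) * (H a * h a) + t\<^sup>2 * H a) = H a * (h a - t)\<^sup>2"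
      by (simp add: power2_eq_square algebra_simps)
    then show "0 \<le> H a * h a * h a + ((-2 * t) * (H a * h a) + t\<^sup>2 * H a)"
      using H[OF \<open>a \<in> A\<close>] by simp
  qed (intro bds h(1))
  also have "\<dots> = L (\<lambda>a. H a * h a * h a) + ((-2 * t) * L (\<lambda>a. H a * h a) + t\<^sup>2 * K)"
  proof -
    have "L (\<lambda>a. H a * h a * h a + ((-2 * t) * (H a * h a) + t\<^sup>2 * H a)) =
        L (\<lambda>a. H a * h a * h a) + L (\<lambda>a. (-2 * t) * (H a * h a) + t\<^sup>2 * H a)"
      by (rule add; intro bds h(1))
    also have "L (\<lambda>a. (-2 * t) * (H a * h a) + t\<^sup>2 * H a) =
        L (\<lambda>a. (-2 * t) * (H a * h a)) + L (\<lambda>a. t\<^sup>2 * H a)"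
      by (rule add; intro bds h(1))
    also have "L (\<lambda>a. (-2 * t) * (H a * h a)) = (-2 * t) * L (\<lambda>a. H a * h a)"
      by (rule scale; intro bds h(1))
    also have "L (\<lambda>a. t\<^sup>2 * H a) = t\<^sup>2 * L H"
      by (rule scale; intro bds h(1))
    finally show ?thesis by (simp only: K_def)
  qed
  finally have "2 * t * L (\<lambda>a. H a * h a) \<le> real N * (b + 1) + t\<^sup>2 * K"
    using h(3) by simp
  moreover have "2 * t * (real N * c / 2) \<le> 2 * t * L (\<lambda>a. H a * h a)"
    using h(2) s(1) by (intro mult_left_mono) (auto simp: t_def)
  moreover have "t\<^sup>2 * K \<le> (real N)\<^sup>2 * s * (c / 2)"
    using mult_left_mono[OF s(2), of "(real N)\<^sup>2 * s"] s(1) by (simp add: t_def power2_eq_square ac_simps)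
  ultimately have "real N * (real N * (s * c / 2)) \<le> real N * (b + 1)"
    by (simp add: t_def power2_eq_square algebra_simps)
  with N show False by simp
qed

text \<open>Products of the truncations chosen so far serve as weights, which
  \<open>positive_correlation\<close> keeps correlated with the family. Where a weight is positive,
  all functions chosen so far exceed \<open>\<delta> / 2\<close>; pointwise convergence to 0 makes
  the next function small at the finitely many earlier points.\<close>

lemma staircase:
  fixes h :: "'i \<Rightarrow> 'a \<Rightarrow> real"
  assumes \<H>: "ultrafilter \<H>"
    and h: "\<And>i a. a \<in> A \<Longrightarrow> \<bar>h i a\<bar> \<le> M"
    and \<delta>: "0 < \<delta>" "eventually (\<lambda>i. \<delta> \<le> L (h i)) \<H>"
    and null: "\<And>a. a \<in> A \<Longrightarrow> ((\<lambda>i. h i a) \<longlongrightarrow> 0) \<H>"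
  obtains \<iota> a where "\<And>k. a k \<in> A" "\<And>i k :: nat. i \<le> k \<Longrightarrow> \<delta> / 2 \<le> h (\<iota> i) (a k)"
    "\<And>i k. k < i \<Longrightarrow> h (\<iota> i) (a k) \<le> \<delta> / 4"
proof -
  \<comment> \<open>Subtracting \<open>\<delta> / 2\<close> before truncating still leaves a mean of
    at least \<open>\<delta> / 2\<close>, and positivity of \<open>g i a\<close> certifies
    \<open>h i a > \<delta> / 2\<close>.\<close>
  define g where "g i a = max 0 (h i a - \<delta> / 2)" for i a
  have g: "0 \<le> g i a \<and> g i a \<le> M" if "a \<in> A" for i a
    using h[OF that, of i] \<delta>(1) by (auto simp: g_def)
  have bg: "bounded_fun_on A (g i)" for i
    by (rule bounded_fun_onI[of _ _ M]) (use g in auto)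
  have bh: "bounded_fun_on A (h i)" for i
    by (rule bounded_fun_onI[of _ _ M]) (use h in auto)
  define good where "good H \<longleftrightarrow> (\<exists>M'. \<forall>a\<in>A. 0 \<le> H a \<and> H a \<le> M') \<and>
      (\<exists>c>0. ((\<lambda>i. L (\<lambda>a. H a * g i a)) \<longlongrightarrow> c) \<H>)" for H
  have step: "\<exists>j a. good (\<lambda>x. H x * g j x) \<and> a \<in> A \<and> 0 < H a * g j a \<and> (\<forall>s\<in>S. h j s \<le> \<delta> / 4)"
    if H: "good H" and S: "finite S" "S \<subseteq> A" for H S
  proof -
    obtain M' c where M': "\<And>a. a \<in> A \<Longrightarrow> 0 \<le> H a \<and> H a \<le> M'" and
      c: "0 < c" "((\<lambda>i. L (\<lambda>a. H a * g i a)) \<longlongrightarrow> c) \<H>"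
      using H by (auto simp: good_def)
    have "eventually (\<lambda>j. \<forall>s\<in>S. h j s \<le> \<delta> / 4) \<H>"
      unfolding eventually_ball_finite_distrib[OF S(1)]
    proof
      fix s assume "s \<in> S"
      then have "eventually (\<lambda>j. h j s < \<delta> / 4) \<H>"
        using S \<delta>(1) by (intro order_tendstoD(2)[OF null]) auto
      then show "eventually (\<lambda>j. h j s \<le> \<delta> / 4) \<H>" by eventually_elim simp
    qed
    moreover define R where "R j c' \<longleftrightarrow> ((\<lambda>i. L (\<lambda>a. H a * g j a * g i a)) \<longlongrightarrow> c') \<H>" for j c'
    ultimately have "eventually (\<lambda>j. (\<exists>c'>0. R j c') \<and> (\<forall>s\<in>S. h j s \<le> \<delta> / 4)) \<H>"
      unfolding R_def by (intro eventually_conj positive_correlation[OF \<H> g M' c(2,1)])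
    then obtain j c' where j: "0 < c'" "R j c'" "\<forall>s\<in>S. h j s \<le> \<delta> / 4"
      using eventually_happens'[OF ultrafilter_not_bot[OF \<H>]] by blast
    note j = j(1) j(2)[unfolded R_def] j(3)
    have bH: "\<forall>a\<in>A. 0 \<le> H a * g j a \<and> H a * g j a \<le> M' * M"
      using M' g by (auto intro!: mult_mono')
    \<comment> \<open>A positive mean of \<open>H g j g i\<close> serves only to find a point of
      \<open>A\<close> where \<open>H g j\<close> is positive.\<close>
    obtain i where i: "0 < L (\<lambda>a. H a * g j a * g i a)"
      using eventually_happens'[OF ultrafilter_not_bot[OF \<H>] order_tendstoD(1)[OF j(2,1)]] by blast
    have "\<exists>a\<in>A. 0 < H a * g j a * g i a"
    proof (rule ccontr)
      assume n: "\<not> ?thesis"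
      have "bounded_fun_on A (\<lambda>a. H a * g j a)"
        by (rule bounded_fun_onI[of _ _ "M' * M"]) (use bH in auto)
      then have "L (\<lambda>a. H a * g j a * g i a) \<le> L (\<lambda>_. 0)"
        using n by (intro mono) (auto intro: bg simp: not_less)
      with i show False by (simp add: const)
    qed
    then obtain a where "a \<in> A" "0 < H a * g j a * g i a" by blast
    then have "0 < H a * g j a"
      using g[of a i] bH by (auto simp: zero_less_mult_iff)
    with \<open>a \<in> A\<close> j bH show ?thesis
      unfolding good_def by blast
  qed
  have init: "good (\<lambda>_. 1)"
  proof -
    have "((\<lambda>i. L (g i)) \<longlongrightarrow> Lim \<H> (\<lambda>i. L (g i))) \<H>"
    proof (rule ultrafilter_bounded_tendsto_Lim[OF \<H>])
      show "eventually (\<lambda>i. \<bar>L (g i)\<bar> \<le> M) \<H>"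
        by (intro always_eventually allI abs_le) (use g in auto)
    qed
    moreover have "eventually (\<lambda>i. \<delta> / 2 \<le> L (g i)) \<H>"
      using \<delta>(2)
    proof eventually_elim
      case (elim i)
      have "L (\<lambda>a. h i a + (- \<delta> / 2)) \<le> L (g i)"
        by (rule mono[OF bounded_fun_on_add[OF bh bounded_fun_on_const] bg]) (simp add: g_def)
      moreover have "L (\<lambda>a. h i a + (- \<delta> / 2)) = L (h i) + (- \<delta> / 2)"
        by (simp only: add const bh bounded_fun_on_const)
      ultimately show ?case using elim by simp
    qed
    ultimately have "\<delta> / 2 \<le> Lim \<H> (\<lambda>i. L (g i))"
      by (intro tendsto_lowerbound[OF _ _ ultrafilter_not_bot[OF \<H>]])
    with \<open>((\<lambda>i. L (g i)) \<longlongrightarrow> Lim \<H> (\<lambda>i. L (g i))) \<H>\<close> \<delta>(1) show ?thesis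
      unfolding good_def by (intro conjI exI[of _ 1] exI[of _ "Lim \<H> (\<lambda>i. L (g i))"]) auto
  qed
  \<comment> \<open>A state holds the current weight, the last index, a point where the weight is
    positive, and the finite set of points used so far. The last index already contributes a factor
    to the weight, so the bound by \<open>\<delta> / 2\<close> includes the case
    \<open>i = k\<close>.\<close>
  define P where "P n x \<longleftrightarrow> (case x of (H, j, a, S) \<Rightarrow> good H \<and> a \<in> A \<and> 0 < H a \<and> finite S \<and> S \<subseteq> A \<and> a \<in> S \<and>
      (\<forall>s\<in>A. 0 < H s \<longrightarrow> 0 < g j s))" for n :: nat and x :: "('a \<Rightarrow> real) \<times> 'i \<times> 'a \<times> 'a set"
  define Q where "Q n x y \<longleftrightarrow> (case x of (H, j, a, S) \<Rightarrow> case y of (H', j', a', S') \<Rightarrow>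
      S \<subseteq> S' \<and> (\<forall>s\<in>A. 0 < H' s \<longrightarrow> 0 < H s) \<and> (\<forall>s\<in>S. h j' s \<le> \<delta> / 4))" for n :: nat and x y :: "('a \<Rightarrow> real) \<times> 'i \<times> 'a \<times> 'a set"
  have pos: "0 < H s \<and> 0 < g j s" if "good H" "0 < H s * g j s" "s \<in> A" for H s j
    using that g[of s j] by (auto simp: good_def zero_less_mult_iff)
  have "\<exists>f. \<forall>n. P n (f n) \<and> Q n (f n) (f (Suc n))"
  proof (rule dependent_nat_choice)
    obtain j a where "good (\<lambda>x. 1 * g j x)" "a \<in> A" "0 < 1 * g j a"
      using step[OF init, of "{}"] by auto
    then show "\<exists>x. P 0 x"
      by (intro exI[of _ "(\<lambda>x. 1 * g j x, j, a, {a})"]) (auto simp: P_def)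
  next
    fix x n assume x: "P n x"
    obtain H j a S where x_eq: "x = (H, j, a, S)" by (cases x)
    have H: "good H" "finite S" "S \<subseteq> A" using x by (auto simp: x_eq P_def)
    obtain j' a' where y: "good (\<lambda>x. H x * g j' x)" "a' \<in> A" "0 < H a' * g j' a'"
        "\<forall>s\<in>S. h j' s \<le> \<delta> / 4"
      using step[OF H] by blast
    let ?y = "(\<lambda>x. H x * g j' x, j', a', insert a' S)"
    have "P (Suc n) ?y"
      unfolding P_def prod.case using y(1,2,3) H(2,3) pos[OF H(1)] by (intro conjI) blast+
    moreover have "Q n x ?y"
      unfolding x_eq Q_def prod.case using y(4) pos[OF H(1)] by (intro conjI) blast+
    ultimately show "\<exists>y. P (Suc n) y \<and> Q n x y" by blast
  qed
  then obtain f where f: "\<And>n. P n (f n)" "\<And>n. Q n (f n) (f (Suc n))" by blast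
  define H where "H n = fst (f n)" for n
  define \<iota> where "\<iota> n = fst (snd (f n))" for n
  define a where "a n = fst (snd (snd (f n)))" for n
  define S where "S n = snd (snd (snd (f n)))" for n
  have f_eq: "f n = (H n, \<iota> n, a n, S n)" for n
    by (simp add: H_def \<iota>_def a_def S_def)
  have Pn: "a n \<in> A" "0 < H n (a n)" "a n \<in> S n" "s \<in> A \<Longrightarrow> 0 < H n s \<Longrightarrow> 0 < g (\<iota> n) s" for n s
    using f(1)[of n] by (auto simp: f_eq P_def)
  have Qn: "S n \<subseteq> S (Suc n)" "s \<in> A \<Longrightarrow> 0 < H (Suc n) s \<Longrightarrow> 0 < H n s"
    "s \<in> S n \<Longrightarrow> h (\<iota> (Suc n)) s \<le> \<delta> / 4" for n s
    using f(2)[of n] by (auto simp: f_eq Q_def)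
  have S_mono: "S k \<subseteq> S n" if "k \<le> n" for k n
    using that Qn(1) by (rule lift_Suc_mono_le[rotated])
  have H_anti: "0 < H k s" if "k \<le> n" "s \<in> A" "0 < H n s" for k n s
    using that by (induction n rule: dec_induct) (auto dest: Qn(2))
  have up: "\<delta> / 2 \<le> h (\<iota> i) (a k)" if "i \<le> k" for i k
  proof -
    have "0 < g (\<iota> i) (a k)"
      using H_anti[OF that Pn(1,2)] by (rule Pn(4)[OF Pn(1)])
    then show ?thesis by (auto simp: g_def)
  qed
  have down: "h (\<iota> i) (a k) \<le> \<delta> / 4" if "k < i" for i k
  proof -
    from that obtain m where "i = Suc m" "k \<le> m" by (cases i) auto
    then show ?thesis using Qn(3) S_mono Pn(3) by blast
  qed
  show ?thesis by (rule that[OF Pn(1) up down])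
qed

end


text \<open>Each point of the hull is a finite average over \<open>A\<close>. The limit of these
  averages is taken for all bounded functions on \<open>A\<close> at once, not only for linear ones,
  so that products of functionals also get a mean.\<close>

lemma convex_hull_mean:
  fixes A :: "'a::real_normed_vector set"
  assumes G: "ultrafilter G" "eventually (\<lambda>v. v \<in> convex hull A) G"
    and B: "\<And>a. a \<in> A \<Longrightarrow> norm a \<le> B"
  obtains L where "mean A L" "\<And>\<phi>. (blinfun_apply \<phi> \<longlongrightarrow> L (blinfun_apply \<phi>)) G"
proof -
  have "\<forall>v\<in>convex hull A. \<exists>p. finite (fst p) \<and> fst p \<subseteq> A \<and> (\<forall>x\<in>fst p. 0 \<le> snd p x) \<and>
      sum (snd p) (fst p) = 1 \<and> sum (\<lambda>v. snd p v *\<^sub>R v) (fst p) = v"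
    unfolding convex_hull_explicit split_paired_Ex by simp
  from bchoice[OF this] obtain p where p: "\<forall>v\<in>convex hull A. finite (fst (p v)) \<and> fst (p v) \<subseteq> A \<and>
      (\<forall>x\<in>fst (p v). 0 \<le> snd (p v) x) \<and> sum (snd (p v)) (fst (p v)) = 1 \<and>
      sum (\<lambda>x. snd (p v) x *\<^sub>R x) (fst (p v)) = v" by blast
  define S where "S v = fst (p v)" for v
  define u where "u v = snd (p v)" for v
  have Su: "\<And>v. v \<in> convex hull A \<Longrightarrow>
      finite (S v) \<and> S v \<subseteq> A \<and> (\<forall>x\<in>S v. 0 \<le> u v x) \<and> sum (u v) (S v) = 1 \<and> sum (\<lambda>x. u v x *\<^sub>R x) (S v) = v"
    using p unfolding S_def u_def by blast
  define m where "m v g = (\<Sum>x\<in>S v. u v x * g x)" for v and g :: "'a \<Rightarrow> real"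
  define L where "L g = Lim G (\<lambda>v. m v g)" for g
  have m_mono: "m v f \<le> m v g" if "v \<in> convex hull A" "\<And>a. a \<in> A \<Longrightarrow> f a \<le> g a" for v f g
    unfolding m_def using Su[OF that(1)] that(2) by (intro sum_mono mult_left_mono) auto
  have m_const: "m v (\<lambda>_. c) = c" if "v \<in> convex hull A" for v c
    using Su[OF that] by (simp add: m_def flip: sum_distrib_right)
  have lim: "((\<lambda>v. m v g) \<longlongrightarrow> L g) G" if "bounded_fun_on A g" for g
  proof -
    obtain M where M: "\<forall>a\<in>A. \<bar>g a\<bar> \<le> M"
      using \<open>bounded_fun_on A g\<close> unfolding bounded_fun_on_def by blast
    have "eventually (\<lambda>v. \<bar>m v g\<bar> \<le> M) G"
      using G(2)
    proof eventually_elim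
      case (elim v)
      have "m v g \<le> m v (\<lambda>_. M)" "m v (\<lambda>_. - M) \<le> m v g"
        using M by (auto intro!: m_mono[OF elim] simp: abs_le_iff minus_le_iff)
      then show ?case by (simp add: m_const[OF elim] abs_le_iff)
    qed
    then show ?thesis
      unfolding L_def by (rule ultrafilter_bounded_tendsto_Lim[OF G(1)])
  qed
  note nb = ultrafilter_not_bot[OF G(1)]
  have "mean A L"
  proof
    fix f g assume fg: "bounded_fun_on A f" "bounded_fun_on A g"
    have "m v (\<lambda>a. f a + g a) = m v f + m v g" for v
      by (simp add: m_def sum.distrib distrib_left)
    then have "((\<lambda>v. m v (\<lambda>a. f a + g a)) \<longlongrightarrow> L f + L g) G"
      by (simp add: tendsto_add lim fg)
    then show "L (\<lambda>a. f a + g a) = L f + L g"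
      by (rule tendsto_unique[OF nb lim[OF bounded_fun_on_add[OF fg]]])
    show "L f \<le> L g" if "\<And>a. a \<in> A \<Longrightarrow> f a \<le> g a"
    proof (rule tendsto_le[OF nb lim[OF fg(2)] lim[OF fg(1)]])
      show "eventually (\<lambda>v. m v f \<le> m v g) G"
        using G(2) by eventually_elim (rule m_mono[OF _ that])
    qed
  next
    fix f c assume f: "bounded_fun_on A f"
    have "m v (\<lambda>a. c * f a) = c * m v f" for v
      by (simp add: m_def sum_distrib_left ac_simps)
    then have "((\<lambda>v. m v (\<lambda>a. c * f a)) \<longlongrightarrow> c * L f) G"
      by (simp add: tendsto_mult lim f)
    then show "L (\<lambda>a. c * f a) = c * L f"
      by (rule tendsto_unique[OF nb lim[OF bounded_fun_on_mult[OF bounded_fun_on_const f]]])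
  next
    have "((\<lambda>v. m v (\<lambda>_. 1)) \<longlongrightarrow> 1) G"
      by (rule tendsto_eventually) (use G(2) in \<open>eventually_elim, simp add: m_const\<close>)
    then show "L (\<lambda>_. 1) = 1"
      by (rule tendsto_unique[OF nb lim[OF bounded_fun_on_const]])
  qed
  moreover have "(blinfun_apply \<phi> \<longlongrightarrow> L (blinfun_apply \<phi>)) G" for \<phi>
  proof -
    have "bounded_fun_on A (blinfun_apply \<phi>)"
    proof (rule bounded_fun_onI)
      fix a assume "a \<in> A"
      then show "\<bar>\<phi> a\<bar> \<le> norm \<phi> * B"
        using norm_blinfun[of \<phi> a] mult_left_mono[OF B, of a "norm \<phi>"] by simp
    qed
    then have "((\<lambda>v. m v (blinfun_apply \<phi>)) \<longlongrightarrow> L (blinfun_apply \<phi>)) G"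
      by (rule lim)
    moreover have "eventually (\<lambda>v. m v (blinfun_apply \<phi>) = \<phi> v) G"
      using G(2)
    proof eventually_elim
      case (elim v)
      have "m v (blinfun_apply \<phi>) = \<phi> (\<Sum>x\<in>S v. u v x *\<^sub>R x)"
        by (simp add: m_def blinfun.sum_right blinfun.scaleR_right)
      then show ?case using Su[OF elim] by simp
    qed
    ultimately show ?thesis
      by (rule Lim_transform_eventually)
  qed
  ultimately show ?thesis using that by blast
qed

text \<open>The one-dimensional step of Hahn-Banach: adding a point with \<open>E x = 1\<close> to
  one with \<open>E y = - 1\<close> lands in the kernel of \<open>E\<close>, where \<open>p\<close>
  alone dominates. Hence the lower bounds for the multiplier \<open>d\<close> stay below the upper
  ones.\<close>

lemma dominated_split_one:
  fixes L :: "'b::real_vector \<Rightarrow> real"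
  assumes L: "linear L" and p: "sublinear p" and E: "linear E"
    and le: "\<And>x. L x \<le> p x + C * \<bar>E x\<bar>"
  obtains d where "\<And>x. L x - d * E x \<le> p x"
proof (cases "\<exists>x. E x \<noteq> 0")
  case False
  then show ?thesis using le that[of 0] by simp
next
  case True
  then obtain x0 where "E x0 \<noteq> 0" by blast
  define x1 where "x1 = (1 / E x0) *\<^sub>R x0"
  have x1: "E x1 = 1" "E (- x1) = - 1"
    using \<open>E x0 \<noteq> 0\<close> by (auto simp: x1_def linear_scale[OF E] linear_neg[OF E])
  have key: "L x - p x \<le> p y - L y" if "E x = 1" "E y = - 1" for x y
    using le[of "x + y"] sublinear_add[OF p, of x y] that
    by (simp add: linear_add[OF L] linear_add[OF E])
  define d where "d = (SUP x\<in>{x. E x = 1}. L x - p x)"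
  have bdd: "bdd_above ((\<lambda>x. L x - p x) ` {x. E x = 1})"
    by (rule bdd_aboveI2[where M="p (- x1) - L (- x1)"]) (use key x1 in auto)
  have up: "L x - p x \<le> d" if "E x = 1" for x
    unfolding d_def by (rule cSUP_upper[OF _ bdd]) (use that in auto)
  have low: "d \<le> p y - L y" if "E y = - 1" for y
    unfolding d_def by (rule cSUP_least) (use x1 key that in auto)
  have "L x - d * E x \<le> p x" for x
  proof -
    consider "E x = 0" | "E x > 0" | "E x < 0" by linarith
    then show ?thesis
    proof cases
      case 1 then show ?thesis using le[of x] by simp
    next
      case 2
      define t where "t = E x"
      have "L ((1/t) *\<^sub>R x) - p ((1/t) *\<^sub>R x) \<le> d"
        using 2 by (intro up) (simp add: linear_scale[OF E] t_def)
      then show ?thesis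
        using 2 by (simp add: linear_scale[OF L] sublinear_scale[OF p] t_def field_simps)
    next
      case 3
      define t where "t = - E x"
      have t: "0 < t" "E x = - t" using 3 by (auto simp: t_def)
      have "d \<le> p ((1/t) *\<^sub>R x) - L ((1/t) *\<^sub>R x)"
        using t by (intro low) (simp add: linear_scale[OF E])
      also have "\<dots> = (1/t) * (p x - L x)"
        using t(1) by (simp add: linear_scale[OF L] sublinear_scale[OF p] algebra_simps)
      finally have "d * t \<le> p x - L x"
        using t(1) by (simp add: field_simps)
      then show ?thesis by (simp add: t(2))
    qed
  qed
  with that show ?thesis by blast
qed

text \<open>Each term \<open>C * \<bar>E e x\<bar>\<close> is first absorbed into the sublinear
  bound and then removed at the cost of a multiple of \<open>E e\<close>. For evaluations
  \<open>E e\<close> this turns approximate weak-star continuity into approximation by a finite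
  combination of points.\<close>

lemma dominated_split:
  fixes L :: "'b::real_vector \<Rightarrow> real"
  assumes "finite F" and L: "linear L" and "sublinear p" and E: "\<And>e. linear (E e)" and C: "0 \<le> C"
    and le: "\<And>x. L x \<le> p x + C * (\<Sum>e\<in>F. \<bar>E e x\<bar>)"
  shows "\<exists>c. \<forall>x. L x - (\<Sum>e\<in>F. c e * E e x) \<le> p x"
  using assms(1,3) le
proof (induction F arbitrary: p rule: finite_induct)
  case empty
  then show ?case by simp
next
  case (insert e F)
  let ?p = "\<lambda>x. p x + C * \<bar>E e x\<bar>"
  have sE: "sublinear (\<lambda>x. C * \<bar>E e x\<bar>)"
    using C by (auto simp: sublinear_def linear_add[OF E] linear_scale[OF E] abs_mult
      simp flip: distrib_left intro!: mult_left_mono abs_triangle_ineq)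
  have "\<exists>c. \<forall>x. L x - (\<Sum>e\<in>F. c e * E e x) \<le> ?p x"
    by (rule insert.IH[OF sublinear_plus[OF insert.prems(1) sE]])
      (use insert.prems(2) insert.hyps in \<open>simp add: algebra_simps\<close>)
  then obtain c where c: "\<And>x. L x - (\<Sum>e\<in>F. c e * E e x) \<le> ?p x" by blast
  have lin: "linear (\<lambda>x. L x - (\<Sum>e\<in>F. c e * E e x))"
    by (intro linear_compose_sub L linear_compose_sum ballI)
      (auto intro!: linearI simp: linear_add[OF E] linear_scale[OF E] algebra_simps)
  obtain d where d: "\<And>x. L x - (\<Sum>e\<in>F. c e * E e x) - d * E e x \<le> p x"
    using dominated_split_one[OF lin insert.prems(1) E c] by blast
  have "(\<Sum>e'\<in>insert e F. (c(e := d)) e' * E e' x) = d * E e x + (\<Sum>e\<in>F. c e * E e x)" for x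
    using insert.hyps by (auto intro!: sum.cong)
  with d show ?case
    by (intro exI[of _ "c(e := d)"]) (simp add: algebra_simps)
qed

text \<open>The limit functional \<open>\<Phi>\<close> is shown in \<open>dom\<close> to be
  weak-star continuous on the dual ball up to any \<open>\<delta>\<close>. Splitting then puts it
  within \<open>\<delta>\<close> of a point, and completeness finishes.\<close>

theorem Krein:
  fixes A :: "'a::real_normed_vector set"
  assumes complete: "complete (UNIV :: 'a set)"
    and A: "relatively_weakly_compact A" and B: "\<And>a. a \<in> A \<Longrightarrow> norm a \<le> B"
  shows "relatively_weakly_compact (convex hull A)"
  unfolding relatively_weakly_compact_def
proof (intro allI impI)
  fix G :: "'a filter" assume G: "ultrafilter G" "eventually (\<lambda>v. v \<in> convex hull A) G"
  obtain L where L: "mean A L" and lim: "\<And>\<phi>. (blinfun_apply \<phi> \<longlongrightarrow> L (blinfun_apply \<phi>)) G"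
    using convex_hull_mean[OF G B] by blast
  interpret mean A L by fact
  define \<Phi> where "\<Phi> \<phi> = L (blinfun_apply \<phi>)" for \<phi> :: "'a \<Rightarrow>\<^sub>L real"
  note lim = lim[folded \<Phi>_def]
  have nb: "G \<noteq> bot" by (rule ultrafilter_not_bot) (rule G)
  have on_A: "\<bar>\<phi> a\<bar> \<le> norm \<phi> * B" if "a \<in> A" for \<phi> :: "'a \<Rightarrow>\<^sub>L real" and a
    using norm_blinfun[of \<phi> a] mult_left_mono[OF B[OF that], of "norm \<phi>"] by simp
  have \<Phi>_le: "\<bar>\<Phi> \<phi>\<bar> \<le> norm \<phi> * B" for \<phi>
    unfolding \<Phi>_def by (rule abs_le) (rule on_A)
  have lin: "linear \<Phi>"
  proof (rule linearI)
    fix \<phi> \<psi> :: "'a \<Rightarrow>\<^sub>L real" and r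
    show "\<Phi> (\<phi> + \<psi>) = \<Phi> \<phi> + \<Phi> \<psi>"
      by (rule tendsto_unique[OF nb lim]) (simp add: plus_blinfun.rep_eq tendsto_add lim)
    show "\<Phi> (r *\<^sub>R \<phi>) = r *\<^sub>R \<Phi> \<phi>"
      by (rule tendsto_unique[OF nb lim]) (simp add: scaleR_blinfun.rep_eq tendsto_mult lim)
  qed
  have dom: "\<exists>C F. 0 \<le> C \<and> finite F \<and> (\<forall>\<phi>. \<Phi> \<phi> \<le> \<delta> * norm \<phi> + C * (\<Sum>e\<in>F. \<bar>\<phi> e\<bar>))" if \<delta>: "0 < \<delta>" for \<delta>
  proof (rule ccontr)
    assume contra: "\<not> ?thesis"
    \<comment> \<open>A pair (point, tolerance) is one weak-star constraint near 0; a tolerance that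
      is not positive means no constraint.\<close>
    define R where "R j \<phi> \<longleftrightarrow> norm \<phi> = 1 \<and> \<delta> \<le> \<Phi> \<phi> \<and> (0 < snd j \<longrightarrow> \<bar>\<phi> (fst j)\<bar> \<le> snd j)"
      for j :: "'a \<times> real" and \<phi> :: "'a \<Rightarrow>\<^sub>L real"
    have "\<exists>\<phi>. \<forall>j\<in>J. R j \<phi>" if J: "finite J" for J
    proof -
      \<comment> \<open>Large enough that breaking one constraint would push
        \<open>\<Phi> \<phi>\<close> above \<open>\<bar>B\<bar>\<close>, which is impossible for
        norm 1.\<close>
      define C where "C = (\<Sum>j\<in>J. \<bar>B\<bar> / \<bar>snd j\<bar>)"
      have C: "0 \<le> C" unfolding C_def by (intro sum_nonneg) auto
      have "\<exists>\<phi>. \<not> \<Phi> \<phi> \<le> \<delta> * norm \<phi> + C * (\<Sum>e\<in>fst ` J. \<bar>\<phi> e\<bar>)"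
        using contra C J by blast
      then obtain \<psi> where \<psi>: "\<Phi> \<psi> > \<delta> * norm \<psi> + C * (\<Sum>e\<in>fst ` J. \<bar>\<psi> e\<bar>)"
        by (auto simp: not_le)
      have "\<psi> \<noteq> 0" using \<psi> linear_0[OF lin] by auto
      define \<phi> where "\<phi> = (1 / norm \<psi>) *\<^sub>R \<psi>"
      have n: "norm \<phi> = 1" using \<open>\<psi> \<noteq> 0\<close> by (simp add: \<phi>_def)
      have "\<psi> = norm \<psi> *\<^sub>R \<phi>" using \<open>\<psi> \<noteq> 0\<close> by (simp add: \<phi>_def)
      then have "\<Phi> \<psi> = norm \<psi> * \<Phi> \<phi>" "\<And>e. \<psi> e = norm \<psi> * \<phi> e"
        by (metis linear_scale[OF lin] real_scaleR_def, metis blinfun.scaleR_left real_scaleR_def)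
      with \<psi> have "norm \<psi> * \<Phi> \<phi> > norm \<psi> * (\<delta> + C * (\<Sum>e\<in>fst ` J. \<bar>\<phi> e\<bar>))"
        by (simp add: abs_mult algebra_simps flip: sum_distrib_left)
      then have \<phi>: "\<Phi> \<phi> > \<delta> + C * (\<Sum>e\<in>fst ` J. \<bar>\<phi> e\<bar>)"
        using \<open>\<psi> \<noteq> 0\<close> by simp
      have "R j \<phi>" if j: "j \<in> J" for j
      proof -
        have "\<bar>\<phi> (fst j)\<bar> \<le> snd j" if s: "0 < snd j"
        proof (rule ccontr)
          assume "\<not> ?thesis"
          then have *: "snd j < \<bar>\<phi> (fst j)\<bar>" by simp
          have "\<bar>\<phi> (fst j)\<bar> \<le> (\<Sum>e\<in>fst ` J. \<bar>\<phi> e\<bar>)"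
            using J j by (intro member_le_sum) auto
          with * have "snd j \<le> (\<Sum>e\<in>fst ` J. \<bar>\<phi> e\<bar>)" by simp
          moreover have "\<bar>B\<bar> / \<bar>snd j\<bar> \<le> C"
            unfolding C_def using J j by (intro member_le_sum) auto
          ultimately have "(\<bar>B\<bar> / \<bar>snd j\<bar>) * snd j \<le> C * (\<Sum>e\<in>fst ` J. \<bar>\<phi> e\<bar>)"
            using s C by (intro mult_mono) auto
          then have "\<bar>B\<bar> < \<Phi> \<phi>" using \<phi> \<delta> s by simp
          then show False using \<Phi>_le[of \<phi>] n by simp
        qed
        moreover have "\<delta> \<le> \<Phi> \<phi>"
          using \<phi> C by (smt (verit) mult_nonneg_nonneg sum_nonneg abs_ge_zero)
        ultimately show ?thesis using n by (simp add: R_def)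
      qed
      then show ?thesis by blast
    qed
    then obtain \<H> where \<H>: "ultrafilter \<H>" "\<And>j. eventually (R j) \<H>"
      using ultrafilter_finite_intersection[of R] by blast
    \<comment> \<open>Functionals off the unit sphere are replaced by 0, because
      \<open>staircase\<close> asks for a bound at every index and not just eventually.\<close>
    define h where "h \<phi> = blinfun_apply (if norm \<phi> = 1 then \<phi> else 0)" for \<phi> :: "'a \<Rightarrow>\<^sub>L real"
    have ev1: "eventually (\<lambda>\<phi>. norm \<phi> = 1 \<and> \<delta> \<le> \<Phi> \<phi>) \<H>"
      using \<H>(2)[of undefined] by eventually_elim (simp add: R_def)
    obtain \<iota> a where a: "\<And>k. a k \<in> A" and up: "\<And>i k :: nat. i \<le> k \<Longrightarrow> \<delta> / 2 \<le> h (\<iota> i) (a k)"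
      and down: "\<And>i k. k < i \<Longrightarrow> h (\<iota> i) (a k) \<le> \<delta> / 4"
    proof (rule staircase[of \<H> h "\<bar>B\<bar>" \<delta>])
      show "\<bar>h \<phi> a\<bar> \<le> \<bar>B\<bar>" if "a \<in> A" for \<phi> a
        using on_A[OF that, of \<phi>] by (auto simp: h_def)
      show "eventually (\<lambda>i. \<delta> \<le> L (h i)) \<H>"
        using ev1 by eventually_elim (simp add: h_def \<Phi>_def)
      show "((\<lambda>i. h i a) \<longlongrightarrow> 0) \<H>" for a
      proof (rule tendstoI)
        fix e :: real assume e: "0 < e"
        show "eventually (\<lambda>\<phi>. dist (h \<phi> a) 0 < e) \<H>"
          using \<H>(2)[of "(a, e/2)"] by eventually_elim (use e in \<open>auto simp: R_def h_def\<close>)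
      qed
    qed (use \<delta> \<H> in auto)
    define \<psi> where "\<psi> i = (if norm (\<iota> i) = 1 then \<iota> i else 0)" for i
    have h_\<psi>: "h (\<iota> i) = blinfun_apply (\<psi> i)" for i by (simp add: h_def \<psi>_def)
    note up = up[unfolded h_\<psi>] and down = down[unfolded h_\<psi>]
    have \<psi>1: "\<bar>\<psi> i e\<bar> \<le> norm e" for i e
      using norm_blinfun[of "\<psi> i" e] by (auto simp: \<psi>_def)
    \<comment> \<open>The double limit: \<open>b\<close> is a weak limit of the points,
      \<open>c\<close> the pointwise limit of the functionals along the same ultrafilter. Points
      first gives \<open>c b \<ge> \<delta> / 2\<close>. Functionals first gives
      \<open>c b \<le> \<delta> / 4\<close>, since \<open>c\<close> is itself bounded and
      linear.\<close>
    obtain \<N> :: "nat filter" where \<N>: "\<N> \<le> sequentially" "ultrafilter \<N>"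
      using ultrafilter_exists[OF sequentially_bot] by blast
    note nbN = ultrafilter_not_bot[OF \<N>(2)]
    have "eventually (\<lambda>v. v \<in> A) (filtermap a \<N>)"
      using a by (auto simp: eventually_filtermap)
    then obtain b where "weak_limit b (filtermap a \<N>)"
      using A ultrafilter_filtermap[OF \<N>(2)] unfolding relatively_weakly_compact_def by blast
    then have b: "((\<lambda>k. \<phi> (a k)) \<longlongrightarrow> \<phi> b) \<N>" for \<phi> :: "'a \<Rightarrow>\<^sub>L real"
      by (simp add: weak_limit_def filterlim_filtermap)
    define c where "c e = Lim \<N> (\<lambda>i. \<psi> i e)" for e
    have c: "((\<lambda>i. \<psi> i e) \<longlongrightarrow> c e) \<N>" for e
      unfolding c_def by (rule ultrafilter_bounded_tendsto_Lim[OF \<N>(2), of _ "norm e"]) (use \<psi>1 in auto)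
    have "bounded_linear c"
    proof (rule bounded_linear_intro[of c 1])
      fix x y r
      show "c (x + y) = c x + c y"
        by (rule tendsto_unique[OF nbN c]) (simp add: blinfun.add_right tendsto_add c)
      show "c (r *\<^sub>R x) = r *\<^sub>R c x"
        by (rule tendsto_unique[OF nbN c]) (simp add: blinfun.scaleR_right tendsto_mult c)
      have "\<bar>c x\<bar> \<le> norm x"
        by (rule tendsto_upperbound[OF tendsto_rabs[OF c] _ nbN]) (use \<psi>1 in auto)
      then show "norm (c x) \<le> norm x * 1" by simp
    qed
    then have cB: "((\<lambda>k. c (a k)) \<longlongrightarrow> c b) \<N>"
      using b[of "Blinfun c"] by (simp add: bounded_linear_Blinfun_apply)
    have "\<delta> / 2 \<le> \<psi> i b" for i
    proof (rule tendsto_lowerbound[OF b _ nbN])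
      show "eventually (\<lambda>k. \<delta> / 2 \<le> \<psi> i (a k)) \<N>"
        by (rule filter_leD[OF \<N>(1)]) (use up in \<open>auto simp: eventually_sequentially\<close>)
    qed
    then have "\<delta> / 2 \<le> c b"
      by (intro tendsto_lowerbound[OF c _ nbN]) simp
    moreover have "c (a k) \<le> \<delta> / 4" for k
    proof (rule tendsto_upperbound[OF c _ nbN])
      show "eventually (\<lambda>i. \<psi> i (a k) \<le> \<delta> / 4) \<N>"
        by (rule filter_leD[OF \<N>(1)])
          (use down in \<open>auto simp: eventually_sequentially intro!: exI[of _ "Suc k"]\<close>)
    qed
    then have "c b \<le> \<delta> / 4"
      by (intro tendsto_upperbound[OF cB _ nbN]) simp
    ultimately show False using \<delta> by simp
  qed
  obtain w where w: "\<And>\<phi>. \<Phi> \<phi> = blinfun_apply \<phi> w"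
  proof (rule approximable_bidual[OF complete, of \<Phi>])
    fix \<delta> :: real assume \<delta>: "0 < \<delta>"
    obtain C F where CF: "0 \<le> C" "finite F" "\<And>\<phi>. \<Phi> \<phi> \<le> \<delta> * norm \<phi> + C * (\<Sum>e\<in>F. \<bar>\<phi> e\<bar>)"
      using dom[OF \<delta>] by blast
    have "\<exists>c. \<forall>\<phi>. \<Phi> \<phi> - (\<Sum>e\<in>F. c e * blinfun_apply \<phi> e) \<le> \<delta> * norm \<phi>"
    proof (rule dominated_split[OF CF(2) lin _ _ CF(1,3)])
      show "sublinear (\<lambda>\<phi> :: 'a \<Rightarrow>\<^sub>L real. \<delta> * norm \<phi>)"
        using \<delta> by (auto simp: sublinear_def norm_triangle_ineq simp flip: distrib_left)
      show "linear (\<lambda>\<phi>. blinfun_apply \<phi> e)" for e :: 'a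
        by (rule linearI) (simp_all add: blinfun.add_left blinfun.scaleR_left)
    qed
    then obtain c where c: "\<And>\<phi>. \<Phi> \<phi> - (\<Sum>e\<in>F. c e * blinfun_apply \<phi> e) \<le> \<delta> * norm \<phi>" by blast
    define w where "w = (\<Sum>e\<in>F. c e *\<^sub>R e)"
    have le: "\<Phi> \<phi> - \<phi> w \<le> \<delta> * norm \<phi>" for \<phi>
      using c[of \<phi>] by (simp add: w_def blinfun.sum_right blinfun.scaleR_right)
    have "\<bar>\<Phi> \<phi> - \<phi> w\<bar> \<le> \<delta> * norm \<phi>" for \<phi>
      using le[of \<phi>] le[of "- \<phi>"] by (simp add: linear_neg[OF lin] blinfun.minus_left abs_le_iff)
    then show "\<exists>w. \<forall>\<phi>. \<bar>\<Phi> \<phi> - \<phi> w\<bar> \<le> \<delta> * norm \<phi>" by blast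
  qed blast
  have "weak_limit w G"
    unfolding weak_limit_def using lim w by simp
  then show "\<exists>u. weak_limit u G" ..
qed


section \<open>Duals of normed structures\<close>

lemma normed_space_onD:
  assumes "normed_space_on V"
  shows "vzero V \<in> vcarrier V"
    and "x \<in> vcarrier V \<Longrightarrow> y \<in> vcarrier V \<Longrightarrow> vadd V x y \<in> vcarrier V"
    and "x \<in> vcarrier V \<Longrightarrow> vscale V a x \<in> vcarrier V"
    and "x \<in> vcarrier V \<Longrightarrow> 0 \<le> vnorm V x"
    and "x \<in> vcarrier V \<Longrightarrow> vnorm V x = 0 \<longleftrightarrow> x = vzero V"
    and "x \<in> vcarrier V \<Longrightarrow> vnorm V (vscale V a x) = \<bar>a\<bar> * vnorm V x"
  using assms by (auto simp: normed_space_on_def real_vector_space_on_def)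

lemma dual_carrierD:
  assumes "\<phi> \<in> dual_carrier V"
  shows "\<phi> \<in> extensional (vcarrier V)"
    and "x \<in> vcarrier V \<Longrightarrow> y \<in> vcarrier V \<Longrightarrow> \<phi> (vadd V x y) = \<phi> x + \<phi> y"
    and "x \<in> vcarrier V \<Longrightarrow> \<phi> (vscale V a x) = a * \<phi> x"
    and "\<exists>C. \<forall>x\<in>vcarrier V. \<bar>\<phi> x\<bar> \<le> C * vnorm V x"
  using assms by (auto simp: dual_carrier_def)

lemma dual_space_simps [simp]:
  "vcarrier (dual_space V) = dual_carrier V"
  "vzero (dual_space V) = (\<lambda>x\<in>vcarrier V. 0)"
  "vadd (dual_space V) \<phi> \<psi> = (\<lambda>x\<in>vcarrier V. \<phi> x + \<psi> x)"
  "vscale (dual_space V) a \<phi> = (\<lambda>x\<in>vcarrier V. a * \<phi> x)"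
  "vnorm (dual_space V) \<phi> = (SUP x\<in>{x\<in>vcarrier V. vnorm V x \<le> 1}. \<bar>\<phi> x\<bar>)"
  by (simp_all add: dual_space_def)

abbreviation dual_norm :: "'v normed_structure \<Rightarrow> ('v \<Rightarrow> real) \<Rightarrow> real" where
  "dual_norm V \<phi> \<equiv> (SUP x\<in>{x\<in>vcarrier V. vnorm V x \<le> 1}. \<bar>\<phi> x\<bar>)"

context
  fixes V :: "'v normed_structure"
  assumes V: "normed_space_on V"
begin

lemma dual_bdd_above:
  assumes "\<phi> \<in> dual_carrier V"
  shows "bdd_above ((\<lambda>x. \<bar>\<phi> x\<bar>) ` {x\<in>vcarrier V. vnorm V x \<le> 1})"
proof -
  obtain C where C: "\<forall>x\<in>vcarrier V. \<bar>\<phi> x\<bar> \<le> C * vnorm V x"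
    using dual_carrierD(4)[OF assms] by blast
  show ?thesis
  proof (rule bdd_aboveI2[where M="\<bar>C\<bar>"])
    fix x assume x: "x \<in> {x\<in>vcarrier V. vnorm V x \<le> 1}"
    then have "\<bar>\<phi> x\<bar> \<le> C * vnorm V x" using C by simp
    also have "\<dots> \<le> \<bar>C\<bar> * 1"
      using x normed_space_onD(4)[OF V] by (intro mult_mono) auto
    finally show "\<bar>\<phi> x\<bar> \<le> \<bar>C\<bar>" by simp
  qed
qed

lemma dual_norm_upper:
  "\<phi> \<in> dual_carrier V \<Longrightarrow> x \<in> vcarrier V \<Longrightarrow> vnorm V x \<le> 1 \<Longrightarrow> \<bar>\<phi> x\<bar> \<le> dual_norm V \<phi>"
  by (rule cSUP_upper[OF _ dual_bdd_above]) auto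

lemma dual_unit_ball_nonempty: "{x\<in>vcarrier V. vnorm V x \<le> 1} \<noteq> {}"
  using normed_space_onD(1)[OF V] normed_space_onD(5)[OF V, of "vzero V"]
  by (auto intro!: exI[of _ "vzero V"])

lemma dual_norm_least:
  "(\<And>x. x \<in> vcarrier V \<Longrightarrow> vnorm V x \<le> 1 \<Longrightarrow> \<bar>\<phi> x\<bar> \<le> c) \<Longrightarrow> dual_norm V \<phi> \<le> c"
  by (rule cSUP_least[OF dual_unit_ball_nonempty]) auto

lemma dual_norm_nonneg: "\<phi> \<in> dual_carrier V \<Longrightarrow> 0 \<le> dual_norm V \<phi>"
  using dual_unit_ball_nonempty dual_norm_upper[of \<phi>] by (smt (verit) Collect_empty_eq)

lemma dual_norm_bound:
  assumes \<phi>: "\<phi> \<in> dual_carrier V" and x: "x \<in> vcarrier V"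
  shows "\<bar>\<phi> x\<bar> \<le> dual_norm V \<phi> * vnorm V x"
proof (cases "vnorm V x = 0")
  case True
  then show ?thesis using dual_carrierD(4)[OF \<phi>] x by fastforce
next
  case False
  then have pos: "0 < vnorm V x" using normed_space_onD(4)[OF V x] by simp
  have "\<bar>\<phi> (vscale V (1 / vnorm V x) x)\<bar> \<le> dual_norm V \<phi>"
    using pos by (intro dual_norm_upper \<phi> normed_space_onD(3)[OF V x]) (simp add: normed_space_onD(6)[OF V x])
  then show ?thesis
    using pos by (simp add: dual_carrierD(3)[OF \<phi> x] field_simps)
qed

lemma dual_carrier_add:
  assumes "\<phi> \<in> dual_carrier V" "\<psi> \<in> dual_carrier V"
  shows "(\<lambda>x\<in>vcarrier V. \<phi> x + \<psi> x) \<in> dual_carrier V"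
  unfolding dual_carrier_def
proof (safe intro!: exI[of _ "dual_norm V \<phi> + dual_norm V \<psi>"])
  fix x assume x: "x \<in> vcarrier V"
  show "\<bar>(\<lambda>x\<in>vcarrier V. \<phi> x + \<psi> x) x\<bar> \<le> (dual_norm V \<phi> + dual_norm V \<psi>) * vnorm V x"
    using dual_norm_bound[OF assms(1) x] dual_norm_bound[OF assms(2) x] x
    by (simp add: distrib_right)
qed (use assms in \<open>auto simp: dual_carrierD normed_space_onD[OF V] algebra_simps\<close>)

lemma dual_carrier_scale:
  assumes "\<phi> \<in> dual_carrier V"
  shows "(\<lambda>x\<in>vcarrier V. a * \<phi> x) \<in> dual_carrier V"
  unfolding dual_carrier_def
proof (safe intro!: exI[of _ "\<bar>a\<bar> * dual_norm V \<phi>"])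
  fix x assume x: "x \<in> vcarrier V"
  show "\<bar>(\<lambda>x\<in>vcarrier V. a * \<phi> x) x\<bar> \<le> (\<bar>a\<bar> * dual_norm V \<phi>) * vnorm V x"
    using mult_left_mono[OF dual_norm_bound[OF assms x], of "\<bar>a\<bar>"] x
    by (simp add: abs_mult mult.assoc)
qed (use assms in \<open>auto simp: dual_carrierD normed_space_onD[OF V] algebra_simps\<close>)

lemma bidual_embedding:
  assumes v: "v \<in> vcarrier V"
  shows "(\<lambda>\<phi>\<in>dual_carrier V. \<phi> v) \<in> dual_carrier (dual_space V)"
  unfolding dual_carrier_def[of "dual_space V"] dual_space_simps
proof (intro CollectI conjI ballI allI exI[of _ "vnorm V v"])
  fix \<phi> \<psi> a assume \<phi>: "\<phi> \<in> dual_carrier V"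
  show "(\<lambda>\<phi>\<in>dual_carrier V. \<phi> v) (\<lambda>x\<in>vcarrier V. a * \<phi> x) = a * (\<lambda>\<phi>\<in>dual_carrier V. \<phi> v) \<phi>"
    using dual_carrier_scale[OF \<phi>] \<phi> v by simp
  show "\<bar>(\<lambda>\<phi>\<in>dual_carrier V. \<phi> v) \<phi>\<bar> \<le> vnorm V v * dual_norm V \<phi>"
    using dual_norm_bound[OF \<phi> v] \<phi> by (simp add: mult.commute)
  assume \<psi>: "\<psi> \<in> dual_carrier V"
  show "(\<lambda>\<phi>\<in>dual_carrier V. \<phi> v) (\<lambda>x\<in>vcarrier V. \<phi> x + \<psi> x) =
      (\<lambda>\<phi>\<in>dual_carrier V. \<phi> v) \<phi> + (\<lambda>\<phi>\<in>dual_carrier V. \<phi> v) \<psi>"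
    using dual_carrier_add[OF \<phi> \<psi>] \<phi> \<psi> v by simp
qed simp

end


section \<open>Davis--Figiel--Johnson--Pelczynski interpolation\<close>

text \<open>The squares \<open>Q y\<close> of the distance to \<open>c\<close> have infimum zero: near a positive minimum the
  functional \<open>c - y\<close> would separate \<open>c\<close> from \<open>D\<close>.\<close>

lemma convex_approximation_finite:
  fixes D :: "('i \<Rightarrow> real) set"
  assumes I: "finite I" and D: "D \<noteq> {}"
    and convex: "\<And>y z t. y \<in> D \<Longrightarrow> z \<in> D \<Longrightarrow> 0 \<le> t \<Longrightarrow> t \<le> 1 \<Longrightarrow> (\<lambda>i. y i + t * (z i - y i)) \<in> D"
    and bounded: "\<And>y i. y \<in> D \<Longrightarrow> i \<in> I \<Longrightarrow> \<bar>y i\<bar> \<le> M i"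
    and weak: "\<And>\<tau> \<epsilon>. 0 < \<epsilon> \<Longrightarrow> \<exists>y\<in>D. (\<Sum>i\<in>I. \<tau> i * c i) - \<epsilon> \<le> (\<Sum>i\<in>I. \<tau> i * y i)"
    and \<eta>: "0 < \<eta>"
  obtains y where "y \<in> D" "\<And>i. i \<in> I \<Longrightarrow> \<bar>y i - c i\<bar> < \<eta>"
proof -
  define Q where "Q y = (\<Sum>i\<in>I. (y i - c i)\<^sup>2)" for y
  define m where "m = (INF y\<in>D. Q y)"
  have Q0: "0 \<le> Q y" for y unfolding Q_def by (intro sum_nonneg) auto
  have bdd: "bdd_below (Q ` D)" by (rule bdd_belowI2[where m=0]) (rule Q0)
  have m_le: "m \<le> Q y" if "y \<in> D" for y unfolding m_def using cINF_lower[OF bdd that] .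
  have near: "\<exists>y\<in>D. Q y < m + e" if "0 < e" for e
    using cINF_less_iff[OF D bdd, of "m + e"] that by (auto simp: m_def)
  have m0: "0 \<le> m" unfolding m_def by (rule cINF_greatest[OF D]) (rule Q0)
  have "m = 0"
  proof (rule ccontr)
    assume "m \<noteq> 0"
    with m0 have m: "0 < m" by simp
    define B where "B = (\<Sum>i\<in>I. (2 * M i)\<^sup>2) + 1"
    have B: "1 \<le> B" unfolding B_def by (simp add: sum_nonneg)
    \<comment> \<open>\<open>B\<close> bounds the squared length of segments in \<open>D\<close>
      over \<open>I\<close>. A move by \<open>t\<close> towards \<open>z\<close> changes
      \<open>Q\<close> by at most \<open>- t m + t (t B)\<close>; as \<open>t B \<le> m / 2\<close>,
      this gains \<open>t m / 2\<close>, more than the slack \<open>t m / 4\<close> allowed for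
      \<open>y\<close>.\<close>
    define t where "t = min 1 (m / (2 * B))"
    have t: "0 < t" "t \<le> 1" using m B by (auto simp: t_def)
    have tB: "t * B \<le> m / 2"
    proof -
      have "t * B \<le> m / (2 * B) * B" using B by (intro mult_right_mono) (auto simp: t_def)
      then show ?thesis using B by simp
    qed
    obtain y where y: "y \<in> D" "Q y < m + t * m / 4"
      using near[of "t * m / 4"] t m by auto
    obtain z where z: "z \<in> D" "(\<Sum>i\<in>I. (c i - y i) * c i) - m / 2 \<le> (\<Sum>i\<in>I. (c i - y i) * z i)"
      using weak[of "m / 2" "\<lambda>i. c i - y i"] m by auto
    define S where "S = (\<Sum>i\<in>I. (c i - y i) * (z i - y i))"
    have "S = (\<Sum>i\<in>I. (c i - y i) * z i) - (\<Sum>i\<in>I. (c i - y i) * y i)"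
      unfolding S_def by (simp add: right_diff_distrib sum_subtractf)
    also have "\<dots> \<ge> (\<Sum>i\<in>I. (c i - y i) * c i) - m / 2 - (\<Sum>i\<in>I. (c i - y i) * y i)"
      using z(2) by simp
    also have "(\<Sum>i\<in>I. (c i - y i) * c i) - m / 2 - (\<Sum>i\<in>I. (c i - y i) * y i) = Q y - m / 2"
      unfolding Q_def by (simp add: power2_eq_square algebra_simps flip: sum_subtractf sum.distrib)
    finally have S: "m / 2 \<le> S" using m_le[OF y(1)] by simp
    have sq: "(\<Sum>i\<in>I. (z i - y i)\<^sup>2) \<le> B"
    proof -
      have "(z i - y i)\<^sup>2 \<le> (2 * M i)\<^sup>2" if "i \<in> I" for i
        using bounded[OF y(1) that] bounded[OF z(1) that] by (intro abs_le_square_iff[THEN iffD1]) auto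
      then have "(\<Sum>i\<in>I. (z i - y i)\<^sup>2) \<le> (\<Sum>i\<in>I. (2 * M i)\<^sup>2)" by (rule sum_mono)
      then show ?thesis by (simp add: B_def)
    qed
    have "Q (\<lambda>i. y i + t * (z i - y i)) = (\<Sum>i\<in>I. (y i - c i)\<^sup>2 - 2 * t * ((c i - y i) * (z i - y i)) + t\<^sup>2 * (z i - y i)\<^sup>2)"
      unfolding Q_def by (rule sum.cong) (auto simp: power2_eq_square algebra_simps)
    also have "\<dots> = Q y - 2 * t * S + t\<^sup>2 * (\<Sum>i\<in>I. (z i - y i)\<^sup>2)"
      by (simp add: Q_def S_def sum.distrib sum_subtractf sum_distrib_left)
    also have "\<dots> \<le> Q y - t * m + t * (t * B)"
    proof -
      have "t * m \<le> 2 * t * S" using mult_left_mono[OF S, of "2 * t"] t by simp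
      moreover have "t\<^sup>2 * (\<Sum>i\<in>I. (z i - y i)\<^sup>2) \<le> t * (t * B)"
        using mult_left_mono[OF sq, of "t\<^sup>2"] by (simp add: power2_eq_square mult.assoc)
      ultimately show ?thesis by linarith
    qed
    also have "\<dots> < m"
    proof -
      have "t * (t * B) \<le> t * m / 2" using mult_left_mono[OF tB, of t] t by simp
      moreover have "0 < t * m" using t m by simp
      ultimately show ?thesis using y(2) by linarith
    qed
    finally show False
      using m_le[OF convex[OF y(1) z(1)], of t] t by simp
  qed
  then obtain y where y: "y \<in> D" "Q y < \<eta>\<^sup>2"
    using near[of "\<eta>\<^sup>2"] \<eta> by auto
  have "\<bar>y i - c i\<bar> < \<eta>" if "i \<in> I" for i
  proof -
    have "(y i - c i)\<^sup>2 \<le> Q y"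
      unfolding Q_def using I that by (intro member_le_sum) auto
    with y(2) have "(y i - c i)\<^sup>2 < \<eta>\<^sup>2" by simp
    then show ?thesis using \<eta> power2_less_imp_less[of "\<bar>y i - c i\<bar>" \<eta>] by simp
  qed
  with y(1) that show ?thesis by blast
qed

text \<open>The scalars converge along the same ultrafilter by compactness. This serves both for the
  two signs of the generators and for bounded multiples of their hull.\<close>

lemma relatively_weakly_compact_scaled:
  fixes W :: "'a::real_normed_vector set"
  assumes W: "relatively_weakly_compact W" and R: "compact R"
  shows "relatively_weakly_compact ((\<lambda>(r, w). r *\<^sub>R w) ` (R \<times> W))"
  unfolding relatively_weakly_compact_def
proof (intro allI impI)
  fix G :: "'a filter"
  assume G: "ultrafilter G" "eventually (\<lambda>v. v \<in> (\<lambda>(r, w). r *\<^sub>R w) ` (R \<times> W)) G"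
  have "\<forall>v. \<exists>r w. v \<in> (\<lambda>(r, w). r *\<^sub>R w) ` (R \<times> W) \<longrightarrow> r \<in> R \<and> w \<in> W \<and> v = r *\<^sub>R w"
    by auto
  then obtain r w where rw: "\<And>v. v \<in> (\<lambda>(r, w). r *\<^sub>R w) ` (R \<times> W) \<Longrightarrow>
      r v \<in> R \<and> w v \<in> W \<and> v = r v *\<^sub>R w v"
    by metis
  have "eventually (\<lambda>v. v \<in> W) (filtermap w G)"
    unfolding eventually_filtermap using G(2) by eventually_elim (use rw in blast)
  then obtain k where k: "weak_limit k (filtermap w G)"
    using W ultrafilter_filtermap[OF G(1)] unfolding relatively_weakly_compact_def by blast
  have "eventually (\<lambda>v. r v \<in> R) G"
    using G(2) by eventually_elim (use rw in blast)
  then obtain l where l: "(r \<longlongrightarrow> l) G"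
    using ultrafilter_compact_limit[OF G(1) R] by blast
  have "weak_limit (l *\<^sub>R k) G"
    unfolding weak_limit_def
  proof
    fix \<phi> :: "'a \<Rightarrow>\<^sub>L real"
    have "((\<lambda>v. \<phi> (w v)) \<longlongrightarrow> \<phi> k) G"
      using k by (simp add: weak_limit_def filterlim_filtermap)
    then have "((\<lambda>v. r v * \<phi> (w v)) \<longlongrightarrow> l * \<phi> k) G"
      by (intro tendsto_mult l)
    moreover have "eventually (\<lambda>v. r v * \<phi> (w v) = \<phi> v) G"
      using G(2)
    proof eventually_elim
      case (elim v)
      then have "v = r v *\<^sub>R w v" using rw by blast
      then show ?case by (metis blinfun.scaleR_right real_scaleR_def)
    qed
    ultimately show "(blinfun_apply \<phi> \<longlongrightarrow> \<phi> (l *\<^sub>R k)) G"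
      by (simp add: blinfun.scaleR_right Lim_transform_eventually)
  qed
  then show "\<exists>u. weak_limit u G" ..
qed

section \<open>The interpolation norm and its completeness\<close>

locale interpolation =
  fixes W :: "'a::real_normed_vector set"
  assumes complete_UNIV: "complete (UNIV :: 'a set)"
    and convex: "convex W" and sym: "w \<in> W \<Longrightarrow> - w \<in> W" and nonempty: "W \<noteq> {}"
    and norm_le_1: "w \<in> W \<Longrightarrow> norm w \<le> 1"
begin

text \<open>The gauge of the convex hull of \<open>2 ^ n\<close> times \<open>W\<close> and
  \<open>1 / 2 ^ n\<close> times the unit ball; up to the factor \<open>1 / 2 ^ n\<close> it is the
  K-functional at parameter \<open>4 ^ n\<close>. On \<open>W\<close> it is at most
  \<open>1 / 2 ^ n\<close>, which makes the squares summable there.\<close>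

definition K :: "nat \<Rightarrow> 'a \<Rightarrow> real" where
  "K n u = (INF (r, w)\<in>{0..} \<times> W. r / 2 ^ n + 2 ^ n * norm (u - r *\<^sub>R w))"

lemma K_bdd: "bdd_below ((\<lambda>(r, w). r / 2 ^ n + 2 ^ n * norm (u - r *\<^sub>R w)) ` ({0..} \<times> W))"
  by (rule bdd_belowI2[where m=0]) auto

lemma K_nonempty: "{0::real..} \<times> W \<noteq> {}"
  using nonempty by auto

lemma K_le: "0 \<le> r \<Longrightarrow> w \<in> W \<Longrightarrow> K n u \<le> r / 2 ^ n + 2 ^ n * norm (u - r *\<^sub>R w)"
  unfolding K_def using cINF_lower[OF K_bdd, of "(r, w)" n u] by auto

lemma K_ge:
  "(\<And>r w. 0 \<le> r \<Longrightarrow> w \<in> W \<Longrightarrow> a \<le> r / 2 ^ n + 2 ^ n * norm (u - r *\<^sub>R w)) \<Longrightarrow> a \<le> K n u"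
  unfolding K_def by (rule cINF_greatest[OF K_nonempty]) auto

lemma K_less:
  assumes "K n u < c"
  obtains r w where "0 \<le> r" "w \<in> W" "r / 2 ^ n + 2 ^ n * norm (u - r *\<^sub>R w) < c"
  using assms cINF_less_iff[OF K_nonempty K_bdd, of n u c] unfolding K_def by auto

lemma K_nonneg [simp]: "0 \<le> K n u"
  by (rule K_ge) auto

lemma K_le_norm: "K n u \<le> 2 ^ n * norm u"
  using nonempty K_le[of 0 _ n u] by auto

lemma K_mem: "w \<in> W \<Longrightarrow> K n w \<le> 1 / 2 ^ n"
  using K_le[of 1 w n w] by simp

lemma norm_le_K0: "norm u \<le> K 0 u"
proof (rule K_ge)
  fix r w assume "0 \<le> (r::real)" "w \<in> W"
  then have "norm (r *\<^sub>R w) \<le> r"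
    using norm_le_1[of w] by (simp add: mult_left_le)
  then show "norm u \<le> r / 2 ^ 0 + 2 ^ 0 * norm (u - r *\<^sub>R w)"
    using norm_triangle_ineq[of "r *\<^sub>R w" "u - r *\<^sub>R w"] by simp
qed

lemma K_add: "K n (u + v) \<le> K n u + K n v"
proof -
  have *: "K n (u + v) \<le> (r / 2 ^ n + 2 ^ n * norm (u - r *\<^sub>R w)) + (s / 2 ^ n + 2 ^ n * norm (v - s *\<^sub>R z))"
    if rw: "0 \<le> r" "w \<in> W" and sz: "0 \<le> s" "z \<in> W" for r w s z
  proof -
    obtain e where e: "e \<in> W" "(r + s) *\<^sub>R e = r *\<^sub>R w + s *\<^sub>R z"
    proof (cases "r + s = 0")
      case True
      then have "r = 0" "s = 0" using rw sz by auto
      then show ?thesis using rw(2) that[of w] by simp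
    next
      case False
      have "(r / (r + s)) *\<^sub>R w + (s / (r + s)) *\<^sub>R z \<in> W"
        by (rule convexD[OF convex]) (use rw sz False in \<open>auto simp flip: add_divide_distrib\<close>)
      then show ?thesis
        using False by (intro that) (auto simp: scaleR_right_distrib)
    qed
    have "K n (u + v) \<le> (r + s) / 2 ^ n + 2 ^ n * norm ((u - r *\<^sub>R w) + (v - s *\<^sub>R z))"
      using K_le[of "r + s" e n "u + v"] e rw sz by (simp add: algebra_simps)
    also have "\<dots> \<le> (r + s) / 2 ^ n + 2 ^ n * (norm (u - r *\<^sub>R w) + norm (v - s *\<^sub>R z))"
      by (intro add_left_mono mult_left_mono norm_triangle_ineq) auto
    finally show ?thesis by (simp add: add_divide_distrib algebra_simps)
  qed
  have "K n (u + v) - (s / 2 ^ n + 2 ^ n * norm (v - s *\<^sub>R z)) \<le> K n u" if "0 \<le> s" "z \<in> W" for s z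
    by (rule K_ge) (use *[OF _ _ that] in \<open>simp add: algebra_simps\<close>)
  then have "K n (u + v) - K n u \<le> K n v"
    by (intro K_ge) (simp add: algebra_simps)
  then show ?thesis by simp
qed

lemma K_scale_le: "K n (t *\<^sub>R u) \<le> \<bar>t\<bar> * K n u"
proof (cases "t = 0")
  case True
  then show ?thesis using K_le_norm[of n 0] by simp
next
  case False
  have "(1 / \<bar>t\<bar>) * K n (t *\<^sub>R u) \<le> K n u"
  proof (rule K_ge)
    fix r w assume rw: "0 \<le> (r::real)" "w \<in> W"
    \<comment> \<open>Symmetry of \<open>W\<close> absorbs the sign of \<open>t\<close>, since the
      coefficient in \<open>K\<close> has to stay non-negative.\<close>
    have w': "sgn t *\<^sub>R w \<in> W" using rw(2) sym[of w] False by (auto simp: sgn_if)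
    have "\<bar>t\<bar> * r * sgn t = t * r"
      using abs_mult_sgn[of t] by (metis mult.assoc mult.commute)
    then have e: "(\<bar>t\<bar> * r) *\<^sub>R (sgn t *\<^sub>R w) = t *\<^sub>R (r *\<^sub>R w)"
      by (simp only: scaleR_scaleR)
    have "K n (t *\<^sub>R u) \<le> (\<bar>t\<bar> * r) / 2 ^ n + 2 ^ n * norm (t *\<^sub>R (u - r *\<^sub>R w))"
      using K_le[OF _ w', of "\<bar>t\<bar> * r" n "t *\<^sub>R u"] rw(1) unfolding e scaleR_diff_right by simp
    also have "\<dots> = \<bar>t\<bar> * (r / 2 ^ n + 2 ^ n * norm (u - r *\<^sub>R w))"
      by (simp only: norm_scaleR) (simp add: distrib_left)
    finally show "(1 / \<bar>t\<bar>) * K n (t *\<^sub>R u) \<le> r / 2 ^ n + 2 ^ n * norm (u - r *\<^sub>R w)"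
      using False by (simp add: pos_divide_le_eq mult.commute)
  qed
  then show ?thesis using False by (simp add: pos_divide_le_eq mult.commute)
qed

lemma K_scale: "K n (t *\<^sub>R u) = \<bar>t\<bar> * K n u"
proof (cases "t = 0")
  case True
  then show ?thesis using K_scale_le[of n t u] by (simp add: order_antisym)
next
  case False
  have "K n u \<le> \<bar>1 / t\<bar> * K n (t *\<^sub>R u)"
    using K_scale_le[of n "1 / t" "t *\<^sub>R u"] False by simp
  then have "\<bar>t\<bar> * K n u \<le> K n (t *\<^sub>R u)"
    using False by (simp add: pos_le_divide_eq mult.commute)
  then show ?thesis using K_scale_le[of n t u] by simp
qed

lemma K_contraction:
  assumes "linear T" "\<And>x. norm (T x) \<le> norm x" "\<And>w. w \<in> W \<Longrightarrow> T w \<in> W"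
  shows "K n (T u) \<le> K n u"
proof (rule K_ge)
  fix r w assume rw: "0 \<le> (r::real)" "w \<in> W"
  have "K n (T u) \<le> r / 2 ^ n + 2 ^ n * norm (T (u - r *\<^sub>R w))"
    using K_le[OF rw(1) assms(3)[OF rw(2)]] by (simp add: linear_diff[OF assms(1)] linear_scale[OF assms(1)])
  also have "\<dots> \<le> r / 2 ^ n + 2 ^ n * norm (u - r *\<^sub>R w)"
    by (intro add_left_mono mult_left_mono assms(2)) auto
  finally show "K n (T u) \<le> r / 2 ^ n + 2 ^ n * norm (u - r *\<^sub>R w)" .
qed

lemma continuous_on_K [continuous_intros]: "continuous_on S (K n)"
proof -
  have le: "K n u - K n v \<le> 2 ^ n * norm (u - v)" for u v
    using K_add[of n v "u - v"] K_le_norm[of n "u - v"] by simp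
  have "\<bar>K n u - K n v\<bar> \<le> 2 ^ n * norm (u - v)" for u v
    using le[of u v] le[of v u] by (simp add: abs_le_iff norm_minus_commute)
  then have "(2 ^ n)-lipschitz_on S (K n)"
    by (intro lipschitz_onI) (auto simp: dist_norm)
  then show ?thesis by (rule lipschitz_on_continuous_on)
qed

definition carrier :: "'a set" where
  "carrier = {u. summable (\<lambda>n. (K n u)\<^sup>2)}"

definition N :: "'a \<Rightarrow> real" where
  "N u = sqrt (\<Sum>n. (K n u)\<^sup>2)"

definition ball :: "real \<Rightarrow> 'a set" where
  "ball c = {u \<in> carrier. N u \<le> c}"

text \<open>Since the terms are non-negative, finite sections decide the bound. Norm inequalities
  thereby reduce to those of \<open>L2_set\<close>, and each single condition is closed for the
  ambient norm.\<close>

lemma mem_ball_iff: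
  assumes "0 \<le> c"
  shows "u \<in> ball c \<longleftrightarrow> (\<forall>m. L2_set (\<lambda>n. K n u) {..<m} \<le> c)"
proof -
  have "u \<in> ball c \<longleftrightarrow> (\<forall>m. (\<Sum>n<m. (K n u)\<^sup>2) \<le> c\<^sup>2)"
  proof
    assume "u \<in> ball c"
    then have s: "summable (\<lambda>n. (K n u)\<^sup>2)" "sqrt (\<Sum>n. (K n u)\<^sup>2) \<le> c"
      by (auto simp: ball_def carrier_def N_def)
    then have "(\<Sum>n. (K n u)\<^sup>2) \<le> c\<^sup>2"
      using assms by (simp add: real_sqrt_le_iff' sqrt_le_D)
    then show "\<forall>m. (\<Sum>n<m. (K n u)\<^sup>2) \<le> c\<^sup>2"
      using sum_le_suminf[OF s(1)] by (meson finite_lessThan order_trans zero_le_power2)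
  next
    assume le: "\<forall>m. (\<Sum>n<m. (K n u)\<^sup>2) \<le> c\<^sup>2"
    then have s: "summable (\<lambda>n. (K n u)\<^sup>2)"
      by (intro summableI_nonneg_bounded[of _ "c\<^sup>2"]) auto
    then have "(\<Sum>n. (K n u)\<^sup>2) \<le> c\<^sup>2"
      using le by (intro suminf_le_const) auto
    then have "sqrt (\<Sum>n. (K n u)\<^sup>2) \<le> c"
      using assms by (intro real_le_lsqrt) auto
    with s show "u \<in> ball c" by (simp add: ball_def carrier_def N_def)
  qed
  also have "\<dots> \<longleftrightarrow> (\<forall>m. L2_set (\<lambda>n. K n u) {..<m} \<le> c)"
    unfolding L2_set_def using assms by (simp add: real_sqrt_le_iff' sum_nonneg real_le_lsqrt sqrt_le_D)
  finally show ?thesis .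
qed

lemma N_nonneg: "u \<in> carrier \<Longrightarrow> 0 \<le> N u"
  by (simp add: N_def carrier_def suminf_nonneg)

lemma L2_le_N: "u \<in> carrier \<Longrightarrow> L2_set (\<lambda>n. K n u) {..<m} \<le> N u"
  using mem_ball_iff[of "N u" u] N_nonneg[of u] by (simp add: ball_def)

lemma K_le_N: "u \<in> carrier \<Longrightarrow> K n u \<le> N u"
  using L2_le_N[of u "Suc n"] member_le_L2_set[of "{..<Suc n}" n "\<lambda>n. K n u"] by simp

lemma norm_le_N: "u \<in> carrier \<Longrightarrow> norm u \<le> N u"
  using norm_le_K0 K_le_N by (rule order_trans)

lemma N_leI: "0 \<le> c \<Longrightarrow> (\<And>m. L2_set (\<lambda>n. K n u) {..<m} \<le> c) \<Longrightarrow> u \<in> carrier \<and> N u \<le> c"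
  using mem_ball_iff[of c u] by (simp add: ball_def)

lemma N_add:
  assumes "u \<in> carrier" "v \<in> carrier"
  shows "u + v \<in> carrier \<and> N (u + v) \<le> N u + N v"
proof (rule N_leI)
  fix m
  have "L2_set (\<lambda>n. K n (u + v)) {..<m} \<le> L2_set (\<lambda>n. K n u + K n v) {..<m}"
    by (rule L2_set_mono) (auto intro: K_add)
  also have "\<dots> \<le> L2_set (\<lambda>n. K n u) {..<m} + L2_set (\<lambda>n. K n v) {..<m}"
    by (rule L2_set_triangle_ineq)
  also have "\<dots> \<le> N u + N v"
    by (intro add_mono L2_le_N assms)
  finally show "L2_set (\<lambda>n. K n (u + v)) {..<m} \<le> N u + N v" .
qed (use assms N_nonneg in auto)

lemma scale_mem: "u \<in> carrier \<Longrightarrow> t *\<^sub>R u \<in> carrier"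
  by (simp add: carrier_def K_scale power_mult_distrib)

lemma N_scale: "u \<in> carrier \<Longrightarrow> N (t *\<^sub>R u) = \<bar>t\<bar> * N u"
  by (simp add: carrier_def N_def K_scale power_mult_distrib suminf_mult real_sqrt_mult)

lemma N_contraction:
  assumes "linear T" "\<And>x. norm (T x) \<le> norm x" "\<And>w. w \<in> W \<Longrightarrow> T w \<in> W" "u \<in> carrier"
  shows "T u \<in> carrier \<and> N (T u) \<le> N u"
proof (rule N_leI)
  fix m
  have "L2_set (\<lambda>n. K n (T u)) {..<m} \<le> L2_set (\<lambda>n. K n u) {..<m}"
    by (rule L2_set_mono) (auto intro: K_contraction assms)
  also have "\<dots> \<le> N u" by (rule L2_le_N) fact
  finally show "L2_set (\<lambda>n. K n (T u)) {..<m} \<le> N u" .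
qed (use assms(4) N_nonneg in auto)

lemma W_subset_carrier:
  assumes w: "w \<in> W"
  shows "w \<in> carrier"
proof -
  have "\<forall>n. norm ((K n w)\<^sup>2) \<le> (1 / 2) ^ n"
  proof
    fix n
    have le: "K n w \<le> (1 / 2) ^ n"
      using K_mem[OF w, of n] by (simp add: power_one_over)
    also have "\<dots> \<le> 1" by (rule power_le_one) auto
    finally have "K n w * K n w \<le> K n w" by (intro mult_left_le) auto
    with le show "norm ((K n w)\<^sup>2) \<le> (1 / 2) ^ n" by (simp add: power2_eq_square)
  qed
  then have "summable (\<lambda>n. (K n w)\<^sup>2)"
    by (rule summable_comparison_test_ev[OF always_eventually]) (simp add: summable_geometric)
  then show ?thesis by (simp add: carrier_def)
qed

lemma closed_ball: "0 \<le> c \<Longrightarrow> closed (ball c)"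
proof -
  assume c: "0 \<le> c"
  have "ball c = (\<Inter>m. {u. L2_set (\<lambda>n. K n u) {..<m} \<le> c})"
    using mem_ball_iff[OF c] by auto
  moreover have "closed {u. L2_set (\<lambda>n. K n u) {..<m} \<le> c}" for m
    unfolding L2_set_def by (intro closed_Collect_le continuous_intros)
  ultimately show ?thesis by (simp add: closed_INT)
qed

lemma convex_ball: "convex (ball c)"
proof (rule convexI)
  fix x y and u v :: real
  assume *: "x \<in> ball c" "y \<in> ball c" "0 \<le> u" "0 \<le> v" "u + v = 1"
  then have xy: "x \<in> carrier" "N x \<le> c" "y \<in> carrier" "N y \<le> c" by (auto simp: ball_def)
  have "N (u *\<^sub>R x + v *\<^sub>R y) \<le> u * N x + v * N y"
    using N_add[OF scale_mem[OF xy(1), of u] scale_mem[OF xy(3), of v]] *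
    by (simp add: N_scale xy)
  also have "\<dots> \<le> u * c + v * c" using * xy by (intro add_mono mult_left_mono) auto
  also have "\<dots> = c" using * by (simp flip: distrib_right)
  finally show "u *\<^sub>R x + v *\<^sub>R y \<in> ball c"
    using N_add scale_mem xy by (auto simp: ball_def)
qed

definition V :: "'a normed_structure" where
  "V = \<lparr> vcarrier = carrier, vzero = 0, vadd = (+), vscale = (*\<^sub>R), vnorm = N \<rparr>"

lemma V_simps [simp]:
  "vcarrier V = carrier" "vzero V = 0" "vadd V = (+)" "vscale V = (*\<^sub>R)" "vnorm V = N" "vdiff V x y = x - y"
  by (simp_all add: V_def vdiff_def)

lemma zero_mem: "0 \<in> carrier"
  using nonempty W_subset_carrier scale_mem[of _ 0] by auto

lemma N_zero: "N 0 = 0"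
  using N_scale[OF zero_mem, of 0] by simp

lemma diff_mem: "u \<in> carrier \<Longrightarrow> v \<in> carrier \<Longrightarrow> u - v \<in> carrier"
  using N_add[of u "(-1) *\<^sub>R v"] scale_mem[of v "-1"] by simp

lemma normed_V: "normed_space_on V"
  unfolding normed_space_on_def real_vector_space_on_def
proof (intro conjI ballI allI)
  fix x assume x: "x \<in> vcarrier V"
  show "vnorm V x = 0 \<longleftrightarrow> x = vzero V"
    using x norm_le_N[of x] N_zero by auto
qed (simp_all add: N_add scale_mem N_scale N_nonneg zero_mem scaleR_left_distrib scaleR_right_distrib ac_simps)

text \<open>A Cauchy sequence first converges in the ambient norm; closedness of the balls there
  carries the Cauchy estimate to the limit, as in Fatou's lemma.\<close>

lemma banach_V: "banach_space_on V"
  unfolding banach_space_on_def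
proof (intro conjI allI impI normed_V)
  fix \<sigma> :: "nat \<Rightarrow> 'a"
  assume "range \<sigma> \<subseteq> vcarrier V \<and> (\<forall>\<epsilon>>0. \<exists>M. \<forall>m\<ge>M. \<forall>n\<ge>M. vnorm V (vdiff V (\<sigma> m) (\<sigma> n)) < \<epsilon>)"
  then have \<sigma>: "\<And>n. \<sigma> n \<in> carrier" and C: "\<And>\<epsilon>. 0 < \<epsilon> \<Longrightarrow> \<exists>M. \<forall>m\<ge>M. \<forall>n\<ge>M. N (\<sigma> m - \<sigma> n) < \<epsilon>"
    by auto
  have "Cauchy \<sigma>"
  proof (rule metric_CauchyI)
    fix e :: real assume "0 < e"
    then obtain M where M: "\<forall>m\<ge>M. \<forall>n\<ge>M. N (\<sigma> m - \<sigma> n) < e" using C by blast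
    have "dist (\<sigma> m) (\<sigma> n) < e" if "m \<ge> M" "n \<ge> M" for m n
      using M that norm_le_N[OF diff_mem[OF \<sigma> \<sigma>], of m n] by (auto simp: dist_norm intro: le_less_trans)
    then show "\<exists>M. \<forall>m\<ge>M. \<forall>n\<ge>M. dist (\<sigma> m) (\<sigma> n) < e" by blast
  qed
  then obtain l where l: "\<sigma> \<longlonglongrightarrow> l"
    using complete_UNIV unfolding complete_def by blast
  have near: "\<exists>M. \<forall>n\<ge>M. \<sigma> n - l \<in> ball e" if e: "0 < e" for e
  proof -
    obtain M where M: "\<forall>m\<ge>M. \<forall>n\<ge>M. N (\<sigma> m - \<sigma> n) < e" using C[OF e] by blast
    have "\<sigma> n - l \<in> ball e" if n: "n \<ge> M" for n
    proof (rule Lim_in_closed_set[OF closed_ball])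
      show "(\<lambda>m. \<sigma> n - \<sigma> m) \<longlonglongrightarrow> \<sigma> n - l" by (intro tendsto_intros l)
      show "eventually (\<lambda>m. \<sigma> n - \<sigma> m \<in> ball e) sequentially"
        unfolding eventually_sequentially using M n diff_mem[OF \<sigma> \<sigma>]
        by (intro exI[of _ M]) (auto simp: ball_def less_imp_le)
    qed (use e in auto)
    then show ?thesis by blast
  qed
  obtain M where "\<sigma> M - l \<in> carrier" using near[of 1] by (auto simp: ball_def)
  then have lc: "l \<in> carrier" using diff_mem[OF \<sigma>[of M]] by force
  have "(\<lambda>n. N (\<sigma> n - l)) \<longlonglongrightarrow> 0"
  proof (rule LIMSEQ_I)
    fix r :: real assume r: "0 < r"
    then obtain M where "\<forall>n\<ge>M. \<sigma> n - l \<in> ball (r / 2)" using near[of "r / 2"] by auto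
    then show "\<exists>M. \<forall>n\<ge>M. norm (N (\<sigma> n - l) - 0) < r"
      using r N_nonneg by (intro exI[of _ M]) (force simp: ball_def)
  qed
  with lc show "\<exists>l\<in>vcarrier V. (\<lambda>n. vnorm V (vdiff V (\<sigma> n) l)) \<longlonglongrightarrow> 0"
    by auto
qed

end


section \<open>Duality and reflexivity of the interpolation space\<close>

context interpolation
begin

lemma dual_carrier_V_iff:
  "\<phi> \<in> dual_carrier V \<longleftrightarrow> \<phi> \<in> extensional carrier \<and>
     (\<forall>x\<in>carrier. \<forall>y\<in>carrier. \<phi> (x + y) = \<phi> x + \<phi> y) \<and>
     (\<forall>a. \<forall>x\<in>carrier. \<phi> (a *\<^sub>R x) = a * \<phi> x) \<and> (\<exists>C. \<forall>x\<in>carrier. \<bar>\<phi> x\<bar> \<le> C * N x)"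
  by (auto simp: dual_carrier_def)

lemma dual_V_diff:
  assumes "\<phi> \<in> dual_carrier V" "x \<in> carrier" "y \<in> carrier"
  shows "\<phi> (x - y) = \<phi> x - \<phi> y"
  using assms scale_mem[of y "-1"] dual_carrierD(2)[OF assms(1), of x "- y"]
    dual_carrierD(3)[OF assms(1), of y "-1"] by simp

text \<open>Where \<open>\<phi>\<close> nearly attains its norm at \<open>u\<close>, a vector \<open>w\<close> of the unit ball with small ambient
  norm is nearly orthogonal to \<open>u\<close> in the \<open>\<ell>\<^sup>2\<close>-sum, so \<open>N (u + t w) \<le> 1 + t\<^sup>2/2\<close> up to
  small terms, which forces \<open>\<phi> w\<close> to be small.\<close>

lemma dual_V_small_on_ball:
  assumes \<phi>: "\<phi> \<in> dual_carrier V" and \<epsilon>: "0 < \<epsilon>"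
  shows "\<exists>\<eta>>0. \<forall>w\<in>ball 1. norm w \<le> \<eta> \<longrightarrow> \<phi> w \<le> \<epsilon>"
proof -
  define m where "m = dual_norm V \<phi>"
  have m0: "0 \<le> m" unfolding m_def by (rule dual_norm_nonneg[OF normed_V \<phi>])
  have m_bound: "\<phi> x \<le> m * N x" if "x \<in> carrier" for x
    using dual_norm_bound[OF normed_V \<phi>, of x] that by (simp add: m_def)
  \<comment> \<open>The final bound is \<open>m D \<eta> + t (2 m + 1)\<close>: \<open>t\<close>
    brings the second summand below \<open>\<epsilon> / 2\<close>, and \<open>\<eta>\<close> will do
    so for the first.\<close>
  define t where "t = min 1 (\<epsilon> / (2 * (2 * m + 1)))"
  have t: "0 < t" "t \<le> 1" using \<epsilon> m0 by (auto simp: t_def)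
  have t\<epsilon>: "t * (2 * m + 1) \<le> \<epsilon> / 2"
  proof -
    have "t * (2 * m + 1) \<le> \<epsilon> / (2 * (2 * m + 1)) * (2 * m + 1)"
      using m0 by (intro mult_right_mono) (auto simp: t_def)
    also have "\<dots> = \<epsilon> / 2" using m0 by (simp add: field_simps)
    finally show ?thesis .
  qed
  \<comment> \<open>Quadratic in \<open>t\<close>, because this defect is divided by
    \<open>t\<close> at the end and must still be small.\<close>
  define \<delta> where "\<delta> = t * t"
  have \<delta>: "0 < \<delta>" "\<delta> \<le> t" using t by (auto simp: \<delta>_def mult_left_le)
  obtain u where u: "u \<in> carrier" "N u \<le> 1" "m - \<delta> < \<phi> u"
  proof -
    have "m - \<delta> < m" using \<delta> by simp
    then obtain x where x: "x \<in> carrier" "N x \<le> 1" "m - \<delta> < \<bar>\<phi> x\<bar>"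
      using less_cSUP_iff[OF dual_unit_ball_nonempty[OF normed_V] dual_bdd_above[OF normed_V \<phi>], of "m - \<delta>"]
      unfolding m_def by auto
    show ?thesis
    proof (cases "0 \<le> \<phi> x")
      case True
      then show ?thesis using x that[of x] by simp
    next
      case False
      then show ?thesis
        using x that[of "(-1) *\<^sub>R x"] scale_mem[OF x(1), of "-1"] N_scale[OF x(1), of "-1"]
          dual_carrierD(3)[OF \<phi>, of x "-1"] by simp
    qed
  qed
  \<comment> \<open>Beyond \<open>n0\<close> the tail of \<open>u\<close> is negligible and
    Cauchy-Schwarz handles the mixed terms. Before \<open>n0\<close>,
    \<open>K n w \<le> 2 ^ n * norm w\<close> makes them small with the ambient norm of
    \<open>w\<close>; summing these factors gives \<open>D\<close>.\<close>
  obtain n0 where n0: "\<And>M. (\<Sum>n\<in>{n0..<M}. (K n u)\<^sup>2) \<le> \<delta>\<^sup>2"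
  proof -
    have "summable (\<lambda>n. (K n u)\<^sup>2)" using u(1) by (simp add: carrier_def)
    then obtain n0 where "\<forall>m\<ge>n0. \<forall>n. norm (sum (\<lambda>n. (K n u)\<^sup>2) {m..<n}) < \<delta>\<^sup>2"
      unfolding summable_Cauchy using \<delta>(1) by (meson zero_less_power)
    then have "(\<Sum>n\<in>{n0..<M}. (K n u)\<^sup>2) \<le> \<delta>\<^sup>2" for M
      by (auto simp: sum_nonneg intro: less_imp_le)
    then show ?thesis using that by blast
  qed
  define D :: real where "D = (\<Sum>n<n0. 2 ^ n)"
  have D: "0 \<le> D" by (simp add: D_def sum_nonneg)
  define \<eta> where "\<eta> = \<epsilon> / (2 * (m * D + 1))"
  have mD: "0 < m * D + 1" using m0 D by (simp add: add_nonneg_pos)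
  have \<eta>: "0 < \<eta>" using \<epsilon> mD by (simp add: \<eta>_def)
  have \<eta>\<epsilon>: "m * D * \<eta> \<le> \<epsilon> / 2"
  proof -
    have "m * D * \<eta> \<le> (m * D + 1) * \<eta>" using \<eta> by (intro mult_right_mono) auto
    moreover have "a * (\<epsilon> / (2 * a)) = \<epsilon> / 2" if "0 < a" for a :: real using that by simp
    from this[OF mD] have "(m * D + 1) * \<eta> = \<epsilon> / 2" by (simp only: \<eta>_def)
    ultimately show ?thesis by linarith
  qed
  have "\<phi> w \<le> \<epsilon>" if w: "w \<in> ball 1" "norm w \<le> \<eta>" for w
  proof -
    have wc: "w \<in> carrier" "N w \<le> 1" using w by (auto simp: ball_def)
    have Kw: "L2_set (\<lambda>n. K n w) {..<M} \<le> 1" and Ku: "L2_set (\<lambda>n. K n u) {..<M} \<le> 1" for M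
      using L2_le_N[OF wc(1), of M] L2_le_N[OF u(1), of M] wc(2) u(2) by auto
    have sq: "(\<Sum>n<M. (K n w)\<^sup>2) \<le> 1" "(\<Sum>n<M. (K n u)\<^sup>2) \<le> 1" for M
      using Kw[of M] Ku[of M] unfolding L2_set_def by auto
    \<comment> \<open>From \<open>sqrt (1 + 2 a) \<le> 1 + a\<close>, where \<open>2 a\<close>
      collects the mixed and the quadratic terms.\<close>
    define B where "B = 1 + t * (D * \<eta> + \<delta>) + t\<^sup>2 / 2"
    have B: "1 \<le> B" using t D \<eta> \<delta> by (simp add: B_def)
    have mixed: "(\<Sum>n<M. K n u * K n w) \<le> D * \<eta> + \<delta>" for M
    proof -
      have "(\<Sum>n<M. K n u * K n w) \<le> (\<Sum>n\<in>{..<n0} \<union> {n0..<M}. K n u * K n w)"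
        by (intro sum_mono2) auto
      also have "\<dots> = (\<Sum>n<n0. K n u * K n w) + (\<Sum>n\<in>{n0..<M}. K n u * K n w)"
        by (intro sum.union_disjoint) auto
      also have "(\<Sum>n<n0. K n u * K n w) \<le> (\<Sum>n<n0. 1 * (2 ^ n * \<eta>))"
      proof (intro sum_mono mult_mono)
        fix n
        show "K n u \<le> 1" using K_le_N[OF u(1), of n] u(2) by simp
        have "K n w \<le> 2 ^ n * norm w" by (rule K_le_norm)
        also have "\<dots> \<le> 2 ^ n * \<eta>" using w(2) by (intro mult_left_mono) auto
        finally show "K n w \<le> 2 ^ n * \<eta>" .
      qed auto
      also have "(\<Sum>n<n0. 1 * (2 ^ n * \<eta>)) = D * \<eta>"
        by (simp add: D_def sum_distrib_right)
      also have "(\<Sum>n\<in>{n0..<M}. K n u * K n w) \<le> \<delta>"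
      proof -
        have "(\<Sum>n\<in>{n0..<M}. K n u * K n w) = (\<Sum>n\<in>{n0..<M}. \<bar>K n u\<bar> * \<bar>K n w\<bar>)"
          by simp
        also have "\<dots> \<le> L2_set (\<lambda>n. K n u) {n0..<M} * L2_set (\<lambda>n. K n w) {n0..<M}"
          by (rule L2_set_mult_ineq)
        also have "\<dots> \<le> \<delta> * 1"
        proof (intro mult_mono)
          show "L2_set (\<lambda>n. K n u) {n0..<M} \<le> \<delta>"
            unfolding L2_set_def using n0[of M] \<delta>(1) by (intro real_le_lsqrt) (auto simp: sum_nonneg)
          have "(\<Sum>n\<in>{n0..<M}. (K n w)\<^sup>2) \<le> (\<Sum>n<M. (K n w)\<^sup>2)"
            by (intro sum_mono2) auto
          then show "L2_set (\<lambda>n. K n w) {n0..<M} \<le> 1"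
            unfolding L2_set_def using sq(1)[of M] by (intro real_le_lsqrt) (auto simp: sum_nonneg)
        qed (use \<delta> in auto)
        finally show ?thesis by simp
      qed
      finally show ?thesis by simp
    qed
    have "u + t *\<^sub>R w \<in> carrier \<and> N (u + t *\<^sub>R w) \<le> B"
    proof (rule N_leI)
      fix M
      have "L2_set (\<lambda>n. K n (u + t *\<^sub>R w)) {..<M} \<le> L2_set (\<lambda>n. K n u + t * K n w) {..<M}"
        using K_add[of _ u "t *\<^sub>R w"] t by (intro L2_set_mono) (auto simp: K_scale)
      also have "\<dots> \<le> B"
        unfolding L2_set_def
      proof (rule real_le_lsqrt)
        have "(\<Sum>n<M. (K n u + t * K n w)\<^sup>2) =
            (\<Sum>n<M. (K n u)\<^sup>2) + 2 * t * (\<Sum>n<M. K n u * K n w) + t\<^sup>2 * (\<Sum>n<M. (K n w)\<^sup>2)"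
          by (simp add: power2_sum power_mult_distrib sum.distrib sum_distrib_left algebra_simps)
        also have "\<dots> \<le> 1 + 2 * t * (D * \<eta> + \<delta>) + t\<^sup>2 * 1"
          using t by (intro add_mono mult_left_mono sq mixed) auto
        also have "\<dots> \<le> B\<^sup>2"
        proof -
          define a where "a = t * (D * \<eta> + \<delta>) + t\<^sup>2 / 2"
          have "B\<^sup>2 = 1 + 2 * a + a\<^sup>2" by (simp add: B_def a_def power2_eq_square algebra_simps)
          moreover have "0 \<le> a\<^sup>2" by simp
          ultimately show ?thesis by (simp add: a_def algebra_simps)
        qed
        finally show "(\<Sum>n<M. (K n u + t * K n w)\<^sup>2) \<le> B\<^sup>2" .
      qed (use B in \<open>auto simp: sum_nonneg\<close>)
      finally show "L2_set (\<lambda>n. K n (u + t *\<^sub>R w)) {..<M} \<le> B" .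
    qed (use B in simp)
    then have "\<phi> (u + t *\<^sub>R w) \<le> m * B"
      using m_bound[of "u + t *\<^sub>R w"] mult_left_mono[of "N (u + t *\<^sub>R w)" B m] m0 by linarith
    moreover have "\<phi> (u + t *\<^sub>R w) = \<phi> u + t * \<phi> w"
      using dual_carrierD(2)[OF \<phi>, of u "t *\<^sub>R w"] dual_carrierD(3)[OF \<phi>, of w t] u(1) wc(1) scale_mem by simp
    ultimately have "t * \<phi> w \<le> \<delta> + m * (t * (D * \<eta> + \<delta>) + t\<^sup>2 / 2)"
      using u(3) by (simp add: B_def algebra_simps)
    also have "\<dots> = t * (t + m * D * \<eta> + m * \<delta> + m * t / 2)"
      by (simp add: \<delta>_def power2_eq_square algebra_simps)
    finally have "\<phi> w \<le> t + m * D * \<eta> + m * \<delta> + m * t / 2"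
      using t by simp
    also have "\<dots> \<le> m * D * \<eta> + t * (2 * m + 1)"
    proof -
      have "m * \<delta> \<le> m * t" "0 \<le> m * t" using \<delta> m0 t by (auto intro: mult_left_mono)
      then show ?thesis by (simp add: algebra_simps)
    qed
    also have "\<dots> \<le> \<epsilon>" using \<eta>\<epsilon> t\<epsilon> by simp
    finally show ?thesis .
  qed
  with \<eta> show ?thesis by blast
qed

lemma ball_scale: "0 < c \<Longrightarrow> v \<in> ball b \<Longrightarrow> (1 / c) *\<^sub>R v \<in> ball (b / c)"
  by (auto simp: ball_def scale_mem N_scale divide_right_mono)

lemma dual_V_norm_continuous:
  assumes \<phi>: "\<phi> \<in> dual_carrier V" and v: "\<And>k. v k \<in> ball c" and u: "u \<in> ball c" and lim: "v \<longlonglongrightarrow> u"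
  shows "(\<lambda>k. \<phi> (v k)) \<longlonglongrightarrow> \<phi> u"
proof (rule LIMSEQ_I)
  fix e :: real assume e: "0 < e"
  have c: "0 \<le> c" using u N_nonneg by (force simp: ball_def)
  \<comment> \<open>A radius for differences of two points of \<open>ball c\<close>; the added 1
    keeps it positive when \<open>c = 0\<close>.\<close>
  define b where "b = 2 * c + 1"
  have b: "0 < b" using c by (simp add: b_def)
  obtain \<eta> where \<eta>: "0 < \<eta>" "\<And>w. w \<in> ball 1 \<Longrightarrow> norm w \<le> \<eta> \<Longrightarrow> \<phi> w \<le> e / (2 * b)"
    using dual_V_small_on_ball[OF \<phi>, of "e / (2 * b)"] e b by auto
  have *: "\<phi> x - \<phi> y \<le> e / 2" if "x \<in> ball c" "y \<in> ball c" "norm (x - y) \<le> \<eta> * b" for x y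
  proof -
    have xy: "x \<in> carrier" "y \<in> carrier" "N x \<le> c" "N y \<le> c" using that by (auto simp: ball_def)
    have "N (x - y) \<le> N x + N y"
      using N_add[OF xy(1) scale_mem[OF xy(2)], of "-1"] N_scale[OF xy(2), of "-1"] by simp
    then have "x - y \<in> ball b"
      using xy by (auto simp: ball_def diff_mem b_def)
    then have "(1 / b) *\<^sub>R (x - y) \<in> ball 1"
      using ball_scale[OF b, of "x - y" b] b by simp
    moreover have "norm ((1 / b) *\<^sub>R (x - y)) \<le> \<eta>"
      using that(3) b by (simp add: pos_divide_le_eq)
    ultimately have "\<phi> ((1 / b) *\<^sub>R (x - y)) \<le> e / (2 * b)"
      by (rule \<eta>(2))
    then have "(1 / b) * (\<phi> x - \<phi> y) \<le> e / (2 * b)"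
      using dual_carrierD(3)[OF \<phi>, of "x - y" "1 / b"] diff_mem xy dual_V_diff[OF \<phi> xy(1,2)] by simp
    also have "e / (2 * b) = (1 / b) * (e / 2)" by simp
    finally show ?thesis using b by (subst (asm) mult_le_cancel_left_pos) auto
  qed
  have "0 < \<eta> * b" using \<eta>(1) b by simp
  then obtain M where M: "\<forall>k\<ge>M. norm (v k - u) < \<eta> * b"
    using LIMSEQ_D[OF lim] by blast
  have "norm (\<phi> (v k) - \<phi> u) < e" if "k \<ge> M" for k
    using *[OF v u, of k] *[OF u v, of k] M that e by (auto simp: norm_minus_commute abs_less_iff less_imp_le intro: le_less_trans)
  then show "\<exists>M. \<forall>k\<ge>M. norm (\<phi> (v k) - \<phi> u) < e" by blast
qed

lemma weak_limit_ball:
  assumes "0 \<le> c" "G \<noteq> bot" "eventually (\<lambda>v. v \<in> ball c) G" "weak_limit u G"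
  shows "u \<in> ball c"
  using Mazur_weak_limit[OF convex_ball assms(2-4)] closed_ball[OF assms(1)] by simp

text \<open>\<open>\<phi>\<close> need not extend continuously to the ambient space, so the weak
  limit says nothing about it directly. The part of the ball where \<open>\<phi> \<le> a\<close> is
  convex; Mazur makes \<open>u\<close> an ambient norm limit of a sequence in it, along which
  \<open>\<phi>\<close> is continuous.\<close>

lemma weak_limit_dual_V:
  assumes c: "0 \<le> c" and G: "ultrafilter G" "eventually (\<lambda>v. v \<in> ball c) G" "weak_limit u G"
    and \<phi>: "\<phi> \<in> dual_carrier V"
  shows "(\<phi> \<longlongrightarrow> \<phi> u) G"
proof -
  have u: "u \<in> ball c"
    by (rule weak_limit_ball[OF c ultrafilter_not_bot[OF G(1)] G(2,3)])
  have le: "\<phi> u \<le> a" if ev: "eventually (\<lambda>v. \<phi> v \<le> a) G" and \<phi>: "\<phi> \<in> dual_carrier V" for a \<phi>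
  proof -
    let ?C = "{v \<in> ball c. \<phi> v \<le> a}"
    have "convex ?C"
    proof (rule convexI)
      fix x y and s t :: real
      assume *: "x \<in> ?C" "y \<in> ?C" "0 \<le> s" "0 \<le> t" "s + t = 1"
      then have "x \<in> carrier" "y \<in> carrier" by (auto simp: ball_def)
      then have "\<phi> (s *\<^sub>R x + t *\<^sub>R y) = s * \<phi> x + t * \<phi> y"
        using dual_carrierD(2,3)[OF \<phi>] scale_mem by simp
      also have "\<dots> \<le> s * a + t * a" using * by (intro add_mono mult_left_mono) auto
      also have "\<dots> = a" using * by (simp flip: distrib_right)
      finally show "s *\<^sub>R x + t *\<^sub>R y \<in> ?C"
        using * convexD[OF convex_ball, of x c y s t] by simp
    qed
    moreover have "eventually (\<lambda>v. v \<in> ?C) G"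
      using G(2) ev by eventually_elim simp
    ultimately have "u \<in> closure ?C"
      using Mazur_weak_limit[OF _ ultrafilter_not_bot[OF G(1)] _ G(3)] by blast
    then obtain v where v: "\<And>k. v k \<in> ?C" "v \<longlonglongrightarrow> u"
      by (auto simp: closure_sequential)
    then have "(\<lambda>k. \<phi> (v k)) \<longlonglongrightarrow> \<phi> u"
      by (intro dual_V_norm_continuous[OF \<phi> _ u]) auto
    then show ?thesis
      by (rule LIMSEQ_le_const2) (use v(1) in auto)
  qed
  \<comment> \<open>The opposite inequality comes from \<open>le\<close> applied to
    \<open>- \<phi>\<close>, which must be made extensional to belong to
    \<open>dual_carrier V\<close>.\<close>
  have neg: "(\<lambda>x\<in>carrier. - \<phi> x) \<in> dual_carrier V"
    using dual_carrier_scale[OF normed_V \<phi>, of "-1"] by (simp add: restrict_def if_distrib cong: if_cong)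
  show ?thesis
  proof (rule order_tendstoI)
    fix a assume a: "a < \<phi> u"
    have "\<not> eventually (\<lambda>v. \<phi> v \<le> a) G"
      using le[OF _ \<phi>, of a] a by auto
    from ultrafilter_not_eventually[OF G(1) this] show "eventually (\<lambda>v. a < \<phi> v) G"
      by (simp add: not_le)
  next
    fix a assume a: "\<phi> u < a"
    have "\<not> eventually (\<lambda>v. a \<le> \<phi> v) G"
    proof
      assume ev: "eventually (\<lambda>v. a \<le> \<phi> v) G"
      have "eventually (\<lambda>v. (\<lambda>x\<in>carrier. - \<phi> x) v \<le> - a) G"
        using ev G(2) by eventually_elim (simp add: ball_def)
      then have "(\<lambda>x\<in>carrier. - \<phi> x) u \<le> - a" by (rule le[OF _ neg])
      then show False using a u by (simp add: ball_def)
    qed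
    from ultrafilter_not_eventually[OF G(1) this] show "eventually (\<lambda>v. \<phi> v < a) G"
      by (simp add: not_le)
  qed
qed

text \<open>At level \<open>n\<close>, \<open>K n v < c + 1\<close> splits \<open>v\<close> into a
  multiple of a member of \<open>W\<close>, with factor at most \<open>2 ^ n * (c + 1)\<close>, and
  a remainder of norm at most \<open>(c + 1) / 2 ^ n\<close>. The added 1 yields the strict
  inequality that selects a splitting.\<close>

lemma relatively_weakly_compact_ball:
  assumes W: "relatively_weakly_compact W" and c: "0 \<le> c"
  shows "relatively_weakly_compact (ball c)"
proof (rule relatively_weakly_compact_approx[OF complete_UNIV])
  show "norm v \<le> c" if "v \<in> ball c" for v
    using that norm_le_N[of v] by (auto simp: ball_def)
  fix \<epsilon> :: real assume \<epsilon>: "0 < \<epsilon>"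
  obtain n where n: "(c + 1) / \<epsilon> < 2 ^ n"
    using real_arch_pow[of 2 "(c + 1) / \<epsilon>"] by auto
  let ?W = "(\<lambda>(r, w). r *\<^sub>R w) ` ({0..2 ^ n * (c + 1)} \<times> W)"
  have "\<exists>w\<in>?W. norm (v - w) \<le> \<epsilon>" if "v \<in> ball c" for v
  proof -
    have "K n v < c + 1" using that K_le_N[of v n] by (auto simp: ball_def)
    then obtain r w where rw: "0 \<le> r" "w \<in> W" "r / 2 ^ n + 2 ^ n * norm (v - r *\<^sub>R w) < c + 1"
      by (rule K_less)
    have "0 \<le> r / 2 ^ n" "0 \<le> 2 ^ n * norm (v - r *\<^sub>R w)" using rw by auto
    with rw(3) have 1: "r / 2 ^ n \<le> c + 1" and 2: "2 ^ n * norm (v - r *\<^sub>R w) \<le> c + 1" by linarith+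
    have "r \<le> 2 ^ n * (c + 1)" using 1 by (simp add: field_simps)
    then have "r *\<^sub>R w \<in> ?W" using rw by auto
    moreover have "norm (v - r *\<^sub>R w) \<le> \<epsilon>"
    proof -
      have "c + 1 \<le> 2 ^ n * \<epsilon>" using n \<epsilon> by (simp add: pos_divide_less_eq)
      with 2 have "2 ^ n * norm (v - r *\<^sub>R w) \<le> 2 ^ n * \<epsilon>" by linarith
      then show ?thesis by simp
    qed
    ultimately show ?thesis by blast
  qed
  then show "\<exists>W. relatively_weakly_compact W \<and> (\<forall>v\<in>ball c. \<exists>w\<in>W. norm (v - w) \<le> \<epsilon>)"
    using relatively_weakly_compact_scaled[OF W compact_Icc] by blast
qed

lemma dual_V_sum:
  assumes "finite F" "F \<subseteq> dual_carrier V"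
  shows "(\<lambda>x\<in>carrier. \<Sum>\<phi>\<in>F. \<tau> \<phi> * \<phi> x) \<in> dual_carrier V \<and>
    (\<Xi> \<in> dual_carrier (dual_space V) \<longrightarrow>
      \<Xi> (\<lambda>x\<in>carrier. \<Sum>\<phi>\<in>F. \<tau> \<phi> * \<phi> x) = (\<Sum>\<phi>\<in>F. \<tau> \<phi> * \<Xi> \<phi>))"
  using assms
proof (induction F rule: finite_induct)
  case empty
  have z: "(\<lambda>x\<in>carrier. 0) \<in> dual_carrier V"
    by (auto simp: dual_carrier_V_iff scale_mem N_add intro!: exI[of _ 0])
  moreover have "\<Xi> (\<lambda>x\<in>carrier. 0) = 0" if "\<Xi> \<in> dual_carrier (dual_space V)"
    using dual_carrierD(3)[OF that, of "\<lambda>x\<in>carrier. 0" 0] z by (simp add: restrict_def cong: if_cong)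
  ultimately show ?case by (simp only: sum.empty) blast
next
  case (insert \<psi> F)
  let ?s = "\<lambda>x\<in>carrier. \<Sum>\<phi>\<in>F. \<tau> \<phi> * \<phi> x" and ?p = "\<lambda>x\<in>carrier. \<tau> \<psi> * \<psi> x"
  have IH: "\<Xi> \<in> dual_carrier (dual_space V) \<Longrightarrow> \<Xi> ?s = (\<Sum>\<phi>\<in>F. \<tau> \<phi> * \<Xi> \<phi>)"
    using insert.IH insert.prems by blast
  have s: "?s \<in> dual_carrier V" and \<psi>: "\<psi> \<in> dual_carrier V"
    using insert.IH insert.prems by blast+
  have p: "?p \<in> dual_carrier V" using dual_carrier_scale[OF normed_V \<psi>] by simp
  have eq: "(\<lambda>x\<in>carrier. \<Sum>\<phi>\<in>insert \<psi> F. \<tau> \<phi> * \<phi> x) = (\<lambda>x\<in>carrier. ?p x + ?s x)"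
    using insert.hyps by (auto simp: restrict_def)
  have "\<Xi> (\<lambda>x\<in>carrier. ?p x + ?s x) = (\<Sum>\<phi>\<in>insert \<psi> F. \<tau> \<phi> * \<Xi> \<phi>)" if \<Xi>: "\<Xi> \<in> dual_carrier (dual_space V)"
    using dual_carrierD(2)[OF \<Xi>, of ?p ?s] dual_carrierD(3)[OF \<Xi>, of \<psi> "\<tau> \<psi>"] IH[OF \<Xi>] insert.hyps s p \<psi>
    by simp
  moreover have "(\<lambda>x\<in>carrier. ?p x + ?s x) \<in> dual_carrier V"
    using dual_carrier_add[OF normed_V p s] by simp
  ultimately show ?case unfolding eq by blast
qed

text \<open>Finitely many functionals reduce the question to a convex set in finite dimension. No
  combination of them separates, because values on \<open>ball C\<close> come arbitrarily close to
  \<open>C\<close> times the dual norm of the combination.\<close>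

lemma Goldstine_V:
  assumes \<Xi>: "\<Xi> \<in> dual_carrier (dual_space V)"
    and C: "0 \<le> C" "\<And>\<phi>. \<phi> \<in> dual_carrier V \<Longrightarrow> \<bar>\<Xi> \<phi>\<bar> \<le> C * dual_norm V \<phi>"
    and F: "finite F" "F \<subseteq> dual_carrier V" and \<eta>: "0 < \<eta>"
  shows "\<exists>v\<in>ball C. \<forall>\<phi>\<in>F. \<bar>\<phi> v - \<Xi> \<phi>\<bar> < \<eta>"
proof -
  let ?D' = "(\<lambda>v. \<lambda>\<phi>\<in>F. \<phi> v) ` ball C :: (('a \<Rightarrow> real) \<Rightarrow> real) set"
  have ne: "0 \<in> ball C" using C(1) zero_mem N_zero by (simp add: ball_def)
  obtain y where y: "y \<in> ?D'" "\<And>\<phi>. \<phi> \<in> F \<Longrightarrow> \<bar>y \<phi> - \<Xi> \<phi>\<bar> < \<eta>"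
  proof (rule convex_approximation_finite[OF F(1), of ?D' "\<lambda>\<phi>. dual_norm V \<phi> * C" \<Xi> \<eta>])
    show "?D' \<noteq> {}" using ne by blast
  next
    fix y z and t :: real assume yz: "y \<in> ?D'" "z \<in> ?D'" and t: "0 \<le> t" "t \<le> 1"
    from yz obtain a b where ab: "a \<in> ball C" "b \<in> ball C" "y = (\<lambda>\<phi>\<in>F. \<phi> a)" "z = (\<lambda>\<phi>\<in>F. \<phi> b)" by auto
    have c: "(1 - t) *\<^sub>R a + t *\<^sub>R b \<in> ball C"
      using convexD[OF convex_ball ab(1,2), of "1 - t" t] t by simp
    have "(\<lambda>i. y i + t * (z i - y i)) = (\<lambda>\<phi>\<in>F. \<phi> ((1 - t) *\<^sub>R a + t *\<^sub>R b))"
    proof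
      fix \<phi>
      show "y \<phi> + t * (z \<phi> - y \<phi>) = (\<lambda>\<phi>\<in>F. \<phi> ((1 - t) *\<^sub>R a + t *\<^sub>R b)) \<phi>"
      proof (cases "\<phi> \<in> F")
        case True
        then have \<phi>: "\<phi> \<in> dual_carrier V" using F by auto
        have "\<phi> ((1 - t) *\<^sub>R a + t *\<^sub>R b) = (1 - t) * \<phi> a + t * \<phi> b"
          using dual_carrierD(2,3)[OF \<phi>] scale_mem ab(1,2) by (simp add: ball_def)
        then show ?thesis using True ab by (simp add: algebra_simps)
      next
        \<comment> \<open>Outside \<open>F\<close> all restricted functions have the value
          \<open>undefined\<close>, which the affine combination leaves fixed.\<close>
        case False
        then show ?thesis using ab by simp
      qed
    qed
    with c show "(\<lambda>i. y i + t * (z i - y i)) \<in> ?D'" by blast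
  next
    fix y \<phi> assume "y \<in> ?D'" "\<phi> \<in> F"
    then obtain a where a: "a \<in> carrier" "N a \<le> C" "y \<phi> = \<phi> a" and \<phi>: "\<phi> \<in> dual_carrier V"
      using F by (auto simp: ball_def)
    have "\<bar>\<phi> a\<bar> \<le> dual_norm V \<phi> * N a"
      using dual_norm_bound[OF normed_V \<phi>, of a] a by simp
    also have "\<dots> \<le> dual_norm V \<phi> * C"
      using a dual_norm_nonneg[OF normed_V \<phi>] by (intro mult_left_mono) auto
    finally show "\<bar>y \<phi>\<bar> \<le> dual_norm V \<phi> * C" using a by simp
  next
    fix \<tau> and \<epsilon> :: real assume \<epsilon>: "0 < \<epsilon>"
    define \<psi> where "\<psi> = (\<lambda>x\<in>carrier. \<Sum>\<phi>\<in>F. \<tau> \<phi> * \<phi> x)"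
    have \<psi>: "\<psi> \<in> dual_carrier V" "\<Xi> \<psi> = (\<Sum>\<phi>\<in>F. \<tau> \<phi> * \<Xi> \<phi>)"
      using dual_V_sum[OF F] \<Xi> by (auto simp: \<psi>_def)
    have "\<Xi> \<psi> \<le> C * dual_norm V \<psi>" using C(2)[OF \<psi>(1)] by simp
    \<comment> \<open>The denominator \<open>C + 1\<close> keeps the loss
      \<open>C * (\<epsilon> / (C + 1))\<close> at most \<open>\<epsilon>\<close> and stays positive
      when \<open>C = 0\<close>.\<close>
    have "dual_norm V \<psi> - \<epsilon> / (C + 1) < dual_norm V \<psi>" using \<epsilon> C by simp
    then have "\<exists>x\<in>{x\<in>vcarrier V. vnorm V x \<le> 1}. dual_norm V \<psi> - \<epsilon> / (C + 1) < \<bar>\<psi> x\<bar>"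
      by (rule iffD1[OF less_cSUP_iff[OF dual_unit_ball_nonempty[OF normed_V] dual_bdd_above[OF normed_V \<psi>(1)]]])
    then obtain x where x: "x \<in> carrier" "N x \<le> 1" "dual_norm V \<psi> - \<epsilon> / (C + 1) < \<bar>\<psi> x\<bar>"
      by auto
    define s where "s = (if 0 \<le> \<psi> x then C else - C)"
    have sx: "s *\<^sub>R x \<in> ball C"
      using x C(1) mult_left_le[of "N x" C] by (auto simp: ball_def scale_mem N_scale s_def)
    have "\<psi> (s *\<^sub>R x) = C * \<bar>\<psi> x\<bar>"
      using dual_carrierD(3)[OF \<psi>(1), of x s] x(1) by (auto simp: s_def)
    also have "\<dots> \<ge> C * (dual_norm V \<psi> - \<epsilon> / (C + 1))"
      using x(3) C(1) by (intro mult_left_mono) auto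
    also have "C * (dual_norm V \<psi> - \<epsilon> / (C + 1)) \<ge> C * dual_norm V \<psi> - \<epsilon>"
    proof -
      have "C * (\<epsilon> / (C + 1)) \<le> \<epsilon>" using C \<epsilon> by (simp add: field_simps)
      then show ?thesis by (simp add: algebra_simps)
    qed
    finally have "\<Xi> \<psi> - \<epsilon> \<le> \<psi> (s *\<^sub>R x)" using C(2)[OF \<psi>(1)] by linarith
    moreover have "\<psi> (s *\<^sub>R x) = (\<Sum>\<phi>\<in>F. \<tau> \<phi> * \<phi> (s *\<^sub>R x))"
      using sx by (simp add: \<psi>_def ball_def)
    ultimately show "\<exists>y\<in>?D'. (\<Sum>i\<in>F. \<tau> i * \<Xi> i) - \<epsilon> \<le> (\<Sum>i\<in>F. \<tau> i * y i)"
      using sx \<psi>(2) by (intro bexI[of _ "\<lambda>\<phi>\<in>F. \<phi> (s *\<^sub>R x)"]) (auto cong: sum.cong)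
  qed (use \<eta> in auto)
  from y(1) obtain v where v: "v \<in> ball C" "y = (\<lambda>\<phi>\<in>F. \<phi> v)" by blast
  have "\<forall>\<phi>\<in>F. \<bar>\<phi> v - \<Xi> \<phi>\<bar> < \<eta>"
    using y(2) by (simp add: v(2))
  with v(1) show ?thesis by blast
qed

text \<open>Goldstine gives an ultrafilter on a ball along which every functional
  \<open>\<phi>\<close> tends to \<open>\<Xi> \<phi>\<close>. Compactness gives it a weak limit in
  the ambient space, and \<open>weak_limit_dual_V\<close> shows that this limit represents
  \<open>\<Xi>\<close>.\<close>

theorem reflexive_V:
  assumes W: "relatively_weakly_compact W"
  shows "reflexive_banach_space_on V"
  unfolding reflexive_banach_space_on_def dual_space_simps
proof (intro conjI banach_V equalityI subsetI)
  fix \<Xi> assume "\<Xi> \<in> (\<lambda>v. \<lambda>\<phi>\<in>dual_carrier V. \<phi> v) ` vcarrier V"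
  then show "\<Xi> \<in> dual_carrier (dual_space V)"
    using bidual_embedding[OF normed_V] by auto
next
  fix \<Xi> assume \<Xi>: "\<Xi> \<in> dual_carrier (dual_space V)"
  obtain C0 where C0: "\<forall>\<phi>\<in>dual_carrier V. \<bar>\<Xi> \<phi>\<bar> \<le> C0 * dual_norm V \<phi>"
    using dual_carrierD(4)[OF \<Xi>] by auto
  define C where "C = \<bar>C0\<bar>"
  have C: "0 \<le> C" "\<bar>\<Xi> \<phi>\<bar> \<le> C * dual_norm V \<phi>" if "\<phi> \<in> dual_carrier V" for \<phi>
    using C0 that mult_right_mono[of C0 "\<bar>C0\<bar>" "dual_norm V \<phi>"] dual_norm_nonneg[OF normed_V that]
    by (force simp: C_def)+
  define R where "R j v \<longleftrightarrow> v \<in> ball C \<and>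
      (fst j \<in> dual_carrier V \<longrightarrow> 0 < snd j \<longrightarrow> \<bar>fst j v - \<Xi> (fst j)\<bar> < snd j)"
    for j :: "('a \<Rightarrow> real) \<times> real" and v
  have "\<exists>v. \<forall>j\<in>J. R j v" if J: "finite J" for J
  proof -
    let ?F = "fst ` J \<inter> dual_carrier V"
    \<comment> \<open>The inserted 1 keeps the minimum defined when \<open>J\<close> has no positive
      tolerance.\<close>
    define \<eta> where "\<eta> = Min (insert 1 (snd ` {j\<in>J. 0 < snd j}))"
    have "0 < \<eta>" unfolding \<eta>_def using J by (subst Min_gr_iff) auto
    moreover have \<eta>: "\<eta> \<le> snd j" if "j \<in> J" "0 < snd j" for j
      unfolding \<eta>_def using J that by (intro Min_le) auto
    ultimately obtain v where v: "v \<in> ball C" "\<forall>\<phi>\<in>?F. \<bar>\<phi> v - \<Xi> \<phi>\<bar> < \<eta>"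
      using Goldstine_V[OF \<Xi>, of C ?F \<eta>] C J unfolding C_def by auto
    have "R j v" if "j \<in> J" for j
      using v \<eta>[OF that] that unfolding R_def by force
    then show ?thesis by blast
  qed
  then obtain G where G: "ultrafilter G" "\<And>j. eventually (R j) G"
    using ultrafilter_finite_intersection[of R] by blast
  have ev: "eventually (\<lambda>v. v \<in> ball C) G"
    using G(2)[of undefined] by eventually_elim (simp add: R_def)
  have C0': "0 \<le> C" by (simp add: C_def)
  obtain u where u: "weak_limit u G"
    using relatively_weakly_compact_ball[OF W C0'] G(1) ev unfolding relatively_weakly_compact_def by blast
  have "u \<in> ball C"
    by (rule weak_limit_ball[OF C0' ultrafilter_not_bot[OF G(1)] ev u])
  have "\<Xi> \<phi> = \<phi> u" if \<phi>: "\<phi> \<in> dual_carrier V" for \<phi>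
  proof (rule tendsto_unique[OF ultrafilter_not_bot[OF G(1)] _ weak_limit_dual_V[OF C0' G(1) ev u \<phi>]])
    show "(\<phi> \<longlongrightarrow> \<Xi> \<phi>) G"
    proof (rule tendstoI)
      fix e :: real assume e: "0 < e"
      show "eventually (\<lambda>v. dist (\<phi> v) (\<Xi> \<phi>) < e) G"
        using G(2)[of "(\<phi>, e)"] by eventually_elim (use \<phi> e in \<open>auto simp: R_def dist_real_def\<close>)
    qed
  qed
  then have "\<Xi> = (\<lambda>\<phi>\<in>dual_carrier V. \<phi> u)"
    using dual_carrierD(1)[OF \<Xi>] by (auto simp: extensional_def restrict_def)
  then show "\<Xi> \<in> (\<lambda>v. \<lambda>\<phi>\<in>dual_carrier V. \<phi> v) ` vcarrier V"
    using \<open>u \<in> ball C\<close> by (auto simp: ball_def)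
qed

end


section \<open>Weak topologies and ultrafilters\<close>

lemma generated_topology_limit:
  assumes "openin (topology_generated_by S) U" "x \<in> U"
    and "\<And>s. s \<in> S \<Longrightarrow> x \<in> s \<Longrightarrow> eventually (\<lambda>y. y \<in> s) F"
  shows "eventually (\<lambda>y. y \<in> U) F"
proof -
  have "generate_topology_on S U" using assms(1) by (simp add: openin_topology_generated_by_iff)
  then show ?thesis using assms(2,3)
  proof induction
    case (Int a b)
    then show ?case by (auto intro: eventually_conj)
  next
    case (UN K)
    then obtain k where "k \<in> K" "x \<in> k" by blast
    then have "eventually (\<lambda>y. y \<in> k) F" using UN by blast
    then show ?case by eventually_elim (use \<open>k \<in> K\<close> in blast)
  qed auto
qed

lemma compactin_ultrafilter_limit:
  assumes "compactin T K" "ultrafilter G" "eventually (\<lambda>x. x \<in> K) G"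
  obtains k where "k \<in> K" "\<And>U. openin T U \<Longrightarrow> k \<in> U \<Longrightarrow> eventually (\<lambda>x. x \<in> U) G"
proof (rule ccontr)
  assume "\<not> thesis"
  then have "\<forall>k\<in>K. \<exists>U. openin T U \<and> k \<in> U \<and> \<not> eventually (\<lambda>x. x \<in> U) G"
    using that by blast
  then obtain U where U: "\<And>k. k \<in> K \<Longrightarrow> openin T (U k) \<and> k \<in> U k \<and> \<not> eventually (\<lambda>x. x \<in> U k) G"
    by metis
  have "\<exists>\<F>. finite \<F> \<and> \<F> \<subseteq> U ` K \<and> K \<subseteq> \<Union>\<F>"
    by (rule assms(1)[unfolded compactin_def, THEN conjunct2, rule_format]) (use U in blast)
  then obtain \<F> where \<F>: "finite \<F>" "\<F> \<subseteq> U ` K" "K \<subseteq> \<Union>\<F>" by blast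
  have "eventually (\<lambda>x. x \<notin> A) G" if "A \<in> \<F>" for A
    using that \<F>(2) U ultrafilter_not_eventually[OF assms(2)] by blast
  then have "eventually (\<lambda>x. \<forall>A\<in>\<F>. x \<notin> A) G"
    using \<F>(1) by (simp add: eventually_ball_finite)
  with assms(3) have "eventually (\<lambda>x. False) G"
    by eventually_elim (use \<F>(3) in blast)
  then show False
    using ultrafilter_not_bot[OF assms(2)] by (simp add: trivial_limit_def)
qed

lemma compactin_ultrafilterI:
  assumes "K \<subseteq> topspace T"
    and "\<And>G. ultrafilter G \<Longrightarrow> eventually (\<lambda>x. x \<in> K) G \<Longrightarrow>
      \<exists>k\<in>K. \<forall>U. openin T U \<longrightarrow> k \<in> U \<longrightarrow> eventually (\<lambda>x. x \<in> U) G"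
  shows "compactin T K"
  unfolding compactin_def
proof (intro conjI assms(1) allI impI, elim conjE, rule ccontr)
  fix \<U> assume op: "\<forall>U\<in>\<U>. openin T U" and cov: "K \<subseteq> \<Union>\<U>"
    and n: "\<nexists>\<F>. finite \<F> \<and> \<F> \<subseteq> \<U> \<and> K \<subseteq> \<Union>\<F>"
  define R where "R U x \<longleftrightarrow> x \<in> K \<and> (U \<in> \<U> \<longrightarrow> x \<notin> U)" for U x
  have "\<exists>x. \<forall>U\<in>J. R U x" if J: "finite J" for J
  proof -
    have "\<not> K \<subseteq> \<Union>(J \<inter> \<U>)" using n J by blast
    then show ?thesis unfolding R_def by blast
  qed
  then obtain G where G: "ultrafilter G" "\<And>U. eventually (R U) G"
    using ultrafilter_finite_intersection[of R] by blast
  have "eventually (\<lambda>x. x \<in> K) G"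
    using G(2)[of undefined] by eventually_elim (simp add: R_def)
  then obtain k where k: "k \<in> K" "\<forall>U. openin T U \<longrightarrow> k \<in> U \<longrightarrow> eventually (\<lambda>x. x \<in> U) G"
    using assms(2)[OF G(1)] by blast
  then obtain U where U: "U \<in> \<U>" "k \<in> U" using cov by blast
  then have "eventually (\<lambda>x. x \<in> U) G" using k op by blast
  with G(2)[of U] have "eventually (\<lambda>x. False) G"
    by eventually_elim (use U in \<open>simp add: R_def\<close>)
  then show False
    using ultrafilter_not_bot[OF G(1)] by (simp add: trivial_limit_def)
qed

lemma space_of_type_simps [simp]:
  "vcarrier space_of_type = UNIV" "vzero space_of_type = 0" "vadd space_of_type = (+)"
  "vscale space_of_type = (*\<^sub>R)" "vnorm space_of_type = norm"
  by (simp_all add: space_of_type_def)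

lemma dual_carrier_space_of_type: "dual_carrier space_of_type = {\<phi>. bounded_linear \<phi>}"
proof (intro equalityI subsetI)
  fix \<phi> :: "'a \<Rightarrow> real" assume "\<phi> \<in> dual_carrier space_of_type"
  then obtain C where \<phi>: "\<And>x y. \<phi> (x + y) = \<phi> x + \<phi> y" "\<And>a x. \<phi> (a *\<^sub>R x) = a * \<phi> x" "\<And>x. \<bar>\<phi> x\<bar> \<le> C * norm x"
    unfolding dual_carrier_def by auto
  have "bounded_linear \<phi>"
    by (rule bounded_linear_intro[of _ C]) (use \<phi> in \<open>auto simp: mult.commute\<close>)
  then show "\<phi> \<in> {\<phi>. bounded_linear \<phi>}" by simp
next
  fix \<phi> :: "'a \<Rightarrow> real" assume "\<phi> \<in> {\<phi>. bounded_linear \<phi>}"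
  then have \<phi>: "bounded_linear \<phi>" by simp
  obtain C where "\<forall>x. norm (\<phi> x) \<le> norm x * C"
    using bounded_linear.bounded[OF \<phi>] by blast
  then show "\<phi> \<in> dual_carrier space_of_type"
    using linear_add[OF bounded_linear.linear[OF \<phi>]] linear_scale[OF bounded_linear.linear[OF \<phi>]]
    by (auto simp: dual_carrier_def mult.commute intro!: exI[of _ C])
qed

lemma openin_weak_topology:
  "\<phi> \<in> dual_carrier V \<Longrightarrow> open U \<Longrightarrow> openin (weak_topology V) {v \<in> vcarrier V. \<phi> v \<in> U}"
  unfolding weak_topology_def by (rule topology_generated_by_Basis) auto

text \<open>The topspace of a generated topology is only the union of the generating sets; the zero
  functional already contributes the whole space.\<close>

lemma topspace_weak_topology_type [simp]:
  "topspace (weak_topology (space_of_type :: 'a::real_normed_vector normed_structure)) = UNIV"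
proof -
  have "openin (weak_topology space_of_type) {v \<in> vcarrier (space_of_type :: 'a normed_structure). (\<lambda>_. 0 :: real) v \<in> UNIV}"
    by (rule openin_weak_topology) (auto simp: dual_carrier_space_of_type)
  then show ?thesis
    using openin_subset by fastforce
qed

lemma compactin_weak_imp_relatively_weakly_compact:
  fixes A :: "'a::real_normed_vector set"
  assumes "compactin (weak_topology space_of_type) K" "A \<subseteq> K"
  shows "relatively_weakly_compact A"
  unfolding relatively_weakly_compact_def
proof (intro allI impI)
  fix G :: "'a filter" assume G: "ultrafilter G" "eventually (\<lambda>v. v \<in> A) G"
  have "eventually (\<lambda>v. v \<in> K) G" using G(2) by eventually_elim (use assms(2) in blast)
  then obtain k where k: "\<And>U. openin (weak_topology space_of_type) U \<Longrightarrow> k \<in> U \<Longrightarrow> eventually (\<lambda>x. x \<in> U) G"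
    by (rule compactin_ultrafilter_limit[OF assms(1) G(1)]) blast
  have "(blinfun_apply \<phi> \<longlongrightarrow> \<phi> k) G" for \<phi> :: "'a \<Rightarrow>\<^sub>L real"
  proof (rule topological_tendstoI)
    fix U :: "real set" assume U: "open U" "\<phi> k \<in> U"
    have "openin (weak_topology space_of_type) {v \<in> vcarrier space_of_type. \<phi> v \<in> U}"
      by (rule openin_weak_topology) (use U in \<open>auto simp: dual_carrier_space_of_type blinfun.bounded_linear_right\<close>)
    from k[OF this] show "eventually (\<lambda>v. \<phi> v \<in> U) G"
      using U by simp
  qed
  then show "\<exists>u. weak_limit u G" unfolding weak_limit_def by blast
qed

lemma bounded_linear_apply_bcontfun: "bounded_linear (\<lambda>u :: 'x::topological_space \<Rightarrow>\<^sub>C real. apply_bcontfun u x)"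
proof (rule bounded_linear_intro[of _ 1])
  show "norm (apply_bcontfun u x) \<le> norm u * 1" for u :: "'x \<Rightarrow>\<^sub>C real"
    using norm_bounded[of u x] by simp
qed auto

text \<open>Point evaluations separate functions. Weakly compact sets are therefore closed, and one
  that contains the orbit also contains its weak closure.\<close>

lemma Hausdorff_weak_topology_bcontfun:
  "Hausdorff_space (weak_topology (space_of_type :: ('x::topological_space \<Rightarrow>\<^sub>C real) normed_structure))"
  unfolding Hausdorff_space_def
proof (intro allI impI, elim conjE)
  fix g h :: "'x \<Rightarrow>\<^sub>C real" assume "g \<noteq> h"
  then obtain x where "g x \<noteq> h x" using bcontfun_eqI by blast
  from hausdorff[OF this] obtain U U' where
    U: "open U" "open U'" "g x \<in> U" "h x \<in> U'" "U \<inter> U' = {}" by blast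
  let ?e = "\<lambda>A. {v \<in> vcarrier space_of_type. (\<lambda>u :: 'x \<Rightarrow>\<^sub>C real. u x) v \<in> A}"
  have op: "openin (weak_topology space_of_type) (?e A)" if "open A" for A
    by (rule openin_weak_topology[OF _ that, of "\<lambda>u. apply_bcontfun u x"])
      (simp add: dual_carrier_space_of_type bounded_linear_apply_bcontfun)
  have "g \<in> ?e U" "h \<in> ?e U'" "disjnt (?e U) (?e U')"
    using U(3-5) by (auto simp: disjnt_def)
  with op[OF U(1)] op[OF U(2)] show "\<exists>U V. openin (weak_topology space_of_type) U \<and>
      openin (weak_topology space_of_type) V \<and> g \<in> U \<and> h \<in> V \<and> disjnt U V"
    by (intro exI conjI)
qed


section \<open>Representable functions are weakly almost periodic\<close>

lemma reflexive_bidual: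
  assumes "reflexive_banach_space_on V" "\<Xi> \<in> dual_carrier (dual_space V)"
  obtains v where "v \<in> vcarrier V" "\<And>\<phi>. \<phi> \<in> dual_carrier V \<Longrightarrow> \<Xi> \<phi> = \<phi> v"
proof -
  have "\<Xi> \<in> (\<lambda>v. \<lambda>\<phi>\<in>dual_carrier V. \<phi> v) ` vcarrier V"
    using assms unfolding reflexive_banach_space_on_def by simp
  with that show ?thesis by force
qed

lemma continuous_on_weak_dual:
  fixes \<alpha> :: "'x::topological_space \<Rightarrow> 'v \<Rightarrow> real"
  assumes V: "normed_space_on V" and u: "u \<in> vcarrier V"
    and \<alpha>: "continuous_map euclidean (weak_topology (dual_space V)) \<alpha>" "\<And>x. \<alpha> x \<in> dual_carrier V"
  shows "continuous_on UNIV (\<lambda>x. \<alpha> x u)"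
  unfolding continuous_on_open_vimage[OF open_UNIV]
proof (intro allI impI)
  fix B :: "real set" assume B: "open B"
  have "openin (weak_topology (dual_space V)) {\<psi> \<in> vcarrier (dual_space V). (\<lambda>\<phi>\<in>dual_carrier V. \<phi> u) \<psi> \<in> B}"
    by (rule openin_weak_topology[OF bidual_embedding[OF V u] B])
  then have "openin euclidean {x \<in> topspace euclidean. \<alpha> x \<in> {\<psi> \<in> vcarrier (dual_space V). (\<lambda>\<phi>\<in>dual_carrier V. \<phi> u) \<psi> \<in> B}}"
    by (rule openin_continuous_map_preimage[OF \<alpha>(1)])
  moreover have "{x \<in> topspace euclidean. \<alpha> x \<in> {\<psi> \<in> vcarrier (dual_space V). (\<lambda>\<phi>\<in>dual_carrier V. \<phi> u) \<psi> \<in> B}} =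
      (\<lambda>x. \<alpha> x u) -` B \<inter> UNIV"
    using \<alpha>(2) by auto
  ultimately show "open ((\<lambda>x. \<alpha> x u) -` B \<inter> UNIV)" by (simp only: open_openin)
qed

theorem reflexive_representation_imp_wap:
  fixes act :: "'s::semitopological_semigroup \<Rightarrow> 'x::topological_space \<Rightarrow> 'x"
  assumes flow: "semitopological_flow act" and rep: "reflexive_representation act f V h \<alpha> v0"
  shows "weakly_almost_periodic act f"
proof -
  have refl: "reflexive_banach_space_on V" and anti: "antihomomorphism V h"
    and cont: "continuous_map euclidean (subtopology (weak_topology (dual_space V)) (dual_ball V)) \<alpha>"
    and equi: "\<And>s x. \<alpha> (act s x) = dual_action V h s (\<alpha> x)"
    and v0: "v0 \<in> vcarrier V" and f: "\<And>x. f x = \<alpha> x v0"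
    using rep unfolding reflexive_representation_def by auto
  have V: "normed_space_on V"
    using refl unfolding reflexive_banach_space_on_def banach_space_on_def by blast
  have c: "continuous_map euclidean (weak_topology (dual_space V)) \<alpha>" and ball: "\<And>x. \<alpha> x \<in> dual_ball V"
    using cont by (auto simp: continuous_map_in_subtopology)
  have \<alpha>: "\<alpha> x \<in> dual_carrier V" "dual_norm V (\<alpha> x) \<le> 1" for x
    using ball[of x] by (auto simp: dual_ball_def)
  have \<alpha>_le: "\<bar>\<alpha> x u\<bar> \<le> vnorm V u" if "u \<in> vcarrier V" for x u
  proof -
    have "\<bar>\<alpha> x u\<bar> \<le> dual_norm V (\<alpha> x) * vnorm V u" by (rule dual_norm_bound[OF V \<alpha>(1) that])
    also have "\<dots> \<le> 1 * vnorm V u"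
      by (intro mult_right_mono \<alpha>(2) normed_space_onD(4)[OF V that])
    finally show ?thesis by simp
  qed
  define T where "T u = Bcontfun (\<lambda>x. \<alpha> x u)" for u
  have T: "apply_bcontfun (T u) = (\<lambda>x. \<alpha> x u)" if "u \<in> vcarrier V" for u
    unfolding T_def
  proof (rule Bcontfun_inverse, rule bcontfun_normI)
    show "continuous_on UNIV (\<lambda>x. \<alpha> x u)" by (rule continuous_on_weak_dual[OF V that c \<alpha>(1)])
    show "norm (\<alpha> x u) \<le> vnorm V u" for x using \<alpha>_le[OF that] by simp
  qed
  define R where "R = vnorm V v0"
  \<comment> \<open>A ball of \<open>V\<close> in polar form: the bounds on all
    \<open>\<phi> u\<close> pass directly to weak limits, whereas a bound on the norm of a limit
    would call for norming functionals on \<open>V\<close>.\<close>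
  define good where "good u \<longleftrightarrow> u \<in> vcarrier V \<and> (\<forall>\<phi>\<in>dual_carrier V. \<bar>\<phi> u\<bar> \<le> dual_norm V \<phi> * R)" for u
  let ?K = "T ` Collect good"
  have comp: "compactin (weak_topology space_of_type) ?K"
  proof (rule compactin_ultrafilterI)
    fix G :: "('x \<Rightarrow>\<^sub>C real) filter" assume G: "ultrafilter G" "eventually (\<lambda>g. g \<in> ?K) G"
    note nb = ultrafilter_not_bot[OF G(1)]
    have "\<forall>g\<in>?K. \<exists>u. good u \<and> g = T u" by blast
    from bchoice[OF this] obtain u where u: "\<And>g. g \<in> ?K \<Longrightarrow> good (u g) \<and> g = T (u g)" by blast
    define \<Xi> where "\<Xi> = (\<lambda>\<phi>\<in>dual_carrier V. Lim G (\<lambda>g. \<phi> (u g)))"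
    have lim: "((\<lambda>g. \<phi> (u g)) \<longlongrightarrow> \<Xi> \<phi>) G" if \<phi>: "\<phi> \<in> dual_carrier V" for \<phi>
    proof -
      have "eventually (\<lambda>g. \<bar>\<phi> (u g)\<bar> \<le> dual_norm V \<phi> * R) G"
        using G(2) by eventually_elim (use u \<phi> in \<open>auto simp: good_def\<close>)
      from ultrafilter_bounded_tendsto_Lim[OF G(1) this] \<phi> show ?thesis
        by (simp add: \<Xi>_def)
    qed
    have carr: "eventually (\<lambda>g. u g \<in> vcarrier V) G"
      using G(2) by eventually_elim (use u in \<open>auto simp: good_def\<close>)
    have \<Xi>_le: "\<bar>\<Xi> \<phi>\<bar> \<le> dual_norm V \<phi> * R" if \<phi>: "\<phi> \<in> dual_carrier V" for \<phi>
    proof (rule tendsto_upperbound[OF tendsto_rabs[OF lim[OF \<phi>]] _ nb])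
      show "eventually (\<lambda>g. \<bar>\<phi> (u g)\<bar> \<le> dual_norm V \<phi> * R) G"
        using G(2) by eventually_elim (use u \<phi> in \<open>auto simp: good_def\<close>)
    qed
    have "\<Xi> \<in> dual_carrier (dual_space V)"
      unfolding dual_carrier_def[of "dual_space V"] dual_space_simps
    proof (intro CollectI conjI ballI allI exI[of _ R])
      show "\<Xi> \<in> extensional (dual_carrier V)" by (simp add: \<Xi>_def)
    next
      fix \<phi> a assume \<phi>: "\<phi> \<in> dual_carrier V"
      show "\<bar>\<Xi> \<phi>\<bar> \<le> R * dual_norm V \<phi>" using \<Xi>_le[OF \<phi>] by (simp add: mult.commute)
      show "\<Xi> (\<lambda>x\<in>vcarrier V. a * \<phi> x) = a * \<Xi> \<phi>"
      proof (rule tendsto_unique[OF nb lim[OF dual_carrier_scale[OF V \<phi>]]])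
        have "((\<lambda>g. a * \<phi> (u g)) \<longlongrightarrow> a * \<Xi> \<phi>) G" by (intro tendsto_intros lim \<phi>)
        moreover have "eventually (\<lambda>g. a * \<phi> (u g) = (\<lambda>x\<in>vcarrier V. a * \<phi> x) (u g)) G"
          using carr by eventually_elim simp
        ultimately show "((\<lambda>g. (\<lambda>x\<in>vcarrier V. a * \<phi> x) (u g)) \<longlongrightarrow> a * \<Xi> \<phi>) G"
          by (rule Lim_transform_eventually)
      qed
    next
      fix \<phi> \<psi> assume \<phi>: "\<phi> \<in> dual_carrier V" and \<psi>: "\<psi> \<in> dual_carrier V"
      show "\<Xi> (\<lambda>x\<in>vcarrier V. \<phi> x + \<psi> x) = \<Xi> \<phi> + \<Xi> \<psi>"
      proof (rule tendsto_unique[OF nb lim[OF dual_carrier_add[OF V \<phi> \<psi>]]])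
        have "((\<lambda>g. \<phi> (u g) + \<psi> (u g)) \<longlongrightarrow> \<Xi> \<phi> + \<Xi> \<psi>) G" by (intro tendsto_intros lim \<phi> \<psi>)
        moreover have "eventually (\<lambda>g. \<phi> (u g) + \<psi> (u g) = (\<lambda>x\<in>vcarrier V. \<phi> x + \<psi> x) (u g)) G"
          using carr by eventually_elim simp
        ultimately show "((\<lambda>g. (\<lambda>x\<in>vcarrier V. \<phi> x + \<psi> x) (u g)) \<longlongrightarrow> \<Xi> \<phi> + \<Xi> \<psi>) G"
          by (rule Lim_transform_eventually)
      qed
    qed
    then obtain u0 where u0: "u0 \<in> vcarrier V" "\<And>\<phi>. \<phi> \<in> dual_carrier V \<Longrightarrow> \<Xi> \<phi> = \<phi> u0"
      by (rule reflexive_bidual[OF refl]) blast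
    have "good u0" using u0 \<Xi>_le by (simp add: good_def)
    have lim_T: "(\<mu> \<longlongrightarrow> \<mu> (T u0)) G" if \<mu>: "bounded_linear \<mu>" for \<mu> :: "('x \<Rightarrow>\<^sub>C real) \<Rightarrow> real"
    proof -
      \<comment> \<open>The adjoint of \<open>T\<close> applied to \<open>\<mu>\<close>; convergence
        against \<open>\<mu>\<close> becomes convergence against a functional on
        \<open>V\<close>.\<close>
      define \<psi> where "\<psi> = (\<lambda>u\<in>vcarrier V. \<mu> (T u))"
      obtain C where C: "\<And>g. \<bar>\<mu> g\<bar> \<le> norm g * C" "0 \<le> C"
        using bounded_linear.nonneg_bounded[OF \<mu>] by auto
      have "\<psi> \<in> dual_carrier V"
        unfolding dual_carrier_def
      proof (intro CollectI conjI ballI allI exI[of _ C])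
        fix x y a assume x: "x \<in> vcarrier V"
        have "T (vscale V a x) = a *\<^sub>R T x"
          by (rule bcontfun_eqI) (simp add: T x normed_space_onD(3)[OF V x] dual_carrierD(3)[OF \<alpha>(1)])
        then show "\<psi> (vscale V a x) = a * \<psi> x"
          using x normed_space_onD(3)[OF V x] by (simp add: \<psi>_def linear_scale[OF bounded_linear.linear[OF \<mu>]])
        have "norm (T x) \<le> vnorm V x"
          by (rule norm_bound) (simp add: T x \<alpha>_le)
        then have "norm (T x) * C \<le> vnorm V x * C" using C(2) by (rule mult_right_mono)
        with C(1)[of "T x"] show "\<bar>\<psi> x\<bar> \<le> C * vnorm V x"
          using x by (simp add: \<psi>_def mult.commute)
        assume y: "y \<in> vcarrier V"
        have "T (vadd V x y) = T x + T y"
          by (rule bcontfun_eqI) (simp add: T x y normed_space_onD(2)[OF V x y] dual_carrierD(2)[OF \<alpha>(1)])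
        then show "\<psi> (vadd V x y) = \<psi> x + \<psi> y"
          using x y normed_space_onD(2)[OF V x y] by (simp add: \<psi>_def linear_add[OF bounded_linear.linear[OF \<mu>]])
      qed (simp add: \<psi>_def)
      from lim[OF this] have "((\<lambda>g. \<psi> (u g)) \<longlongrightarrow> \<mu> (T u0)) G"
        using u0 \<open>\<psi> \<in> dual_carrier V\<close> by (simp add: \<psi>_def)
      moreover have "eventually (\<lambda>g. \<psi> (u g) = \<mu> g) G"
        using G(2) by eventually_elim (use u in \<open>auto simp: \<psi>_def good_def\<close>)
      ultimately show ?thesis by (rule Lim_transform_eventually)
    qed
    have "eventually (\<lambda>g. g \<in> U) G" if U: "openin (weak_topology space_of_type) U" "T u0 \<in> U" for U
    proof (rule generated_topology_limit[OF U[unfolded weak_topology_def]])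
      fix S :: "('x \<Rightarrow>\<^sub>C real) set"
      assume "S \<in> {{v \<in> vcarrier space_of_type. \<phi> v \<in> U} |\<phi> U. \<phi> \<in> vcarrier (dual_space space_of_type) \<and> open U}"
        and "T u0 \<in> S"
      then show "eventually (\<lambda>g. g \<in> S) G"
      proof (elim CollectE exE conjE)
        fix \<mu> B
        assume S: "S = {v \<in> vcarrier space_of_type. \<mu> v \<in> B}"
          and \<mu>: "\<mu> \<in> vcarrier (dual_space (space_of_type :: ('x \<Rightarrow>\<^sub>C real) normed_structure))"
          and B: "open B" and "T u0 \<in> S"
        then have "bounded_linear \<mu>" "\<mu> (T u0) \<in> B"
          by (simp_all add: dual_carrier_space_of_type)
        then show ?thesis
          using topological_tendstoD[OF lim_T B] by (simp add: S)
      qed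
    qed
    with \<open>good u0\<close> show "\<exists>k\<in>?K. \<forall>U. openin (weak_topology space_of_type) U \<longrightarrow> k \<in> U \<longrightarrow> eventually (\<lambda>g. g \<in> U) G"
      by (intro bexI[of _ "T u0"]) auto
  qed simp
  have sub: "range (translate act f) \<subseteq> ?K"
  proof
    fix g assume "g \<in> range (translate act f)"
    then obtain s where g: "g = translate act f s" by blast
    have hs: "h s \<in> contractions V" using anti by (auto simp: antihomomorphism_def)
    have hv: "h s v0 \<in> vcarrier V" "vnorm V (h s v0) \<le> R"
      using hs v0 by (auto simp: contractions_def R_def)
    have "good (h s v0)"
      unfolding good_def
    proof (intro conjI ballI hv(1))
      fix \<phi> assume \<phi>: "\<phi> \<in> dual_carrier V"
      show "\<bar>\<phi> (h s v0)\<bar> \<le> dual_norm V \<phi> * R"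
        using dual_norm_bound[OF V \<phi> hv(1)] mult_left_mono[OF hv(2) dual_norm_nonneg[OF V \<phi>]] by linarith
    qed
    moreover have "g = T (h s v0)"
      unfolding g by (rule bcontfun_eqI)
        (simp add: apply_translate[OF flow] f equi dual_action_def v0 T[OF hv(1)])
    ultimately show "g \<in> ?K" by blast
  qed
  have "weak_topology space_of_type closure_of range (translate act f) \<subseteq> ?K"
    by (rule closure_of_minimal[OF sub compactin_imp_closedin[OF Hausdorff_weak_topology_bcontfun comp]])
  then show ?thesis
    unfolding weakly_almost_periodic_def by (rule closed_compactin[OF comp]) simp
qed


section \<open>Weakly almost periodic functions are representable\<close>

lemma complete_bcontfun: "complete (UNIV :: ('a::topological_space \<Rightarrow>\<^sub>C 'b::complete_space) set)"
  unfolding complete_def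
proof (intro allI impI)
  fix f :: "nat \<Rightarrow> ('a \<Rightarrow>\<^sub>C 'b)" assume "(\<forall>n. f n \<in> UNIV) \<and> Cauchy f"
  then have "Cauchy f" by simp
  have "\<forall>e>0. \<exists>N. \<forall>m n x. N \<le> m \<and> N \<le> n \<and> True \<longrightarrow> dist (f m x) (f n x) < e"
    using \<open>Cauchy f\<close> dist_fun_lt_imp_dist_val_lt unfolding Cauchy_def by meson
  then obtain g where "\<forall>e>0. \<exists>N. \<forall>n x. N \<le> n \<and> True \<longrightarrow> dist (f n x) (g x) < e"
    using uniformly_convergent_eq_cauchy[of "\<lambda>_. True" "\<lambda>n. apply_bcontfun (f n)"] by blast
  then have "uniform_limit UNIV f g sequentially"
    unfolding uniform_limit_sequentially_iff by blast
  then obtain l where "f \<longlonglongrightarrow> l"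
    by (rule uniform_limit_bcontfunE[OF _ sequentially_bot])
  then show "\<exists>l\<in>UNIV. f \<longlonglongrightarrow> l" by auto
qed

lemma relatively_weakly_compact_Un:
  assumes "relatively_weakly_compact A" "relatively_weakly_compact B"
  shows "relatively_weakly_compact (A \<union> B)"
  unfolding relatively_weakly_compact_def
proof (intro allI impI)
  fix G :: "'a filter" assume G: "ultrafilter G" "eventually (\<lambda>v. v \<in> A \<union> B) G"
  show "\<exists>u. weak_limit u G"
  proof (cases "eventually (\<lambda>v. v \<in> A) G")
    case True
    then show ?thesis using assms(1) G(1) unfolding relatively_weakly_compact_def by blast
  next
    case False
    from ultrafilter_not_eventually[OF G(1) this] G(2) have "eventually (\<lambda>v. v \<in> B) G"
      by eventually_elim blast
    then show ?thesis using assms(2) G(1) unfolding relatively_weakly_compact_def by blast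
  qed
qed

lemma relatively_weakly_compact_singleton: "relatively_weakly_compact {a}"
  unfolding relatively_weakly_compact_def weak_limit_def
proof (intro allI impI exI)
  fix G :: "'a filter" and \<phi> :: "'a \<Rightarrow>\<^sub>L real" assume "eventually (\<lambda>v. v \<in> {a}) G"
  then show "(blinfun_apply \<phi> \<longlongrightarrow> \<phi> a) G"
    by (auto intro!: tendsto_eventually elim!: eventually_mono)
qed

lemma continuous_on_UNIV_tendstoI:
  fixes g :: "'a::topological_space \<Rightarrow> 'b::topological_space"
  shows "(\<And>s. (g \<longlongrightarrow> g s) (nhds s)) \<Longrightarrow> continuous_on UNIV g"
  unfolding continuous_on_def by (auto intro: tendsto_mono[OF at_within_le_nhds])

lemma open_eventuallyI:
  assumes "\<And>s. s \<in> S \<Longrightarrow> eventually (\<lambda>t. t \<in> S) (nhds s)"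
  shows "open S"
proof -
  have "\<forall>s\<in>S. \<exists>T. open T \<and> s \<in> T \<and> T \<subseteq> S"
  proof
    fix s assume "s \<in> S"
    then have "\<exists>T. open T \<and> s \<in> T \<and> (\<forall>x\<in>T. x \<in> S)"
      by (rule assms[unfolded eventually_nhds])
    then show "\<exists>T. open T \<and> s \<in> T \<and> T \<subseteq> S"
      by (simp add: subset_eq)
  qed
  then show ?thesis by (rule open_subopen[THEN iffD2])
qed

lemma continuous_on_UNIV_nhds:
  assumes "continuous_on UNIV g"
  shows "(g \<longlongrightarrow> g s) (nhds s)"
proof (rule topological_tendstoI)
  fix B assume B: "open B" "g s \<in> B"
  then have "open (g -` B)"
    using assms continuous_on_open_vimage[OF open_UNIV, of g] by simp
  from eventually_nhds_in_open[OF this, of s] B(2) show "eventually (\<lambda>t. g t \<in> B) (nhds s)"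
    by simp
qed

section \<open>Translations and norm continuity of orbit maps\<close>

context
  fixes act :: "'s::semitopological_semigroup \<Rightarrow> 'x::topological_space \<Rightarrow> 'x"
  assumes flow: "semitopological_flow act"
begin

lemmas apply_tr [simp] = apply_translate[OF flow]

lemma flowD:
  "continuous_on UNIV (\<lambda>x. act s x)" "continuous_on UNIV (\<lambda>s. act s x)"
  "act s (act t x) = act (s * t) x" "is_identity e \<Longrightarrow> act e x = x"
  using flow by (auto simp: semitopological_flow_def)

lemma linear_translate: "linear (\<lambda>u. translate act u s)"
  by (rule linearI) (auto intro!: bcontfun_eqI)

lemma norm_translate_le: "norm (translate act u s) \<le> norm u"
  by (rule norm_bound) (use norm_bounded[of u] in auto)

lemma translate_translate: "translate act (translate act u t) s = translate act u (t * s)"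
  by (rule bcontfun_eqI) (simp add: flowD(3))

lemma translate_identity: "is_identity e \<Longrightarrow> translate act u e = u"
  by (rule bcontfun_eqI) (simp add: flowD(4))

definition norm_continuous :: "('x \<Rightarrow>\<^sub>C real) \<Rightarrow> bool" where
  "norm_continuous u \<longleftrightarrow> (\<forall>s. (translate act u \<longlongrightarrow> translate act u s) (nhds s))"

lemma norm_continuous_scaleR: "norm_continuous u \<Longrightarrow> norm_continuous (c *\<^sub>R u)"
proof -
  have "translate act (c *\<^sub>R u) = (\<lambda>t. c *\<^sub>R translate act u t)"
    by (simp add: fun_eq_iff linear_scale[OF linear_translate])
  then show "norm_continuous u \<Longrightarrow> norm_continuous (c *\<^sub>R u)"
    by (simp add: norm_continuous_def tendsto_scaleR)
qed

lemma norm_continuous_add: "norm_continuous u \<Longrightarrow> norm_continuous v \<Longrightarrow> norm_continuous (u + v)"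
proof -
  have "translate act (u + v) = (\<lambda>t. translate act u t + translate act v t)"
    by (simp add: fun_eq_iff linear_add[OF linear_translate])
  then show "norm_continuous u \<Longrightarrow> norm_continuous v \<Longrightarrow> norm_continuous (u + v)"
    by (simp add: norm_continuous_def tendsto_add)
qed

lemma norm_continuous_closure:
  assumes "\<And>\<epsilon>. 0 < \<epsilon> \<Longrightarrow> \<exists>z. norm_continuous z \<and> norm (u - z) \<le> \<epsilon>"
  shows "norm_continuous u"
  unfolding norm_continuous_def
proof (intro allI tendstoI)
  fix s and e :: real assume e: "0 < e"
  obtain z where z: "norm_continuous z" "norm (u - z) \<le> e / 4"
    using assms[of "e / 4"] e by auto
  have *: "norm (translate act u t - translate act z t) \<le> e / 4" for t
    using norm_translate_le[of "u - z" t] z(2) by (simp add: linear_diff[OF linear_translate])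
  have "eventually (\<lambda>t. dist (translate act z t) (translate act z s) < e / 4) (nhds s)"
    by (rule tendstoD) (use z(1) e in \<open>auto simp: norm_continuous_def\<close>)
  then show "eventually (\<lambda>t. dist (translate act u t) (translate act u s) < e) (nhds s)"
  proof eventually_elim
    case (elim t)
    have "norm (translate act u t - translate act u s) \<le>
        norm (translate act u t - translate act z t) + norm (translate act z t - translate act z s) +
        norm (translate act u s - translate act z s)"
      using norm_triangle_ineq4[of "(translate act u t - translate act z t) + (translate act z t - translate act z s)"
          "translate act u s - translate act z s"]
        norm_triangle_ineq[of "translate act u t - translate act z t" "translate act z t - translate act z s"]
      by simp
    then show ?case using *[of t] *[of s] elim e by (simp add: dist_norm)
  qed
qed

section \<open>The interpolation space of an orbit\<close>

context
  fixes f :: "'x \<Rightarrow>\<^sub>C real"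
  assumes wap: "weakly_almost_periodic act f"
begin

lemma relatively_weakly_compact_orbit: "relatively_weakly_compact (range (translate act f))"
proof (rule compactin_weak_imp_relatively_weakly_compact)
  show "compactin (weak_topology space_of_type) (weak_topology space_of_type closure_of range (translate act f))"
    using wap by (simp add: weakly_almost_periodic_def)
  show "range (translate act f) \<subseteq> weak_topology space_of_type closure_of range (translate act f)"
    by (rule closure_of_subset) simp
qed

text \<open>Brings the orbit of \<open>f\<close> into the unit ball, as the locale
  \<open>interpolation\<close> demands; the 1 in the denominator covers
  \<open>f = 0\<close>.\<close>

definition scale_factor :: real where
  "scale_factor = 1 / (norm f + 1)"

text \<open>The semigroup need not have an identity, so \<open>f\<close> is added to its orbit by hand.\<close>

definition orbit :: "('x \<Rightarrow>\<^sub>C real) set" where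
  "orbit = insert f (range (translate act f))"

text \<open>Both signs are included so that the convex hull is symmetric.\<close>

definition gens :: "('x \<Rightarrow>\<^sub>C real) set" where
  "gens = (*\<^sub>R) scale_factor ` orbit \<union> (*\<^sub>R) (- scale_factor) ` orbit"

lemma scale_factor_pos: "0 < scale_factor"
  by (simp add: scale_factor_def add_nonneg_pos)

lemma orbit_norm: "g \<in> orbit \<Longrightarrow> norm g \<le> norm f"
  using norm_translate_le by (auto simp: orbit_def)

lemma gens_norm: "g \<in> gens \<Longrightarrow> norm g \<le> 1"
proof -
  have "scale_factor * norm g \<le> 1" if "g \<in> orbit" for g
    using orbit_norm[OF that] by (simp add: scale_factor_def divide_le_eq add_nonneg_pos)
  then show "g \<in> gens \<Longrightarrow> norm g \<le> 1"
    using scale_factor_pos by (auto simp: gens_def)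
qed

lemma gens_translate: "g \<in> gens \<Longrightarrow> translate act g s \<in> gens"
proof -
  have "translate act g s \<in> orbit" if "g \<in> orbit" for g
    using that by (auto simp: orbit_def translate_translate)
  then show "g \<in> gens \<Longrightarrow> translate act g s \<in> gens"
    by (auto simp: gens_def linear_scale[OF linear_translate] linear_neg[OF linear_translate])
qed

lemma gens_uminus: "uminus ` gens = gens"
proof -
  have "- g \<in> gens" if "g \<in> gens" for g
    using that by (auto simp: gens_def)
  then show ?thesis by (metis (no_types, lifting) add.inverse_inverse image_iff subsetI subset_antisym image_subsetI)
qed

lemma relatively_weakly_compact_hull: "relatively_weakly_compact (convex hull gens)"
proof (rule Krein[OF complete_bcontfun])
  have "relatively_weakly_compact orbit"
    using relatively_weakly_compact_Un[OF relatively_weakly_compact_singleton[of f] relatively_weakly_compact_orbit]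
    by (simp add: orbit_def)
  then have "relatively_weakly_compact ((\<lambda>(r, g). r *\<^sub>R g) ` ({scale_factor, - scale_factor} \<times> orbit))"
    by (rule relatively_weakly_compact_scaled) (simp add: finite_imp_compact)
  moreover have "(\<lambda>(r, g). r *\<^sub>R g) ` ({scale_factor, - scale_factor} \<times> orbit) = gens"
    unfolding gens_def by (auto simp: image_iff)
  ultimately show "relatively_weakly_compact gens" by simp
qed (rule gens_norm)

lemma interpolation_hull: "interpolation (convex hull gens)"
proof
  show "- w \<in> convex hull gens" if "w \<in> convex hull gens" for w
  proof -
    have "uminus ` (convex hull gens) = convex hull gens"
      using convex_hull_linear_image[of "uminus :: ('x \<Rightarrow>\<^sub>C real) \<Rightarrow> _" gens]
      by (simp add: gens_uminus linear_iff)
    with that show ?thesis by blast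
  qed
  show "norm w \<le> 1" if "w \<in> convex hull gens" for w
  proof -
    have "convex hull gens \<subseteq> cball 0 1"
      by (rule hull_minimal) (use gens_norm in auto)
    with that show ?thesis by auto
  qed
  show "convex hull gens \<noteq> {}" by (auto simp: gens_def orbit_def)
qed (rule complete_bcontfun convex_convex_hull)+

interpretation I: interpolation "convex hull gens"
  by (rule interpolation_hull)

lemma hull_translate: "w \<in> convex hull gens \<Longrightarrow> translate act w s \<in> convex hull gens"
proof -
  have "(\<lambda>u. translate act u s) ` (convex hull gens) \<subseteq> convex hull gens"
    unfolding convex_hull_linear_image[OF linear_translate]
    by (rule hull_mono) (use gens_translate in auto)
  then show "w \<in> convex hull gens \<Longrightarrow> translate act w s \<in> convex hull gens" by blast
qed

lemma carrier_translate:
  assumes "u \<in> I.carrier"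
  shows "translate act u s \<in> I.carrier" "I.N (translate act u s) \<le> I.N u" "I.K n (translate act u s) \<le> I.K n u"
proof -
  note T = linear_translate[of s] norm_translate_le hull_translate
  show "translate act u s \<in> I.carrier" "I.N (translate act u s) \<le> I.N u"
    using I.N_contraction[OF T assms] by blast+
  show "I.K n (translate act u s) \<le> I.K n u"
    by (rule I.K_contraction[OF T])
qed

lemma f_mem: "f \<in> I.carrier"
proof -
  have "scale_factor *\<^sub>R f \<in> convex hull gens"
    by (rule hull_inc) (auto simp: gens_def orbit_def)
  then have "(1 / scale_factor) *\<^sub>R scale_factor *\<^sub>R f \<in> I.carrier"
    by (intro I.scale_mem I.W_subset_carrier)
  then show ?thesis using scale_factor_pos by simp
qed

definition translation :: "'s \<Rightarrow> ('x \<Rightarrow>\<^sub>C real) \<Rightarrow> ('x \<Rightarrow>\<^sub>C real)" where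
  "translation s = (\<lambda>u\<in>I.carrier. translate act u s)"

definition evaluation :: "'x \<Rightarrow> ('x \<Rightarrow>\<^sub>C real) \<Rightarrow> real" where
  "evaluation x = (\<lambda>u\<in>I.carrier. apply_bcontfun u x)"

lemma evaluation_dual: "evaluation x \<in> dual_carrier I.V" "dual_norm I.V (evaluation x) \<le> 1"
proof -
  have le: "\<bar>apply_bcontfun u x\<bar> \<le> I.N u" if "u \<in> I.carrier" for u
    using norm_bounded[of u x] I.norm_le_N[OF that] by simp
  show "evaluation x \<in> dual_carrier I.V"
    unfolding I.dual_carrier_V_iff
    using le I.N_add I.scale_mem by (auto simp: evaluation_def intro!: exI[of _ 1])
  show "dual_norm I.V (evaluation x) \<le> 1"
    by (rule dual_norm_least[OF I.normed_V]) (use le in \<open>force simp: evaluation_def\<close>)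
qed

lemma translation_contraction: "translation s \<in> contractions I.V"
  unfolding contractions_def
proof (intro CollectI conjI ballI allI)
  show "translation s \<in> vcarrier I.V \<rightarrow>\<^sub>E vcarrier I.V"
    using carrier_translate(1) by (simp add: translation_def)
  fix x a assume x: "x \<in> vcarrier I.V"
  show "translation s (vscale I.V a x) = vscale I.V a (translation s x)"
    using x I.scale_mem by (simp add: translation_def linear_scale[OF linear_translate])
  show "vnorm I.V (translation s x) \<le> vnorm I.V x"
    using x carrier_translate(2) by (simp add: translation_def)
  fix y assume "y \<in> vcarrier I.V"
  then show "translation s (vadd I.V x y) = vadd I.V (translation s x) (translation s y)"
    using x I.N_add by (simp add: translation_def linear_add[OF linear_translate])
qed

lemma translation_representation: "reflexive_representation act f I.V translation evaluation f"
  unfolding reflexive_representation_def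
proof (intro conjI allI)
  show refl: "reflexive_banach_space_on I.V"
    by (rule I.reflexive_V[OF relatively_weakly_compact_hull])
  show "antihomomorphism I.V translation"
    unfolding antihomomorphism_def
  proof (intro conjI allI impI translation_contraction)
    show "translation (s * t) = compose (vcarrier I.V) (translation t) (translation s)" for s t
      by (rule ext) (simp add: translation_def compose_def carrier_translate(1) translate_translate restrict_def)
    show "translation e = (\<lambda>v\<in>vcarrier I.V. v)" if "is_identity e" for e
      by (auto simp: translation_def translate_identity[OF that])
  qed
  show "continuous_map euclidean (subtopology (weak_topology (dual_space I.V)) (dual_ball I.V)) evaluation"
    unfolding continuous_map_in_subtopology
  proof
    show "evaluation \<in> topspace euclidean \<rightarrow> dual_ball I.V"
      using evaluation_dual by (auto simp: dual_ball_def)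
    show "continuous_map euclidean (weak_topology (dual_space I.V)) evaluation"
      unfolding weak_topology_def
    proof (rule continuous_on_generated_topo)
      fix S assume "S \<in> {{v \<in> vcarrier (dual_space I.V). \<phi> v \<in> U} |\<phi> U.
        \<phi> \<in> vcarrier (dual_space (dual_space I.V)) \<and> open U}"
      then show "openin euclidean (evaluation -` S \<inter> topspace euclidean)"
      proof (elim CollectE exE conjE)
        fix \<Xi> and B :: "real set"
        assume S: "S = {v \<in> vcarrier (dual_space I.V). \<Xi> v \<in> B}"
          and "\<Xi> \<in> vcarrier (dual_space (dual_space I.V))" and B: "open B"
        then have "\<Xi> \<in> dual_carrier (dual_space I.V)" by simp
        \<comment> \<open>By reflexivity a functional on the dual is evaluation at some
          \<open>u\<close> in the space, and \<open>u\<close> is a continuous function on the flow;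
          this gives the weak continuity of \<open>evaluation\<close>.\<close>
        then obtain u where u: "u \<in> vcarrier I.V" "\<And>\<phi>. \<phi> \<in> dual_carrier I.V \<Longrightarrow> \<Xi> \<phi> = \<phi> u"
          by (rule reflexive_bidual[OF refl]) blast
        have "evaluation -` S = apply_bcontfun u -` B"
          using u evaluation_dual(1) by (auto simp: S evaluation_def)
        moreover have "open (apply_bcontfun u -` B)"
          using B continuous_on_apply_bcontfun[of UNIV u] continuous_on_open_vimage[OF open_UNIV, of "apply_bcontfun u"]
          by simp
        ultimately show ?thesis by simp
      qed
    next
      \<comment> \<open>Continuity into a generated topology also asks that the range lie in the
        union of the generating sets; a single preimage of \<open>UNIV\<close> suffices.\<close>
      have "evaluation x \<in> {v \<in> vcarrier (dual_space I.V). (\<lambda>\<phi>\<in>dual_carrier I.V. \<phi> 0) v \<in> UNIV}" for x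
        using evaluation_dual(1) by simp
      moreover have zero: "(\<lambda>\<phi>\<in>dual_carrier I.V. \<phi> 0) \<in> vcarrier (dual_space (dual_space I.V))"
        using bidual_embedding[OF I.normed_V, of 0] I.zero_mem by simp
      have "{v \<in> vcarrier (dual_space I.V). (\<lambda>\<phi>\<in>dual_carrier I.V. \<phi> 0) v \<in> UNIV} \<in>
          {{v \<in> vcarrier (dual_space I.V). \<phi> v \<in> U} |\<phi> U. \<phi> \<in> vcarrier (dual_space (dual_space I.V)) \<and> open U}"
        by (rule CollectI, rule exI[of _ "\<lambda>\<phi>\<in>dual_carrier I.V. \<phi> 0"], rule exI[of _ UNIV])
          (use zero in \<open>simp del: dual_space_simps I.V_simps\<close>)
      ultimately show "evaluation ` topspace euclidean \<subseteq> \<Union> {{v \<in> vcarrier (dual_space I.V). \<phi> v \<in> U} |\<phi> U.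
        \<phi> \<in> vcarrier (dual_space (dual_space I.V)) \<and> open U}"
        by (intro image_subsetI UnionI)
    qed
  qed
  show "evaluation (act s x) = dual_action I.V translation s (evaluation x)" for s x
    by (rule ext) (simp add: evaluation_def dual_action_def translation_def restrict_def carrier_translate(1))
  show "f \<in> vcarrier I.V" using f_mem by simp
  show "apply_bcontfun f x = evaluation x f" for x
    using f_mem by (simp add: evaluation_def)
qed

text \<open>The translates of \<open>u\<close> stay in one ball, so along an ultrafilter they have a
  weak limit in the ambient space. Continuity of \<open>t \<mapsto> act t x\<close> identifies it
  pointwise, and \<open>weak_limit_dual_V\<close> passes to all functionals on the interpolation
  space.\<close>

lemma translation_weakly_continuous: "weakly_continuous I.V translation"
  unfolding weakly_continuous_def weak_op_topology_def
proof (rule continuous_on_generated_topo)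
  fix S assume "S \<in> {{\<sigma> \<in> contractions I.V. \<phi> (\<sigma> v) \<in> U} |v \<phi> U.
    v \<in> vcarrier I.V \<and> \<phi> \<in> vcarrier (dual_space I.V) \<and> open U}"
  then show "openin euclidean (translation -` S \<inter> topspace euclidean)"
  proof (elim CollectE exE conjE)
    fix u \<phi> and B :: "real set"
    assume S: "S = {\<sigma> \<in> contractions I.V. \<phi> (\<sigma> u) \<in> B}"
      and "u \<in> vcarrier I.V" "\<phi> \<in> vcarrier (dual_space I.V)" and B: "open B"
    then have u: "u \<in> I.carrier" and \<phi>: "\<phi> \<in> dual_carrier I.V" by simp_all
    have lim: "((\<lambda>t. \<phi> (translate act u t)) \<longlongrightarrow> \<phi> (translate act u s)) (nhds s)" for s
    proof (rule tendsto_ultrafilterI)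
      fix G assume G: "ultrafilter G" "G \<le> nhds s"
      let ?H = "filtermap (translate act u) G"
      have H: "ultrafilter ?H" by (rule ultrafilter_filtermap[OF G(1)])
      have ev: "eventually (\<lambda>v. v \<in> I.ball (I.N u)) ?H"
        using carrier_translate[OF u] by (auto simp: eventually_filtermap I.ball_def)
      obtain w where w: "weak_limit w ?H"
        using I.relatively_weakly_compact_ball[OF relatively_weakly_compact_hull I.N_nonneg[OF u]] H ev
        unfolding relatively_weakly_compact_def by blast
      have "w = translate act u s"
      proof (rule bcontfun_eqI)
        fix x
        have "(blinfun_apply (Blinfun (\<lambda>u. apply_bcontfun u x)) \<longlongrightarrow>
            blinfun_apply (Blinfun (\<lambda>u. apply_bcontfun u x)) w) ?H"
          using w unfolding weak_limit_def by blast
        then have "((\<lambda>t. apply_bcontfun u (act t x)) \<longlongrightarrow> apply_bcontfun w x) G"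
          by (simp add: bounded_linear_Blinfun_apply bounded_linear_apply_bcontfun filterlim_filtermap)
        moreover have "continuous_on UNIV (\<lambda>t. apply_bcontfun u (act t x))"
          by (rule continuous_on_compose2[OF continuous_on_apply_bcontfun[of UNIV u] flowD(2)]) simp
        then have "((\<lambda>t. apply_bcontfun u (act t x)) \<longlongrightarrow> apply_bcontfun u (act s x)) G"
          using G(2) continuous_on_UNIV_nhds filterlim_mono by blast
        ultimately show "apply_bcontfun w x = apply_bcontfun (translate act u s) x"
          using tendsto_unique[OF ultrafilter_not_bot[OF G(1)]] by simp
      qed
      then show "((\<lambda>t. \<phi> (translate act u t)) \<longlongrightarrow> \<phi> (translate act u s)) G"
        using I.weak_limit_dual_V[OF I.N_nonneg[OF u] H ev w \<phi>] by (simp add: filterlim_filtermap)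
    qed
    have "translation -` S = (\<lambda>t. \<phi> (translate act u t)) -` B"
      using translation_contraction u by (auto simp: S translation_def)
    moreover have "open ((\<lambda>t. \<phi> (translate act u t)) -` B)"
      using continuous_on_UNIV_tendstoI[of "\<lambda>t. \<phi> (translate act u t)", OF lim] B
        continuous_on_open_vimage[OF open_UNIV, of "\<lambda>t. \<phi> (translate act u t)"] by simp
    ultimately show ?thesis by simp
  qed
next
  \<comment> \<open>Types are nonempty, so some point, and with it some functional, is available for
    the trivial generating set.\<close>
  obtain x :: 'x where True by blast
  have "translation s \<in> {\<sigma> \<in> contractions I.V. evaluation x (\<sigma> 0) \<in> UNIV}" for s
    using translation_contraction by simp
  moreover have mem: "evaluation x \<in> vcarrier (dual_space I.V)" "0 \<in> vcarrier I.V"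
    using evaluation_dual I.zero_mem by auto
  have "{\<sigma> \<in> contractions I.V. evaluation x (\<sigma> 0) \<in> UNIV} \<in> {{\<sigma> \<in> contractions I.V. \<phi> (\<sigma> v) \<in> U} |v \<phi> U.
      v \<in> vcarrier I.V \<and> \<phi> \<in> vcarrier (dual_space I.V) \<and> open U}"
    by (rule CollectI, rule exI[of _ 0], rule exI[of _ "evaluation x"], rule exI[of _ UNIV])
      (use mem in \<open>simp del: dual_space_simps I.V_simps\<close>)
  ultimately show "translation ` topspace euclidean \<subseteq> \<Union> {{\<sigma> \<in> contractions I.V. \<phi> (\<sigma> v) \<in> U} |v \<phi> U.
    v \<in> vcarrier I.V \<and> \<phi> \<in> vcarrier (dual_space I.V) \<and> open U}"
    by (intro image_subsetI UnionI)
qed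

text \<open>Dominated convergence for the series: translations do not increase any
  \<open>K k\<close>, so each term is at most \<open>4 * (I.K k u)\<^sup>2\<close>, a summable
  bound, while every single term tends to 0 with the sup norm.\<close>

lemma N_translate_tendsto:
  assumes u: "u \<in> I.carrier" "norm_continuous u"
  shows "((\<lambda>t. I.N (translate act u t - translate act u s)) \<longlongrightarrow> 0) (nhds s)"
proof -
  let ?d = "\<lambda>t. translate act u t - translate act u s"
  have d0: "((\<lambda>t. norm (?d t)) \<longlongrightarrow> 0) (nhds s)"
    using u(2) unfolding norm_continuous_def by (intro tendsto_norm_zero LIM_zero) blast
  have K0: "((\<lambda>t. I.K k (?d t)) \<longlongrightarrow> 0) (nhds s)" for k
  proof (rule tendsto_sandwich[OF _ _ tendsto_const])
    show "eventually (\<lambda>t. 0 \<le> I.K k (?d t)) (nhds s)" by simp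
    show "eventually (\<lambda>t. I.K k (?d t) \<le> 2 ^ k * norm (?d t)) (nhds s)" using I.K_le_norm by simp
    show "((\<lambda>t. 2 ^ k * norm (?d t)) \<longlongrightarrow> 0) (nhds s)"
      by (rule tendsto_mult_right_zero[OF d0])
  qed
  have bound: "(I.K k (?d t))\<^sup>2 \<le> 4 * (I.K k u)\<^sup>2" for k t
  proof -
    have "I.K k (?d t) \<le> I.K k (translate act u t) + I.K k (translate act u s)"
      using I.K_add[of k "translate act u t" "- translate act u s"] I.K_scale[of k "-1" "translate act u s"] by simp
    also have "\<dots> \<le> 2 * I.K k u"
      using carrier_translate(3)[OF u(1), of k t] carrier_translate(3)[OF u(1), of k s] by simp
    finally have "(I.K k (?d t))\<^sup>2 \<le> (2 * I.K k u)\<^sup>2" by (rule power_mono) simp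
    then show ?thesis by (simp add: power_mult_distrib)
  qed
  have "eventually (\<lambda>t. summable (\<lambda>k. norm ((I.K k (?d t))\<^sup>2))) (nhds s) \<and> summable (\<lambda>k. norm (0::real)) \<and>
      ((\<lambda>t. \<Sum>k. (I.K k (?d t))\<^sup>2) \<longlongrightarrow> (\<Sum>k. 0)) (nhds s)"
  proof (rule tannerys_theorem[where M="\<lambda>k. 4 * (I.K k u)\<^sup>2"])
    show "((\<lambda>t. (I.K k (?d t))\<^sup>2) \<longlongrightarrow> 0) (nhds s)" for k
      using tendsto_power[OF K0, of k 2] by simp
    show "summable (\<lambda>k. 4 * (I.K k u)\<^sup>2)"
      using u(1) by (intro summable_mult) (simp add: I.carrier_def)
    show "eventually (\<lambda>(k, t). norm ((I.K k (?d t))\<^sup>2) \<le> 4 * (I.K k u)\<^sup>2) (at_top \<times>\<^sub>F nhds s)"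
      using bound by (intro always_eventually) auto
  qed simp
  then have "((\<lambda>t. sqrt (\<Sum>k. (I.K k (?d t))\<^sup>2)) \<longlongrightarrow> sqrt 0) (nhds s)"
    by (intro tendsto_real_sqrt) simp
  then show ?thesis by (simp add: I.N_def)
qed

lemma translation_strongly_continuous:
  assumes "\<And>u. u \<in> I.carrier \<Longrightarrow> norm_continuous u"
  shows "strongly_continuous I.V translation"
  unfolding strongly_continuous_def strong_op_topology_def
proof (rule continuous_on_generated_topo)
  fix S assume "S \<in> {{\<sigma> \<in> contractions I.V. vnorm I.V (vdiff I.V (\<sigma> v) w) < r} |v w r.
    v \<in> vcarrier I.V \<and> w \<in> vcarrier I.V}"
  then show "openin euclidean (translation -` S \<inter> topspace euclidean)"
  proof (elim CollectE exE conjE)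
    fix u w and r :: real
    assume S: "S = {\<sigma> \<in> contractions I.V. vnorm I.V (vdiff I.V (\<sigma> u) w) < r}"
      and "u \<in> vcarrier I.V" "w \<in> vcarrier I.V"
    then have u: "u \<in> I.carrier" and w: "w \<in> I.carrier" by simp_all
    have eq: "translation -` S = {t. I.N (translate act u t - w) < r}"
      using translation_contraction u by (auto simp: S translation_def)
    have "open {t. I.N (translate act u t - w) < r}"
    proof (rule open_eventuallyI)
      fix s assume s: "s \<in> {t. I.N (translate act u t - w) < r}"
      have "eventually (\<lambda>t. I.N (translate act u t - translate act u s) < r - I.N (translate act u s - w)) (nhds s)"
        by (rule order_tendstoD(2)[OF N_translate_tendsto[OF u assms[OF u]]]) (use s in auto)
      then show "eventually (\<lambda>t. t \<in> {t. I.N (translate act u t - w) < r}) (nhds s)"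
      proof eventually_elim
        case (elim t)
        have "I.N (translate act u t - w) \<le> I.N (translate act u t - translate act u s) + I.N (translate act u s - w)"
          using I.N_add[OF I.diff_mem[OF carrier_translate(1)[OF u] carrier_translate(1)[OF u]]
              I.diff_mem[OF carrier_translate(1)[OF u] w], of t s s] by simp
        with elim show ?case by simp
      qed
    qed
    with eq show ?thesis by simp
  qed
next
  have "translation s \<in> {\<sigma> \<in> contractions I.V. vnorm I.V (vdiff I.V (\<sigma> 0) 0) < 1}" for s
    using translation_contraction I.zero_mem I.N_zero linear_0[OF linear_translate] by (simp add: translation_def)
  moreover have zero: "0 \<in> vcarrier I.V" using I.zero_mem by simp
  have "{\<sigma> \<in> contractions I.V. vnorm I.V (vdiff I.V (\<sigma> 0) 0) < 1} \<in>
      {{\<sigma> \<in> contractions I.V. vnorm I.V (vdiff I.V (\<sigma> v) w) < r} |v w r. v \<in> vcarrier I.V \<and> w \<in> vcarrier I.V}"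
    by (rule CollectI, rule exI[of _ 0], rule exI[of _ 0], rule exI[of _ 1])
      (use zero in \<open>simp del: I.V_simps\<close>)
  ultimately show "translation ` topspace euclidean \<subseteq> \<Union> {{\<sigma> \<in> contractions I.V. vnorm I.V (vdiff I.V (\<sigma> v) w) < r} |v w r.
    v \<in> vcarrier I.V \<and> w \<in> vcarrier I.V}"
    by (intro image_subsetI UnionI)
qed

text \<open>Functions with norm continuous orbit map form a closed subspace containing the
  generators. A splitting for \<open>K n u\<close> with large \<open>n\<close> makes every element
  of the carrier a norm limit of multiples of hull elements.\<close>

lemma norm_continuous_carrier:
  assumes "norm_continuous f" "u \<in> I.carrier"
    and orb: "\<And>s. norm_continuous (translate act f s)"
  shows "norm_continuous u"
proof (rule norm_continuous_closure)
  fix \<epsilon> :: real assume \<epsilon>: "0 < \<epsilon>"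
  have "convex hull gens \<subseteq> Collect norm_continuous"
  proof (rule hull_minimal)
    show "gens \<subseteq> Collect norm_continuous"
      using assms(1) orb norm_continuous_scaleR by (auto simp: gens_def orbit_def simp del: scaleR_minus_left)
    show "convex (Collect norm_continuous)"
      by (rule convexI) (auto intro: norm_continuous_add norm_continuous_scaleR)
  qed
  then have hull: "norm_continuous w" if "w \<in> convex hull gens" for w using that by blast
  define c where "c = I.N u + 1"
  obtain n where n: "c / \<epsilon> < 2 ^ n"
    using real_arch_pow[of 2 "c / \<epsilon>"] by auto
  have "I.K n u < c" using I.K_le_N[OF assms(2), of n] by (simp add: c_def)
  then obtain r w where rw: "0 \<le> r" "w \<in> convex hull gens" "r / 2 ^ n + 2 ^ n * norm (u - r *\<^sub>R w) < c"
    by (rule I.K_less)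
  have "0 \<le> r / 2 ^ n" using rw(1) by simp
  with rw(3) have "2 ^ n * norm (u - r *\<^sub>R w) \<le> c" by linarith
  also have "c \<le> 2 ^ n * \<epsilon>" using n \<epsilon> by (simp add: pos_divide_less_eq)
  finally have "norm (u - r *\<^sub>R w) \<le> \<epsilon>" by simp
  with norm_continuous_scaleR[OF hull[OF rw(2)]] show "\<exists>z. norm_continuous z \<and> norm (u - z) \<le> \<epsilon>"
    by (intro exI[of _ "r *\<^sub>R w"] conjI)
qed

end

end


section \<open>Norm continuity of translations\<close>

text \<open>Otherwise members of \<open>A\<close> can be chosen in shrinking open sets that stay
  away from the convex hull of all earlier choices. By Mazur a weak limit of the choices is close to
  one of these hulls, although the separation persists in the limit.\<close>

lemma small_pointwise_open:
  fixes A :: "('x::topological_space \<Rightarrow>\<^sub>C real) set"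
  assumes A: "relatively_weakly_compact A" "A \<noteq> {}" and \<epsilon>: "0 < \<epsilon>"
  obtains U g where "open U" "g \<in> A" "apply_bcontfun g \<in> U"
    "\<And>g h. g \<in> A \<Longrightarrow> h \<in> A \<Longrightarrow> apply_bcontfun g \<in> U \<Longrightarrow> apply_bcontfun h \<in> U \<Longrightarrow> norm (g - h) \<le> \<epsilon>"
proof (rule ccontr)
  assume no: "\<not> thesis"
  note thesisI = that
  have big: "\<exists>g h. g \<in> A \<and> h \<in> A \<and> apply_bcontfun g \<in> U \<and> apply_bcontfun h \<in> U \<and> \<epsilon> < norm (g - h)"
    if U: "open U" "k \<in> A" "apply_bcontfun k \<in> U" for U k
  proof (rule ccontr)
    assume n: "\<not> ?thesis"
    have thesis
    proof (rule thesisI[OF U])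
      fix g h assume "g \<in> A" "h \<in> A" "apply_bcontfun g \<in> U" "apply_bcontfun h \<in> U"
      with n show "norm (g - h) \<le> \<epsilon>" by (simp add: not_less[symmetric])
    qed
    with no show False ..
  qed
  define meets where "meets U \<longleftrightarrow> open U \<and> (\<exists>k\<in>A. apply_bcontfun k \<in> U)" for U
  \<comment> \<open>One coordinate \<open>x\<close> serves for the whole set \<open>U\<close>, so
    the estimate survives pointwise limits as a weak inequality.\<close>
  define far where "far d U \<longleftrightarrow> (\<exists>x. \<forall>g\<in>U. \<epsilon> / 2 < \<bar>g x - apply_bcontfun d x\<bar>)"
    for d :: "'x \<Rightarrow>\<^sub>C real" and U :: "('x \<Rightarrow> real) set"
  have avoid: "\<exists>U'\<subseteq>U. meets U' \<and> far d U'" if U: "meets U" for U d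
  proof -
    obtain g h where gh: "g \<in> A" "h \<in> A" "apply_bcontfun g \<in> U" "apply_bcontfun h \<in> U" "\<epsilon> < norm (g - h)"
      using U big unfolding meets_def by blast
    \<comment> \<open>Two points more than \<open>\<epsilon>\<close> apart cannot both lie within
      \<open>\<epsilon> / 2\<close> of \<open>d\<close>.\<close>
    have "norm (g - h) \<le> norm (g - d) + norm (h - d)"
      using norm_triangle_ineq4[of "g - d" "h - d"] by simp
    then have "\<epsilon> / 2 < norm (g - d) \<or> \<epsilon> / 2 < norm (h - d)" using gh(5) by linarith
    then obtain k where k: "k \<in> A" "apply_bcontfun k \<in> U" "\<epsilon> / 2 < norm (k - d)" using gh by blast
    have "\<exists>x. \<epsilon> / 2 < \<bar>k x - d x\<bar>"
    proof (rule ccontr)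
      assume "\<not> ?thesis"
      then have "norm (k - d) \<le> \<epsilon> / 2" by (intro norm_bound) (simp add: not_less)
      with k(3) show False by simp
    qed
    then obtain x where x: "\<epsilon> / 2 < \<bar>k x - d x\<bar>" by blast
    have "open {g :: 'x \<Rightarrow> real. \<epsilon> / 2 < \<bar>g x - d x\<bar>}"
      by (intro open_Collect_less continuous_intros) simp
    then have "meets (U \<inter> {g. \<epsilon> / 2 < \<bar>g x - d x\<bar>})"
      using U k x unfolding meets_def by (auto intro!: open_Int)
    moreover have "far d (U \<inter> {g. \<epsilon> / 2 < \<bar>g x - d x\<bar>})"
      unfolding far_def by auto
    ultimately show ?thesis by blast
  qed
  have avoid_finite: "\<exists>U'\<subseteq>U. meets U' \<and> (\<forall>d\<in>D. far d U')" if "finite D" "meets U" for D U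
    using that
  proof (induction D arbitrary: U rule: finite_induct)
    case empty
    then show ?case by blast
  next
    case (insert d D)
    then obtain U1 where U1: "U1 \<subseteq> U" "meets U1" "\<forall>d\<in>D. far d U1" by meson
    obtain U2 where U2: "U2 \<subseteq> U1" "meets U2" "far d U2" using avoid[OF U1(2)] by blast
    have "far e U2" if "e \<in> D" for e
      using U1(3) U2(1) that unfolding far_def by blast
    with U1 U2 show ?case by blast
  qed
  define P where "P n s \<longleftrightarrow> (case s of (S, U, k) \<Rightarrow> finite S \<and> k \<in> S \<and> open U \<and> k \<in> A \<and> apply_bcontfun k \<in> U)"
    for n :: nat and s :: "('x \<Rightarrow>\<^sub>C real) set \<times> ('x \<Rightarrow> real) set \<times> ('x \<Rightarrow>\<^sub>C real)"
  define Q where "Q n s s' \<longleftrightarrow> (case s of (S, U, k) \<Rightarrow> case s' of (S', U', k') \<Rightarrow> S \<subseteq> S' \<and> U' \<subseteq> U \<and>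
      (\<forall>c\<in>convex hull S. \<exists>d. dist c d < \<epsilon> / 4 \<and> far d U'))"
    for n :: nat and s s' :: "('x \<Rightarrow>\<^sub>C real) set \<times> ('x \<Rightarrow> real) set \<times> ('x \<Rightarrow>\<^sub>C real)"
  have "\<exists>s. \<forall>n. P n (s n) \<and> Q n (s n) (s (Suc n))"
  proof (rule dependent_nat_choice)
    obtain k where "k \<in> A" using A(2) by blast
    then show "\<exists>s. P 0 s"
      by (intro exI[of _ "({k}, UNIV, k)"]) (simp add: P_def)
  next
    fix s n assume s: "P n s"
    obtain S U k where s_eq: "s = (S, U, k)" by (cases s)
    have S: "finite S" and U: "meets U" using s by (auto simp: s_eq P_def meets_def)
    \<comment> \<open>An \<open>\<epsilon> / 4\<close>-net of the hull leaves only finitely many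
      points to be avoided.\<close>
    have "compact (convex hull S)" by (rule finite_imp_compact_convex_hull[OF S])
    then obtain D where D: "finite D" "convex hull S \<subseteq> (\<Union>d\<in>D. ball d (\<epsilon> / 4))"
      using \<epsilon> unfolding compact_eq_totally_bounded by (meson divide_pos_pos zero_less_numeral)
    obtain U' where U': "U' \<subseteq> U" "meets U'" "\<forall>d\<in>D. far d U'"
      using avoid_finite[OF D(1) U] by blast
    obtain k' where k': "k' \<in> A" "apply_bcontfun k' \<in> U'" using U'(2) by (auto simp: meets_def)
    have "P (Suc n) (insert k' S, U', k')"
      using S U'(2) k' by (simp add: P_def meets_def)
    moreover have "Q n s (insert k' S, U', k')"
      unfolding Q_def s_eq prod.case
    proof (intro conjI ballI)
      fix c assume "c \<in> convex hull S"
      then obtain d where "d \<in> D" "c \<in> ball d (\<epsilon> / 4)" using D(2) by blast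
      then show "\<exists>d. dist c d < \<epsilon> / 4 \<and> far d U'"
        using U'(3) by (auto simp: dist_commute)
    qed (use U'(1) in auto)
    ultimately show "\<exists>s'. P (Suc n) s' \<and> Q n s s'" by blast
  qed
  then obtain s where s: "\<And>n. P n (s n)" "\<And>n. Q n (s n) (s (Suc n))" by blast
  define S where "S n = fst (s n)" for n
  define U where "U n = fst (snd (s n))" for n
  define k where "k n = snd (snd (s n))" for n
  have s_eq: "s n = (S n, U n, k n)" for n by (simp add: S_def U_def k_def)
  have Pn: "k n \<in> S n" "k n \<in> A" "apply_bcontfun (k n) \<in> U n" for n
    using s(1)[of n] by (auto simp: s_eq P_def)
  have Qn: "S n \<subseteq> S (Suc n)" "U (Suc n) \<subseteq> U n"
    "c \<in> convex hull (S n) \<Longrightarrow> \<exists>d. dist c d < \<epsilon> / 4 \<and> far d (U (Suc n))" for n c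
    using s(2)[of n] by (auto simp: s_eq Q_def)
  have S_mono: "S m \<subseteq> S n" if "m \<le> n" for m n using that Qn(1) by (rule lift_Suc_mono_le[rotated])
  have U_anti: "U n \<subseteq> U m" if "m \<le> n" for m n using that Qn(2) by (rule lift_Suc_antimono_le[rotated])
  obtain \<N> :: "nat filter" where \<N>: "\<N> \<le> sequentially" "ultrafilter \<N>"
    using ultrafilter_exists[OF sequentially_bot] by blast
  let ?H = "filtermap k \<N>"
  have H: "ultrafilter ?H" by (rule ultrafilter_filtermap[OF \<N>(2)])
  have "eventually (\<lambda>v. v \<in> A) ?H" using Pn(2) by (simp add: eventually_filtermap)
  then obtain u where u: "weak_limit u ?H"
    using A(1) H unfolding relatively_weakly_compact_def by blast
  have u_x: "((\<lambda>n. k n x) \<longlongrightarrow> u x) \<N>" for x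
  proof -
    have "(blinfun_apply (Blinfun (\<lambda>u. apply_bcontfun u x)) \<longlongrightarrow> blinfun_apply (Blinfun (\<lambda>u. apply_bcontfun u x)) u) ?H"
      using u unfolding weak_limit_def by blast
    then show ?thesis
      by (simp add: bounded_linear_Blinfun_apply bounded_linear_apply_bcontfun filterlim_filtermap)
  qed
  let ?C = "\<Union>n. convex hull (S n)"
  have "convex ?C"
  proof (rule convexI)
    fix x y and a b :: real assume *: "x \<in> ?C" "y \<in> ?C" "0 \<le> a" "0 \<le> b" "a + b = 1"
    then obtain m n where "x \<in> convex hull (S m)" "y \<in> convex hull (S n)" by blast
    then have "x \<in> convex hull (S (max m n))" "y \<in> convex hull (S (max m n))"
      using hull_mono[OF S_mono[of m "max m n"], of convex] hull_mono[OF S_mono[of n "max m n"], of convex] by auto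
    then have "a *\<^sub>R x + b *\<^sub>R y \<in> convex hull (S (max m n))"
      using * by (intro convexD[OF convex_convex_hull])
    then show "a *\<^sub>R x + b *\<^sub>R y \<in> ?C" by blast
  qed
  moreover have "k n \<in> convex hull (S n)" for n by (rule hull_inc[OF Pn(1)])
  then have "eventually (\<lambda>v. v \<in> ?C) ?H" by (auto simp: eventually_filtermap intro!: always_eventually)
  ultimately have "u \<in> closure ?C"
    by (rule Mazur_weak_limit[OF _ ultrafilter_not_bot[OF H] _ u])
  then obtain c where c: "c \<in> ?C" "dist c u < \<epsilon> / 4"
    using \<epsilon> by (meson closure_approachable divide_pos_pos zero_less_numeral)
  then obtain n where "c \<in> convex hull (S n)" by blast
  then obtain d where d: "dist c d < \<epsilon> / 4" "far d (U (Suc n))" using Qn(3) by blast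
  then obtain x where x: "\<forall>g\<in>U (Suc n). \<epsilon> / 2 < \<bar>g x - d x\<bar>" by (auto simp: far_def)
  have "\<epsilon> / 2 \<le> \<bar>u x - d x\<bar>"
  proof (rule tendsto_lowerbound[OF _ _ ultrafilter_not_bot[OF \<N>(2)]])
    show "((\<lambda>n. \<bar>k n x - d x\<bar>) \<longlongrightarrow> \<bar>u x - d x\<bar>) \<N>" by (intro tendsto_intros u_x)
    have "\<epsilon> / 2 \<le> \<bar>k m x - d x\<bar>" if "m \<ge> Suc n" for m
      using x Pn(3)[of m] U_anti[OF that] by (auto intro: less_imp_le)
    then have "eventually (\<lambda>m. \<epsilon> / 2 \<le> \<bar>k m x - d x\<bar>) sequentially"
      unfolding eventually_sequentially by blast
    then show "eventually (\<lambda>m. \<epsilon> / 2 \<le> \<bar>k m x - d x\<bar>) \<N>" by (rule filter_leD[OF \<N>(1)])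
  qed
  also have "\<bar>u x - d x\<bar> \<le> norm (u - d)" using norm_bounded[of "u - d" x] by simp
  also have "\<dots> = dist u d" by (simp add: dist_norm)
  also have "\<dots> \<le> dist c u + dist c d" by (rule dist_triangle3)
  also have "\<dots> < \<epsilon> / 2" using c(2) d(1) by simp
  finally show False by simp
qed

section \<open>Norm continuity for groups and for compact flows\<close>

context
  fixes act :: "'s::semitopological_semigroup \<Rightarrow> 'x::topological_space \<Rightarrow> 'x"
  assumes flow: "semitopological_flow act"
begin

text \<open>The small open piece is found around the translate by \<open>b\<close>, not by
  \<open>s\<close>. Right multiplication by \<open>s' * b\<close> carries \<open>s\<close> to
  \<open>b\<close>, and \<open>t \<mapsto> translate act f (t * (s' * b))\<close> is pointwise
  continuous. The norm estimate obtained there is brought back by the translation by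
  \<open>b' * s\<close>.\<close>

lemma norm_continuous_group:
  assumes G: "is_group TYPE('s)" and wap: "weakly_almost_periodic act f"
  shows "norm_continuous act f"
  unfolding norm_continuous_def[OF flow]
proof (intro allI tendstoI)
  fix s and \<epsilon> :: real assume \<epsilon>: "0 < \<epsilon>"
  obtain e :: 's where e: "is_identity e" "\<And>s. \<exists>t. s * t = e \<and> t * s = e"
    using G unfolding is_group_def by blast
  have id: "e * a = a" "a * e = a" for a using e(1) by (auto simp: is_identity_def)
  obtain U g where U: "open U" "g \<in> range (translate act f)" "apply_bcontfun g \<in> U"
    and small: "\<And>g h. g \<in> range (translate act f) \<Longrightarrow> h \<in> range (translate act f) \<Longrightarrow>
      apply_bcontfun g \<in> U \<Longrightarrow> apply_bcontfun h \<in> U \<Longrightarrow> norm (g - h) \<le> \<epsilon> / 2"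
    using small_pointwise_open[OF relatively_weakly_compact_orbit[OF flow wap], of "\<epsilon> / 2"] \<epsilon> by auto
  obtain b where b: "g = translate act f b" using U(2) by blast
  obtain s' where s': "s * s' = e" "s' * s = e" using e(2) by blast
  obtain b' where b': "b * b' = e" "b' * b = e" using e(2) by blast
  have move_back: "translate act (translate act f (t * (s' * b))) (b' * s) = translate act f t" for t
  proof -
    have "t * (s' * b) * (b' * s) = t * (s' * ((b * b') * s))" by (simp add: mult.assoc)
    also have "\<dots> = t" by (simp add: b'(1) id s'(2))
    finally show ?thesis by (simp add: translate_translate[OF flow])
  qed
  have sb: "s * (s' * b) = b" by (simp add: s'(1) id flip: mult.assoc)
  have "continuous_on UNIV (\<lambda>t. apply_bcontfun (translate act f (t * (s' * b))))"
  proof (rule continuous_on_coordinatewise_then_product)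
    fix x
    have "continuous_on UNIV (\<lambda>t. apply_bcontfun f (act t (act (s' * b) x)))"
      by (rule continuous_on_compose2[OF continuous_on_apply_bcontfun[of UNIV f] flowD(2)[OF flow]]) simp
    then show "continuous_on UNIV (\<lambda>t. apply_bcontfun (translate act f (t * (s' * b))) x)"
      by (simp add: apply_translate[OF flow] flowD(3)[OF flow])
  qed
  then have "((\<lambda>t. apply_bcontfun (translate act f (t * (s' * b)))) \<longlongrightarrow> apply_bcontfun (translate act f (s * (s' * b)))) (nhds s)"
    by (rule continuous_on_UNIV_nhds)
  then have "eventually (\<lambda>t. apply_bcontfun (translate act f (t * (s' * b))) \<in> U) (nhds s)"
    by (rule topological_tendstoD[OF _ U(1)]) (use U(3) in \<open>simp add: sb b\<close>)
  then show "eventually (\<lambda>t. dist (translate act f t) (translate act f s) < \<epsilon>) (nhds s)"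
  proof eventually_elim
    case (elim t)
    let ?d = "translate act f (t * (s' * b)) - translate act f (s * (s' * b))"
    have "translate act f t - translate act f s = translate act ?d (b' * s)"
      unfolding linear_diff[OF linear_translate[OF flow]] move_back ..
    then have "norm (translate act f t - translate act f s) \<le> norm ?d"
      using norm_translate_le[OF flow, of ?d] by simp
    also have "\<dots> \<le> \<epsilon> / 2"
      by (rule small) (use elim U(3) in \<open>auto simp: sb b\<close>)
    finally show ?case using \<epsilon> by (simp add: dist_norm)
  qed
qed

lemma norm_continuous_compact:
  fixes u :: "'x \<Rightarrow>\<^sub>C real"
  assumes X: "compact (UNIV :: 'x set)" and act: "continuous_on UNIV (\<lambda>(s, x). act s x)"
  shows "norm_continuous act u"
  unfolding norm_continuous_def[OF flow]
proof (intro allI tendstoI)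
  fix s and \<epsilon> :: real assume \<epsilon>: "0 < \<epsilon>"
  have ev: "eventually (\<lambda>t. \<forall>x. \<bar>u (act t x) - u (act s x)\<bar> \<le> \<epsilon> / 2) (nhds s)"
  proof (rule ccontr)
    let ?bad = "\<lambda>t. \<not> (\<forall>x. \<bar>u (act t x) - u (act s x)\<bar> \<le> \<epsilon> / 2)"
    assume "\<not> ?thesis"
    then have "inf (nhds s) (principal (Collect ?bad)) \<noteq> bot"
      by (simp add: trivial_limit_def eventually_inf_principal)
    then obtain G where G: "G \<le> inf (nhds s) (principal (Collect ?bad))" "ultrafilter G"
      by (rule ultrafilter_exists)
    then have Gs: "G \<le> nhds s" and bad: "eventually ?bad G"
      by (simp_all add: le_principal)
    have "\<forall>t. \<exists>x. ?bad t \<longrightarrow> \<epsilon> / 2 < \<bar>u (act t x) - u (act s x)\<bar>" by (auto simp: not_le)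
    then obtain x where x: "\<And>t. ?bad t \<Longrightarrow> \<epsilon> / 2 < \<bar>u (act t (x t)) - u (act s (x t))\<bar>" by metis
    obtain y where y: "(x \<longlongrightarrow> y) G"
      using ultrafilter_compact_limit[OF G(2) X, of x] by auto
    have t: "((\<lambda>t. t) \<longlongrightarrow> s) G" using Gs by (simp add: filterlim_def)
    have cont: "continuous_on UNIV (\<lambda>p. apply_bcontfun u (case p of (s, x) \<Rightarrow> act s x))"
      by (rule continuous_on_compose2[OF continuous_on_apply_bcontfun[of UNIV u] act]) simp
    \<comment> \<open>Used for \<open>a\<close> the identity and for \<open>a\<close> constantly
      \<open>s\<close>; joint continuity gives both terms the same limit.\<close>
    have lim: "((\<lambda>t. u (act (a t) (x t))) \<longlongrightarrow> u (act s y)) G" if a: "(a \<longlongrightarrow> s) G" for a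
      using continuous_on_tendsto_compose[OF cont tendsto_Pair[OF a y]] by simp
    have "((\<lambda>t. \<bar>u (act t (x t)) - u (act s (x t))\<bar>) \<longlongrightarrow> \<bar>u (act s y) - u (act s y)\<bar>) G"
      by (intro tendsto_intros lim t tendsto_const)
    moreover have "eventually (\<lambda>t. \<epsilon> / 2 \<le> \<bar>u (act t (x t)) - u (act s (x t))\<bar>) G"
      using bad by eventually_elim (use x in \<open>auto intro: less_imp_le\<close>)
    ultimately have "\<epsilon> / 2 \<le> \<bar>u (act s y) - u (act s y)\<bar>"
      by (intro tendsto_lowerbound[OF _ _ ultrafilter_not_bot[OF G(2)]])
    with \<epsilon> show False by simp
  qed
  then show "eventually (\<lambda>t. dist (translate act u t) (translate act u s) < \<epsilon>) (nhds s)"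
  proof eventually_elim
    case (elim t)
    have "norm (translate act u t - translate act u s) \<le> \<epsilon> / 2"
      by (rule norm_bound) (use elim in \<open>simp add: apply_translate[OF flow]\<close>)
    then show ?case using \<epsilon> by (simp add: dist_norm)
  qed
qed

lemma strongly_continuous_representation:
  assumes wap: "weakly_almost_periodic act f" and nc: "norm_continuous act f" "\<And>s. norm_continuous act (translate act f s)"
  shows "\<exists>(V :: ('x \<Rightarrow>\<^sub>C real) normed_structure) h \<alpha> v.
    reflexive_representation act f V h \<alpha> v \<and> strongly_continuous V h"
  using translation_representation[OF flow wap] translation_strongly_continuous[OF flow wap norm_continuous_carrier[OF flow wap nc(1) _ nc(2)]]
  by blast

text \<open>The orbit map of a translate is that of \<open>f\<close> after left multiplication by
  \<open>s\<close>, which is continuous. This supplies the condition on the remaining generators in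
  \<open>norm_continuous_carrier\<close>.\<close>

lemma norm_continuous_translate:
  assumes "norm_continuous act f"
  shows "norm_continuous act (translate act f s)"
  unfolding norm_continuous_def[OF flow]
proof
  fix t
  have "continuous_on UNIV (\<lambda>t. s * t)"
    unfolding continuous_on_open_vimage[OF open_UNIV] using continuous_mult_left by auto
  then have "((\<lambda>t. s * t) \<longlongrightarrow> s * t) (nhds t)" by (rule continuous_on_UNIV_nhds)
  then have "filterlim (\<lambda>t. s * t) (nhds (s * t)) (nhds t)" .
  then have "((\<lambda>t. translate act f (s * t)) \<longlongrightarrow> translate act f (s * t)) (nhds t)"
    using assms unfolding norm_continuous_def[OF flow] by (blast intro: filterlim_compose)
  moreover have "translate act (translate act f s) = (\<lambda>t. translate act f (s * t))"
    by (simp add: fun_eq_iff translate_translate[OF flow])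
  ultimately show "(translate act (translate act f s) \<longlongrightarrow> translate act (translate act f s) t) (nhds t)"
    by simp
qed

end

theorem theorem4p6:
  fixes act :: "'s::semitopological_semigroup \<Rightarrow> 'x::topological_space \<Rightarrow> 'x"
    and f :: "'x \<Rightarrow>\<^sub>C real"
  assumes "semitopological_flow act"
  shows
    "(weakly_almost_periodic act f \<longleftrightarrow>
       (\<exists>(V :: ('x \<Rightarrow>\<^sub>C real) normed_structure) h \<alpha> v.
          reflexive_representation act f V h \<alpha> v \<and> weakly_continuous V h))
     \<and> (weakly_almost_periodic act f \<longleftrightarrow>
       (\<exists>(V :: ('x \<Rightarrow>\<^sub>C real) normed_structure) h \<alpha> v.
          reflexive_representation act f V h \<alpha> v))
     \<and> (\<forall>(V :: 'v normed_structure) h \<alpha> v.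
          reflexive_representation act f V h \<alpha> v \<longrightarrow> weakly_almost_periodic act f)
     \<and> (is_group TYPE('s) \<or>
        (compact_space (euclidean :: 'x topology) \<and> Hausdorff_space (euclidean :: 'x topology) \<and>
         continuous_on UNIV (\<lambda>(s, x). act s x))
        \<longrightarrow> (weakly_almost_periodic act f \<longleftrightarrow>
              (\<exists>(V :: ('x \<Rightarrow>\<^sub>C real) normed_structure) h \<alpha> v.
                 reflexive_representation act f V h \<alpha> v \<and> strongly_continuous V h)))"
proof (intro conjI)
  note imp_wap = reflexive_representation_imp_wap[OF assms]
  show "weakly_almost_periodic act f \<longleftrightarrow>
       (\<exists>(V :: ('x \<Rightarrow>\<^sub>C real) normed_structure) h \<alpha> v.
          reflexive_representation act f V h \<alpha> v \<and> weakly_continuous V h)"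
    \<comment> \<open>A single construction serves conditions (ii) and (iii): the translations on
      the interpolation space are already weakly continuous.\<close>
    using imp_wap translation_representation[OF assms] translation_weakly_continuous[OF assms] by meson
  show "weakly_almost_periodic act f \<longleftrightarrow>
       (\<exists>(V :: ('x \<Rightarrow>\<^sub>C real) normed_structure) h \<alpha> v. reflexive_representation act f V h \<alpha> v)"
    using imp_wap translation_representation[OF assms] by meson
  show "\<forall>(V :: 'v normed_structure) h \<alpha> v.
          reflexive_representation act f V h \<alpha> v \<longrightarrow> weakly_almost_periodic act f"
    using imp_wap by meson
  show "is_group TYPE('s) \<or>
        (compact_space (euclidean :: 'x topology) \<and> Hausdorff_space (euclidean :: 'x topology) \<and>
         continuous_on UNIV (\<lambda>(s, x). act s x))
        \<longrightarrow> (weakly_almost_periodic act f \<longleftrightarrow>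
              (\<exists>(V :: ('x \<Rightarrow>\<^sub>C real) normed_structure) h \<alpha> v.
                 reflexive_representation act f V h \<alpha> v \<and> strongly_continuous V h))"
  proof (intro impI iffI)
    assume cases: "is_group TYPE('s) \<or>
        (compact_space (euclidean :: 'x topology) \<and> Hausdorff_space (euclidean :: 'x topology) \<and>
         continuous_on UNIV (\<lambda>(s, x). act s x))" and wap: "weakly_almost_periodic act f"
    have "norm_continuous act f"
      using cases
    proof
      assume "is_group TYPE('s)"
      then show ?thesis by (rule norm_continuous_group[OF assms _ wap])
    next
      assume c: "compact_space (euclidean :: 'x topology) \<and> Hausdorff_space (euclidean :: 'x topology) \<and>
         continuous_on UNIV (\<lambda>(s, x). act s x)"
      then have "compact (UNIV :: 'x set)" by (simp add: compact_space_def)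
      with c show ?thesis by (intro norm_continuous_compact[OF assms]) auto
    qed
    then show "\<exists>(V :: ('x \<Rightarrow>\<^sub>C real) normed_structure) h \<alpha> v.
        reflexive_representation act f V h \<alpha> v \<and> strongly_continuous V h"
      by (intro strongly_continuous_representation[OF assms wap] norm_continuous_translate[OF assms])
  next
    assume "\<exists>(V :: ('x \<Rightarrow>\<^sub>C real) normed_structure) h \<alpha> v.
        reflexive_representation act f V h \<alpha> v \<and> strongly_continuous V h"
    then show "weakly_almost_periodic act f" using imp_wap by meson
  qed
qed

end
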